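(* Let $2\leq d\leq 10$ and consider the equation \[ (x+1)^2+(x+2)^2+\cdots+(x+d)^2=y^n \] in integers $x,y$ and $n\geq 2$. The only solutions $(d,x,y,n)$ with $n\geq 3$ are \[ (2,-1,\pm 1,2r),\quad (2,-2,\pm 1,2r),\quad (2,-1,1,2r+1),\quad (2,-2,1,2r+1),\quad (2,118,\pm 13,4),\quad (2,-121,\pm 13,4), \] where $r$ is an integer (with the exponent $n$ being at least $3$). The only solutions with $n=2$ form the infinite family with $d=2$ and \[ 2x+3+y\sqrt{2}=\pm(1+\sqrt{2})^{2r+1},\qquad r\in\mathbb{Z}. \] *)

theory Defs imports Complex_Main begin
end

theory Submission
  imports Defs "HOL-Analysis.Analysis" "HOL-Number_Theory.Quadratic_Reciprocity"
begin

text \<open>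
  Completing the square, \<open>d \<notin> {2, 3, 6}\<close> is impossible by a congruence to a small prime power, and the
  remaining cases are \<open>u\<^sup>2 + 1 = 2 y\<^sup>n\<close>, \<open>3 u\<^sup>2 + 2 = y\<^sup>n\<close> and \<open>3 u\<^sup>2 + 35 = 2 y\<^sup>n\<close>.

  For odd \<open>n\<close> a pigeonhole argument yields a small representation \<open>A s\<^sup>2 + B t\<^sup>2 = C y\<close> compatible with the
  given one, which turns the equation into the statement that a Lehmer number of odd index is \<open>\<plusminus>1\<close>.
  For the first two equations this is refuted two-adically. For the third one a two-adic solution
  exists, and it is excluded by quadratic residues modulo 5, 7, the exponent (taken prime) and
  \<open>(3 s\<^sup>2 - 35) / 8\<close>.

  For even \<open>n\<close> only \<open>u\<^sup>2 + 1 = 2 y\<^sup>n\<close> survives; \<open>n = 2\<close> is the negative Pell equation and the powers of two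
  reduce to Ljunggren's equation \<open>u\<^sup>2 + 1 = 2 y\<^sup>4\<close>. There \<open>u + \<i>\<close> is, up to units and conjugation, \<open>(1 + \<i>) z\<^sup>4\<close> with
  \<open>y = |z|\<^sup>2\<close>, so \<open>z / cnj z\<close> is very close to a fourth root of \<open>-\<i>\<close>. Since \<open>3 + 2 \<i>\<close> is already a good
  approximation, Thue's method with Pade approximants to the fourth root bounds \<open>y\<close>, and the remaining
  \<open>y\<close> are found by checking which of the first solutions of the Pell equation are squares.
\<close>

subsection \<open>Elementary congruences\<close>

text \<open>Thue's method needs a fixed approximation that is already very good. Each Pade step
  multiplies the linear form by 8 |z1|^4, which clears denominators, while the remainder shrinks by
  about 4 |1 - x|^2, where x is the fourth root near 1 of cnj X1 / X1 and X1 = (1 + \<i>) z1^4. The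
  trivial solution y = 1, with z1 = 1, loses more than it gains. The solution 239^2 + 1 = 2 * 13^4,
  that is z1 = 3 + 2 \<i> and X1 = -239 + \<i>, gives |1 - x| <= 1/470, and 1352 * 4 / 470^2 is
  below 1/40. So the exceptional solution itself provides the tool that bounds all others. The
  fields generated by the square roots of -6 and -105 lack unique factorisation. Instead of ideals,
  the pigeonhole principle represents a small multiple m C y by the form, and the few possible m are
  removed by congruences or by dividing out a square. A prime exponent p helps in the third equation
  because the binomial theorem then determines the Lehmer number modulo p.\<close>

lemma pos_of_odd_power: "0 < y ^ n \<Longrightarrow> odd n \<Longrightarrow> 0 < (y :: int)"
  by (auto simp: zero_less_power_eq)

lemma odd_of_square_plus_1: "u^2 + 1 = 2 * (z :: int) \<Longrightarrow> odd u"
  by (metis dvd_triv_left even_plus_one_iff even_power pos2)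

lemma odd_square_mod_8:
  fixes s :: int
  assumes "odd s"
  obtains e where "s^2 = 8 * e + 1" "e \<ge> 0"
proof -
  obtain c where "s = 2 * c + 1" using assms by (elim oddE)
  then have "s^2 = 4 * (c * (c + 1)) + 1" by (simp add: power2_eq_square algebra_simps)
  moreover have "even (c * (c + 1))" by simp
  then obtain e where "c * (c + 1) = 2 * e" by (elim evenE)
  ultimately have e: "s^2 = 8 * e + 1" by simp
  moreover have "e \<ge> 0" using e zero_le_power2[of s] by linarith
  ultimately show thesis by (rule that)
qed

lemma square_mod_3: "(x::int)^2 mod 3 = 0 \<or> x^2 mod 3 = 1"
proof -
  have "x^2 mod 3 = (x mod 3) * (x mod 3) mod 3" by (simp add: power2_eq_square mod_mult_eq)
  moreover have "x mod 3 = 0 \<or> x mod 3 = 1 \<or> x mod 3 = 2" by presburger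
  ultimately show ?thesis by auto
qed

lemma square_mod_4: "(x::int)^2 mod 4 = 0 \<or> x^2 mod 4 = 1"
proof -
  have "x^2 mod 4 = (x mod 4) * (x mod 4) mod 4" by (simp add: power2_eq_square mod_mult_eq)
  moreover have "x mod 4 = 0 \<or> x mod 4 = 1 \<or> x mod 4 = 2 \<or> x mod 4 = 3" by presburger
  ultimately show ?thesis by auto
qed

lemma mod_5_cases: "(x::int) mod 5 = 0 \<or> x mod 5 = 1 \<or> x mod 5 = 2 \<or> x mod 5 = 3 \<or> x mod 5 = 4"
proof -
  have "r = 0 \<or> r = 1 \<or> r = 2 \<or> r = 3 \<or> r = 4" if "0 \<le> r" "r < 5" for r :: int
    using that by linarith
  then show ?thesis by simp
qed

lemma square_mod_5: "(x::int)^2 mod 5 = 0 \<or> x^2 mod 5 = 1 \<or> x^2 mod 5 = 4"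
proof -
  have "x^2 mod 5 = (x mod 5) * (x mod 5) mod 5" by (simp add: power2_eq_square mod_mult_eq)
  then show ?thesis using mod_5_cases[of x] by auto
qed

lemma mod_7_cases:
  fixes x :: int
  shows "x mod 7 = 0 \<or> x mod 7 = 1 \<or> x mod 7 = 2 \<or> x mod 7 = 3 \<or> x mod 7 = 4 \<or> x mod 7 = 5 \<or> x mod 7 = 6"
proof -
  have "r = 0 \<or> r = 1 \<or> r = 2 \<or> r = 3 \<or> r = 4 \<or> r = 5 \<or> r = 6" if "0 \<le> r" "r < 7" for r :: int
    using that by linarith
  then show ?thesis by simp
qed

lemma square_mod_7: "(x::int)^2 mod 7 = 0 \<or> x^2 mod 7 = 1 \<or> x^2 mod 7 = 2 \<or> x^2 mod 7 = 4"
proof -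
  have "x^2 mod 7 = (x mod 7) * (x mod 7) mod 7" by (simp add: power2_eq_square mod_mult_eq)
  then show ?thesis using mod_7_cases[of x] by auto
qed

lemma odd_power_mod_in:
  fixes y m :: int
  assumes "y mod m \<in> X" "\<And>a b. a \<in> X \<Longrightarrow> b \<in> X \<Longrightarrow> a * a mod m * b mod m \<in> X"
  shows "y ^ (2 * i + 1) mod m \<in> X"
proof (induction i)
  case (Suc i)
  have "y ^ (2 * Suc i + 1) = (y * y) * y ^ (2 * i + 1)" by simp
  then have "y ^ (2 * Suc i + 1) mod m = ((y mod m) * (y mod m) mod m) * (y ^ (2 * i + 1) mod m) mod m"
    by (simp only: mod_mult_eq)
  then show ?case using assms(2)[OF assms(1) Suc] by simp
qed (use assms in simp)

lemma pos_eq_power_2_times_odd: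
  assumes "(n::nat) > 0"
  obtains v k where "odd k" "n = 2 ^ v * k"
  using assms
proof (induction n arbitrary: thesis rule: less_induct)
  case (less n)
  show ?case
  proof (cases "odd n")
    case True
    then show ?thesis using less.prems(1)[of n 0] by simp
  next
    case False
    then have "even n" by simp
    then obtain m where m: "n = 2 * m" by (elim evenE)
    then obtain v k where "odd k" "m = 2 ^ v * k" using less.IH[of m] less.prems(2) by auto
    then show ?thesis using less.prems(1)[of k "Suc v"] m by simp
  qed
qed

subsection \<open>Pade approximants to the fourth root\<close>

lemma sum_choose_alternating_Suc:
  fixes f :: "nat \<Rightarrow> real"
  shows "(\<Sum>l\<le>Suc r. (-1)^l * real (Suc r choose l) * f l)
    = (\<Sum>l\<le>r. (-1)^l * real (r choose l) * f l) - (\<Sum>l\<le>r. (-1)^l * real (r choose l) * f (Suc l))"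
proof -
  let ?T = "(\<Sum>l\<le>r. (-1)^l * real (r choose l) * f (Suc l))"
  let ?U = "(\<Sum>l\<le>r. (-1)^Suc l * real (r choose Suc l) * f (Suc l))"
  have "(\<Sum>l\<le>Suc r. (-1)^l * real (Suc r choose l) * f l)
      = f 0 + (\<Sum>l\<le>r. (-1)^Suc l * real (Suc r choose Suc l) * f (Suc l))"
    by (subst sum.atMost_Suc_shift) simp
  also have "(\<Sum>l\<le>r. (-1)^Suc l * real (Suc r choose Suc l) * f (Suc l))
      = ?U - ?T"
    by (subst sum_subtractf [symmetric], rule sum.cong) (auto simp: algebra_simps)
  also have "f 0 + (?U - ?T)
    = (\<Sum>l\<le>Suc r. (-1)^l * real (r choose l) * f l) - ?T"
    by (simp only: sum.atMost_Suc_shift[of _ r]) simp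
  finally show ?thesis by simp
qed

text \<open>These are the partial fractions of r! / (a (a + 1) ... (a + r)). Pascal's rule turns the
  sum for \<open>Suc r\<close> into the difference of the sums for \<open>r\<close> at
  \<open>a\<close> and at \<open>a + 1\<close>, and the right side satisfies the same
  recursion.\<close>

lemma sum_choose_alternating_inverse:
  fixes a :: real
  assumes "\<And>l::nat. a + real l \<noteq> 0"
  shows "(\<Sum>l\<le>r. (-1)^l * real (r choose l) * inverse (a + real l)) = fact r / pochhammer a (Suc r)"
  using assms
proof (induction r arbitrary: a)
  case 0
  then show ?case by (simp add: field_simps)
next
  case (Suc r)
  have nz: "(a + 1) + real l \<noteq> 0" for l using Suc.prems[of "Suc l"] by (simp add: algebra_simps)
  have p: "pochhammer a (Suc r) \<noteq> 0" "pochhammer (a+1) (Suc r) \<noteq> 0"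
    using Suc.prems nz by (auto simp: pochhammer_eq_0_iff) (metis add.commute add_eq_0_iff)+
  have e1: "pochhammer a (Suc (Suc r)) = pochhammer a (Suc r) * (a + real (Suc r))"
    by (simp add: pochhammer_Suc)
  have e2: "pochhammer a (Suc (Suc r)) = a * pochhammer (a+1) (Suc r)"
    by (simp add: pochhammer_rec)
  have nz0: "a \<noteq> 0" "a + real (Suc r) \<noteq> 0" using Suc.prems[of 0] Suc.prems[of "Suc r"] by auto
  have "(\<Sum>l\<le>Suc r. (-1)^l * real (Suc r choose l) * inverse (a + real l))
     = (\<Sum>l\<le>r. (-1)^l * real (r choose l) * inverse (a + real l)) - (\<Sum>l\<le>r. (-1)^l * real (r choose l) * inverse (a + real (Suc l)))"
    by (rule sum_choose_alternating_Suc)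
  also have "(\<Sum>l\<le>r. (-1)^l * real (r choose l) * inverse (a + real (Suc l))) = fact r / pochhammer (a+1) (Suc r)"
    using Suc.IH[OF nz] by (simp add: algebra_simps)
  also have "(\<Sum>l\<le>r. (-1)^l * real (r choose l) * inverse (a + real l)) = fact r / pochhammer a (Suc r)"
    by (rule Suc.IH) (use Suc.prems in auto)
  also have "fact r / pochhammer a (Suc r) - fact r / pochhammer (a+1) (Suc r) = fact r * (a + real (Suc r)) / pochhammer a (Suc (Suc r)) - fact r * a / pochhammer a (Suc (Suc r))"
  proof -
    have "fact r / pochhammer a (Suc r) = fact r * (a + real (Suc r)) / pochhammer a (Suc (Suc r))"
      unfolding e1 using nz0 p by simp
    moreover have "fact r / pochhammer (a+1) (Suc r) = fact r * a / pochhammer a (Suc (Suc r))"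
      unfolding e2 using nz0 p by simp
    ultimately show ?thesis by simp
  qed
  also have "\<dots> = fact (Suc r) / pochhammer a (Suc (Suc r))"
    by (simp add: field_simps flip: add_divide_distrib)
  finally show ?case .
qed

text \<open>Diagonal Pade approximants to the fourth root, scaled so that \<open>padeA r (x\<^sup>4) - x * padeB r (x\<^sup>4)\<close>
  vanishes to order \<open>2 r + 1\<close> at \<open>x = 1\<close>. The remainder is a multiple of
  \<open>\<integral> ((w\<^sup>4 - x\<^sup>4) (1 - w\<^sup>4) / w\<^sup>4)\<^sup>r dw\<close> from \<open>x\<close> to \<open>1\<close>.\<close>

definition pcoeff :: "nat \<Rightarrow> nat \<Rightarrow> real" where
  "pcoeff r k = ((real r + 1/4) gchoose k) * ((real r - 1/4) gchoose (r - k))"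

definition padeA :: "nat \<Rightarrow> complex \<Rightarrow> complex" where
  "padeA r u = (\<Sum>k\<le>r. of_real (pcoeff r k) * u ^ k)"

definition padeB :: "nat \<Rightarrow> complex \<Rightarrow> complex" where
  "padeB r u = (\<Sum>k\<le>r. of_real (pcoeff r k) * u ^ (r - k))"

text \<open>The factor that turns the endpoint values of the primitive of the remainder integrand
  into \<open>padeA\<close> and \<open>x * padeB\<close>. For the estimates it only has to lie
  between 0 and 1.\<close>

definition pade_scale :: "nat \<Rightarrow> real" where
  "pade_scale r = pochhammer (3/4) r * pochhammer (5/4) r / (fact r)^2"

text \<open>The factors run from 1/4 - k up to 1/4 - k + r: the k negative ones give
  \<open>pochhammer (3/4) k\<close> with a sign, then comes 1/4, then the larger ones.\<close>

lemma pochhammer_quarter_shift: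
  assumes "k \<le> r"
  shows "pochhammer (1/4 - real k) (Suc r) = (-1)^k * pochhammer (3/4) k * (1/4) * pochhammer (5/4) (r - k)"
proof -
  have "pochhammer (1/4 - real k) (Suc r) = pochhammer (1/4 - real k) k * pochhammer (1/4) (Suc (r-k))"
    using pochhammer_product[of k "Suc r" "1/4 - real k"] assms by (simp add: Suc_diff_le)
  also have "pochhammer (1/4 - real k) k = (-1)^k * pochhammer (3/4) k"
    using pochhammer_minus[of "real k - 1/4" k] by (simp add: algebra_simps)
  also have "pochhammer (1/4::real) (Suc (r-k)) = (1/4) * pochhammer (5/4) (r-k)"
    by (simp add: pochhammer_rec)
  finally show ?thesis by simp
qed

text \<open>In this form the coefficient is what \<open>sum_choose_alternating_inverse\<close> with
  a = 1/4 - k produces when the remainder integrand is expanded and integrated term by term.\<close>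

lemma pcoeff_partial_fraction:
  assumes "k \<le> r"
  shows "pcoeff r k = pade_scale r * (-1)^k * real (r choose k) * (1/4) * fact r / pochhammer (1/4 - real k) (Suc r)"
proof -
  have a: "pochhammer (3/4::real) r = pochhammer (3/4) k * pochhammer (3/4 + real k) (r - k)"
    using pochhammer_product[of k r "3/4::real"] assms by simp
  have b: "pochhammer (5/4::real) r = pochhammer (5/4) (r-k) * pochhammer (5/4 + real (r-k)) k"
    using pochhammer_product[of "r-k" r "5/4::real"] assms by simp
  have p: "pochhammer (3/4::real) k > 0" "pochhammer (5/4::real) (r-k) > 0"
    by (auto intro!: pochhammer_pos)
  have c: "real (r choose k) = fact r / (fact k * fact (r-k))"
    using assms by (simp add: binomial_fact)
  have d: "pcoeff r k = pochhammer (5/4 + real (r-k)) k / fact k * (pochhammer (3/4 + real k) (r-k) / fact (r-k))"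
    unfolding pcoeff_def gbinomial_pochhammer' using assms by (simp add: of_nat_diff algebra_simps)
  have s: "((-1)^k * (-1)^k :: real) = 1" by (simp flip: power_mult_distrib)
  have "(-1::real)^k \<noteq> 0" by simp
  then show ?thesis
    unfolding d pade_scale_def pochhammer_quarter_shift[OF assms] c a b using p
    by (simp add: divide_simps power2_eq_square)
qed

lemma pcoeff_pos: "k \<le> r \<Longrightarrow> pcoeff r k > 0"
  unfolding pcoeff_def gbinomial_pochhammer' by (auto intro!: mult_pos_pos divide_pos_pos pochhammer_pos simp: of_nat_diff)

text \<open>Vandermonde convolution, since (r + 1/4) + (r - 1/4) = 2 r. As the coefficients are
  positive, this bounds both approximants by 4^r wherever the argument has norm at most 1.\<close>

lemma sum_pcoeff: "(\<Sum>k\<le>r. pcoeff r k) = real (2 * r choose r)"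
proof -
  have "(\<Sum>k\<le>r. pcoeff r k) = (real (2*r)) gchoose r"
    unfolding pcoeff_def using gbinomial_Vandermonde[of "real r + 1/4" "real r - 1/4" r]
    by (simp add: atMost_atLeast0)
  then show ?thesis by (simp add: binomial_gbinomial)
qed

lemma norm_padeA_le: "norm u = 1 \<Longrightarrow> norm (padeA r u) \<le> 4 ^ r"
proof -
  assume u: "norm u = 1"
  have "norm (padeA r u) \<le> (\<Sum>k\<le>r. norm (of_real (pcoeff r k) * u ^ k))"
    unfolding padeA_def by (rule norm_sum)
  also have "\<dots> = (\<Sum>k\<le>r. pcoeff r k)"
    by (rule sum.cong) (use pcoeff_pos u in \<open>auto simp: norm_mult norm_power abs_of_pos\<close>)
  also have "\<dots> \<le> 4 ^ r"
    unfolding sum_pcoeff using binomial_le_pow2[of "2*r" r]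
    by (simp add: power_mult)
  finally show ?thesis .
qed

lemma pade_scale_nonneg: "pade_scale r \<ge> 0" unfolding pade_scale_def by (simp add: pochhammer_nonneg)

lemma pade_scale_le_1: "pade_scale r \<le> 1"
proof (induction r)
  case 0 then show ?case by (simp add: pade_scale_def)
next
  case (Suc r)
  have "pade_scale (Suc r) = pade_scale r * (((3/4 + real r) * (5/4 + real r)) / (real (Suc r))^2)"
    unfolding pade_scale_def pochhammer_Suc fact_Suc power_mult_distrib of_nat_mult by (simp add: mult_ac)
  also have "\<dots> \<le> 1 * 1"
  proof (intro mult_mono Suc pade_scale_nonneg)
    have "(3/4 + real r) * (5/4 + real r) \<le> (real (Suc r))^2"
      by (simp add: power2_eq_square algebra_simps)
    then show "(3/4 + real r) * (5/4 + real r) / (real (Suc r))^2 \<le> 1"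
      by (simp add: divide_le_eq_1)
  qed auto
  finally show ?case by simp
qed

text \<open>Termwise antiderivative in \<open>w\<close> of ((w^4 - x^4) (1 - w^4) / w^4)^r, after
  expanding both binomials. The exponents 4 (l - k) + 1 may be negative but are never 0, so no
  logarithm occurs.\<close>

definition pade_primitive :: "nat \<Rightarrow> complex \<Rightarrow> complex \<Rightarrow> complex" where
  "pade_primitive r x w = (\<Sum>k\<le>r. \<Sum>l\<le>r. of_nat (r choose k) * (- (x^4)) ^ k * (of_nat (r choose l) * (-1)^l)
      * (w powi (4 * (int l - int k) + 1) / of_int (4 * (int l - int k) + 1)))"

lemma powi_4_mult: "(x::complex) powi (4 * i) = (x^4) powi i"
  by (simp only: power_int_mult power_int_numeral)

lemma pade_primitive_deriv:
  assumes "w \<noteq> 0"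
  shows "(pade_primitive r x has_field_derivative ((w^4 - x^4) * (1 - w^4) / w^4) ^ r) (at w within S)"
proof -
  have nz: "of_int (4 * (int l - int k) + 1) \<noteq> (0::complex)" for l k
    by (subst of_int_eq_0_iff) presburger
  have "(pade_primitive r x has_field_derivative (\<Sum>k\<le>r. \<Sum>l\<le>r. of_nat (r choose k) * (- (x^4)) ^ k * (of_nat (r choose l) * (-1)^l)
      * w powi (4 * (int l - int k)))) (at w within S)"
    unfolding pade_primitive_def
    apply (intro DERIV_sum DERIV_cmult)
    apply (rule DERIV_cong)
     apply (rule DERIV_cdivide)
     apply (rule DERIV_power_int[OF DERIV_ident])
    using assms by (auto simp: nz simp del: of_int_add of_int_diff of_int_mult of_int_numeral) presburger
  also have "(\<Sum>k\<le>r. \<Sum>l\<le>r. of_nat (r choose k) * (- (x^4)) ^ k * (of_nat (r choose l) * (-1)^l)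
      * w powi (4 * (int l - int k))) =
      (\<Sum>k\<le>r. of_nat (r choose k) * (- (x^4)) ^ k * (w^4)^(r-k)) * (\<Sum>l\<le>r. of_nat (r choose l) * (- (w^4))^l * 1^(r-l)) / (w^4)^r"
    unfolding sum_product sum_divide_distrib
  proof (intro sum.cong refl)
    fix k l assume "k \<in> {..r}" "l \<in> {..r}"
    then have k: "k \<le> r" by simp
    have "w powi (4 * (int l - int k)) = (w^4) powi (int l - int k)"
      by (rule powi_4_mult)
    also have "\<dots> = (w^4)^l / (w^4)^k"
      using assms by (simp add: power_int_diff)
    also have "\<dots> = (w^4)^l * (w^4)^(r-k) / (w^4)^r"
      using assms k by (simp add: field_simps flip: power_add)
    finally have *: "w powi (4 * (int l - int k)) = (w^4)^l * (w^4)^(r-k) / (w^4)^r" .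
    have "(- (w^4))^l = (-1)^l * (w^4)^l"
      by (metis mult_minus1 power_mult_distrib)
    then show "of_nat (r choose k) * (- (x^4)) ^ k * (of_nat (r choose l) * (-1)^l) * w powi (4 * (int l - int k))
      = of_nat (r choose k) * (- (x^4)) ^ k * (w^4)^(r-k) * (of_nat (r choose l) * (- (w^4))^l * 1^(r-l)) / (w^4)^r"
      unfolding * by simp
  qed
  also have "\<dots> = (- (x^4) + w^4)^r * (- (w^4) + 1)^r / (w^4)^r"
    by (simp only: binomial_ring)
  also have "\<dots> = ((w^4 - x^4) * (1 - w^4) / w^4) ^ r"
    by (simp add: power_mult_distrib power_divide)
  finally show ?thesis .
qed

lemma quarter_ne: "1/4 - real k + real l \<noteq> 0"
proof
  assume "1/4 - real k + real l = 0"
  then have "real (4 * k) = real (1 + 4 * l)" by simp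
  then have "4 * k = 1 + 4 * l" using of_nat_eq_iff by blast
  then show False by presburger
qed

text \<open>Coefficient of (x^4)^k in the primitive at the endpoint w = 1: the sum over
  \<open>l\<close> is evaluated by partial fractions.\<close>

lemma pade_scale_inner:
  assumes "k \<le> r"
  shows "pade_scale r * (-1)^k * real (r choose k) * (\<Sum>l\<le>r. (-1)^l * real (r choose l) * (1 / (4 * (real l - real k) + 1))) = pcoeff r k"
proof -
  have "(\<Sum>l\<le>r. (-1)^l * real (r choose l) * (1 / (4 * (real l - real k) + 1)))
     = (1/4) * (\<Sum>l\<le>r. (-1)^l * real (r choose l) * inverse (1/4 - real k + real l))"
    unfolding sum_distrib_left
    by (rule sum.cong) (use quarter_ne in \<open>auto simp: field_simps\<close>)
  also have "\<dots> = (1/4) * (fact r / pochhammer (1/4 - real k) (Suc r))"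
    by (subst sum_choose_alternating_inverse) (use quarter_ne in auto)
  finally show ?thesis using pcoeff_partial_fraction[OF assms] by simp
qed

lemma pade_primitive_1: "pade_scale r * pade_primitive r x 1 = padeA r (x^4)"
proof -
  have "pade_scale r * pade_primitive r x 1 = (\<Sum>k\<le>r. of_real (pade_scale r * (-1)^k * real (r choose k) * (\<Sum>l\<le>r. (-1)^l * real (r choose l) * (1 / (4 * (real l - real k) + 1)))) * (x^4)^k)"
    unfolding pade_primitive_def sum_distrib_left of_real_sum sum_distrib_right of_real_mult
    by (intro sum.cong refl) (simp add: power_minus[of "x^4"] mult_ac)
  also have "\<dots> = padeA r (x^4)"
    unfolding padeA_def by (intro sum.cong refl) (simp only: pade_scale_inner atMost_iff)
  finally show ?thesis .
qed

text \<open>Coefficient at the other endpoint w = x. There (x^4)^k times the power of w is x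
  (x^4)^l, so that now \<open>k\<close> is summed out. Reversing \<open>k\<close> to
  \<open>r - k\<close> reduces it to \<open>pade_scale_inner\<close> at
  \<open>r - l\<close>.\<close>

lemma pade_scale_inner':
  assumes "l \<le> r"
  shows "pade_scale r * (-1)^l * real (r choose l) * (\<Sum>k\<le>r. (-1)^k * real (r choose k) * (1 / (4 * (real l - real k) + 1))) = pcoeff r (r - l)"
proof -
  let ?K = "(\<Sum>k\<le>r. (-1)^k * real (r choose k) * (1 / (4 * (real l - real k) + 1)))"
  let ?K2 = "(\<Sum>k\<le>r. (-1)^k * real (r choose k) * (1 / (4 * (real k - real (r-l)) + 1)))"
  have "?K
     = (\<Sum>k\<le>r. (-1)^(r-k) * real (r choose (r-k)) * (1 / (4 * (real l - real (r-k)) + 1)))"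
    by (rule sum.reindex_bij_witness[of _ "\<lambda>k. r - k" "\<lambda>k. r - k"]) auto
  also have "\<dots> = (\<Sum>k\<le>r. (-1)^r * ((-1)^k * real (r choose k) * (1 / (4 * (real k - real (r-l)) + 1))))"
  proof (intro sum.cong refl)
    fix k assume "k \<in> {..r}"
    then have k: "k \<le> r" by simp
    have s: "(-1::real)^(r-k) = (-1)^r * (-1)^k"
      using k by (simp add: uminus_power_if)
    show "(-1)^(r-k) * real (r choose (r-k)) * (1 / (4 * (real l - real (r-k)) + 1)) = (-1)^r * ((-1)^k * real (r choose k) * (1 / (4 * (real k - real (r-l)) + 1)))"
      unfolding s using k assms by (simp add: binomial_symmetric[symmetric] of_nat_diff algebra_simps)
  qed
  also have "\<dots> = (-1)^r * ?K2"
    by (simp only: sum_distrib_left)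
  finally have e: "?K
    = (-1)^r * ?K2" .
  have g: "(-1::real)^(r-l) = (-1)^l * (-1)^r" using assms by (simp add: uminus_power_if)
  show ?thesis
    unfolding e using pade_scale_inner[of "r-l" r]
    by (simp only: g binomial_symmetric[OF assms, symmetric] mult_ac diff_le_self)
qed

lemma pade_primitive_x:
  assumes "x \<noteq> 0"
  shows "pade_scale r * pade_primitive r x x = x * padeB r (x^4)"
proof -
  have "pade_scale r * pade_primitive r x x = (\<Sum>l\<le>r. of_real (pade_scale r * (-1)^l * real (r choose l) * (\<Sum>k\<le>r. (-1)^k * real (r choose k) * (1 / (4 * (real l - real k) + 1)))) * (x * (x^4)^l))"
    unfolding pade_primitive_def
    apply (subst sum.swap)
    unfolding sum_distrib_left of_real_sum sum_distrib_right of_real_mult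
  proof (intro sum.cong refl)
    fix k l
    have "x powi (4 * (int l - int k) + 1) = x * (x^4) powi (int l - int k)"
      using assms powi_4_mult[of x "int l - int k"] by (simp add: power_int_add)
    also have "\<dots> = x * (x^4)^l / (x^4)^k"
      using assms by (simp add: power_int_diff)
    finally have *: "(x^4)^k * x powi (4 * (int l - int k) + 1) = x * (x^4)^l"
      using assms by simp
    let ?P = "complex_of_real (pade_scale r) *
       (of_nat (r choose k) * (- (x ^ 4)) ^ k * (of_nat (r choose l) * (- 1) ^ l) *
        (x powi (4 * (int l - int k) + 1) / of_int (4 * (int l - int k) + 1)))"
    have "?P
      = complex_of_real (pade_scale r) * of_nat (r choose k) * (-1)^k * of_nat (r choose l) * (-1)^l * ((x^4)^k * x powi (4 * (int l - int k) + 1)) / of_int (4 * (int l - int k) + 1)"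
      by (simp add: power_minus[of "x^4"] mult_ac)
    then show "?P =
       complex_of_real (pade_scale r) * complex_of_real ((- 1) ^ l) * complex_of_real (real (r choose l)) *
       (complex_of_real ((- 1) ^ k) * complex_of_real (real (r choose k)) *
        complex_of_real (1 / (4 * (real l - real k) + 1))) * (x * (x ^ 4) ^ l)"
      unfolding * by simp
  qed
  also have "\<dots> = (\<Sum>l\<le>r. of_real (pcoeff r (r - l)) * (x * (x^4)^l))"
    by (intro sum.cong refl) (simp only: pade_scale_inner' atMost_iff)
  also have "\<dots> = x * padeB r (x^4)"
    unfolding padeB_def sum_distrib_left
    by (rule sum.reindex_bij_witness[of _ "\<lambda>k. r - k" "\<lambda>k. r - k"]) auto
  finally show ?thesis .
qed

lemma norm_pow4_diff_le:
  fixes a b :: complex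
  assumes "norm a \<le> 1" "norm b \<le> 1"
  shows "norm (a^4 - b^4) \<le> 4 * norm (a - b)"
proof -
  have "a^4 - b^4 = (a - b) * (a^3 + a^2*b + a*b^2 + b^3)"
    by (simp add: algebra_simps power2_eq_square power3_eq_cube power4_eq_xxxx)
  moreover have "norm (a^3 + a^2*b + a*b^2 + b^3) \<le> norm (a^3) + norm (a^2*b) + norm (a*b^2) + norm (b^3)"
    by (intro norm_triangle_le add_mono order_refl)
  moreover have "norm (a^3) \<le> 1" "norm (a^2*b) \<le> 1" "norm (a*b^2) \<le> 1" "norm (b^3) \<le> 1"
    using assms by (auto simp: norm_mult norm_power intro!: power_le_one mult_le_one)
  ultimately have "norm (a^3 + a^2*b + a*b^2 + b^3) \<le> 4" "a^4 - b^4 = (a - b) * (a^3 + a^2*b + a*b^2 + b^3)" by auto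
  then show ?thesis
    using mult_left_mono[of _ 4 "norm (a - b)"] by (simp add: norm_mult mult_left_mono mult.commute[of _ "norm (a - b)"])
qed

text \<open>The remainder is bounded by the size of the integrand on the segment from x to 1 times
  its length. There |w - x| |1 - w| <= d^2 / 4 because t (1 - t) <= 1/4; each difference of fourth
  powers costs a factor 4, and |w| >= 1 - d bounds the denominator.\<close>

lemma pade_remainder:
  assumes x: "norm x \<le> 1" and d: "norm (1 - x) \<le> d" "d < 1"
  shows "norm (padeA r (x^4) - x * padeB r (x^4)) \<le> d * (4 * d^2 / (1-d)^4) ^ r"
proof -
  define S where "S = closed_segment x 1"
  have d0: "0 \<le> d" using d norm_ge_zero order_trans by blast
  have w: "norm w \<le> 1 \<and> norm w \<ge> 1 - d \<and> norm (w - x) * norm (1 - w) \<le> d^2 / 4" if wS: "w \<in> S" for w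
  proof -
    obtain t where t: "0 \<le> t" "t \<le> 1" "w = (1 - t) *\<^sub>R x + t *\<^sub>R 1"
      using wS unfolding S_def closed_segment_def by auto
    have "norm w \<le> (1-t) * norm x + t * 1"
      unfolding t(3) by (rule norm_triangle_le) (use t in auto)
    also have "\<dots> \<le> (1 - t) * 1 + t * 1" using x t by (intro add_mono mult_left_mono) auto
    finally have 1: "norm w \<le> 1" by simp
    have e: "1 - w = (1-t) *\<^sub>R (1 - x)" unfolding t(3) by (simp add: algebra_simps)
    have e': "w - x = t *\<^sub>R (1 - x)" unfolding t(3) by (simp add: algebra_simps)
    have n1: "norm (1 - w) = (1-t) * norm (1 - x)" unfolding e using t by simp
    have n2: "norm (w - x) = t * norm (1 - x)" unfolding e' using t by simp
    have "norm (1 - w) \<le> 1 * norm (1 - x)" unfolding n1 using t by (intro mult_right_mono) auto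
    moreover have "norm (1::complex) - norm w \<le> norm (1 - w)" by (rule norm_triangle_ineq2)
    ultimately have 2: "norm w \<ge> 1 - d" using d by simp
    have "t * (1-t) \<le> 1/4" using zero_le_power2[of "t - 1/2"] by (simp add: power2_eq_square algebra_simps)
    then have "(t * (1-t)) * (norm (1-x))^2 \<le> (1/4) * d^2"
      using d t by (intro mult_mono power_mono) auto
    then have 3: "norm (w - x) * norm (1 - w) \<le> d^2/4"
      unfolding n1 n2 by (simp add: power2_eq_square mult_ac)
    show ?thesis using 1 2 3 by simp
  qed
  have "norm (pade_primitive r x 1 - pade_primitive r x x) \<le> (4 * d^2 / (1-d)^4) ^ r * norm (1 - x)"
  proof (rule field_differentiable_bound[of S "pade_primitive r x" "\<lambda>w. ((w^4 - x^4) * (1 - w^4) / w^4) ^ r"])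
    show "convex S" unfolding S_def by simp
    show "1 \<in> S" "x \<in> S" unfolding S_def by auto
    fix w assume wS: "w \<in> S"
    have nw: "norm w \<ge> 1 - d" using w[OF wS] by simp
    then have "w \<noteq> 0" using d by auto
    then show "(pade_primitive r x has_field_derivative ((w^4 - x^4) * (1 - w^4) / w^4) ^ r) (at w within S)"
      by (rule pade_primitive_deriv)
    have "norm (w^4 - x^4) * norm (1^4 - w^4) \<le> (4 * norm (w - x)) * (4 * norm (1 - w))"
      using w[OF wS] x by (intro mult_mono norm_pow4_diff_le) auto
    also have "\<dots> = 16 * (norm (w - x) * norm (1 - w))" by simp
    also have "\<dots> \<le> 16 * (d^2 / 4)" using w[OF wS] by (intro mult_left_mono) auto
    finally have a: "norm (w^4 - x^4) * norm (1 - w^4) \<le> 4 * d^2" by simp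
    have b: "(1-d)^4 \<le> norm w ^ 4" using nw d by (intro power_mono) auto
    have "norm ((w^4 - x^4) * (1 - w^4) / w^4) \<le> 4 * d^2 / (1-d)^4"
      unfolding norm_mult norm_divide norm_power
      using a b d by (intro frac_le) auto
    then show "norm (((w^4 - x^4) * (1 - w^4) / w^4) ^ r) \<le> (4 * d^2 / (1-d)^4) ^ r"
      unfolding norm_power by (intro power_mono) auto
  qed
  also have "\<dots> \<le> (4 * d^2 / (1-d)^4) ^ r * d" using d by (intro mult_left_mono) auto
  finally have b: "norm (pade_primitive r x 1 - pade_primitive r x x) \<le> d * (4 * d^2 / (1-d)^4) ^ r" by (simp add: mult.commute)
  have "x \<noteq> 0" using d by auto
  then have "padeA r (x^4) - x * padeB r (x^4) = of_real (pade_scale r) * (pade_primitive r x 1 - pade_primitive r x x)"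
    using pade_primitive_1[of r x] pade_primitive_x[of x r] by (simp add: algebra_simps)
  then have "norm (padeA r (x^4) - x * padeB r (x^4)) = pade_scale r * norm (pade_primitive r x 1 - pade_primitive r x x)"
    using pade_scale_nonneg by (simp add: norm_mult)
  also have "\<dots> \<le> 1 * (d * (4 * d^2 / (1-d)^4) ^ r)"
    using pade_scale_le_1 pade_scale_nonneg b by (intro mult_mono) auto
  finally show ?thesis by simp
qed

section \<open>Denominators of the Pade coefficients\<close>

lemma fact_double_odd_part: "\<exists>d. odd d \<and> fact (2 * m) = 2 ^ m * fact m * (d::nat)"
proof (induction m)
  case (Suc m)
  then obtain d where d: "odd d" "fact (2 * m) = 2 ^ m * fact m * (d::nat)" by blast
  have "fact (2 * Suc m) = (2 * m + 2) * ((2 * m + 1) * fact (2 * m) :: nat)"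
    by (simp add: algebra_simps)
  also have "\<dots> = 2 ^ Suc m * fact (Suc m) * ((2 * m + 1) * d)"
    unfolding d(2) by (simp add: algebra_simps)
  finally show ?case using d(1) by (intro exI[of _ "(2 * m + 1) * d"]) simp
qed auto

text \<open>By halving, since (2 m)! has m factors 2 more than m!.\<close>

lemma fact_two_adic: "\<exists>e d. odd d \<and> e \<le> k \<and> fact k = 2 ^ e * (d::nat)"
proof (induction k rule: less_induct)
  case (less k)
  show ?case
  proof (cases "k = 0")
    case True
    then show ?thesis by (intro exI[of _ 0] exI[of _ 1]) simp
  next
    case False
    define m where "m = k div 2"
    obtain e d where ed: "odd d" "e \<le> m" "fact m = 2 ^ e * (d::nat)"
      using less.IH[of m] False unfolding m_def by auto
    obtain c where c: "odd c" "fact (2 * m) = 2 ^ m * fact m * (c::nat)"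
      using fact_double_odd_part by blast
    have k: "k = 2 * m \<or> k = Suc (2 * m)" unfolding m_def by linarith
    then show ?thesis
    proof
      assume "k = 2 * m"
      then show ?thesis using ed c
        by (intro exI[of _ "m + e"] exI[of _ "d * c"]) (simp add: power_add)
    next
      assume "k = Suc (2 * m)"
      then show ?thesis using ed c
        by (intro exI[of _ "m + e"] exI[of _ "Suc (2 * m) * d * c"]) (simp add: power_add del: mult_Suc)
    qed
  qed
qed

text \<open>The power of 2 in k! is absorbed by 2^k. Modulo the odd part, 4 has an inverse
  \<open>f\<close>, and f^k times the product is congruent to a product of k consecutive integers,
  which k! divides.\<close>

lemma fact_dvd_prod_step_4: "fact k dvd 2 ^ k * (\<Prod>j<k. m + 4 * int j)"
proof -
  obtain e d where ed: "odd d" "e \<le> k" "fact k = 2 ^ e * (d::nat)" using fact_two_adic by blast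
  have fk: "(fact k :: int) = 2 ^ e * int d"
    using ed(3) by (metis of_nat_fact of_nat_mult of_nat_numeral of_nat_power)
  have "coprime 4 (int d)"
    using ed(1) by (metis coprime_power_left_iff even_of_nat_iff coprime_left_2_iff_odd numeral_Bit0 power2_eq_square zero_less_numeral mult_2 numeral_Bit0_eq_double)
  then obtain f where f: "[4 * f = 1] (mod int d)" using cong_solve_coprime_int by blast
  have "[f ^ k * (\<Prod>j<k. m + 4 * int j) = (\<Prod>j<k. f * m + int j)] (mod int d)"
  proof -
    have "f ^ k * (\<Prod>j<k. m + 4 * int j) = (\<Prod>j<k. f * m + (4 * f) * int j)"
    proof -
      have "f ^ k * (\<Prod>j<k. m + 4 * int j) = (\<Prod>j<k. f * (m + 4 * int j))" by (simp add: prod.distrib)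
      then show ?thesis by (simp add: algebra_simps)
    qed
    moreover have "[(\<Prod>j<k. f * m + (4 * f) * int j) = (\<Prod>j<k. f * m + 1 * int j)] (mod int d)"
      by (intro cong_prod cong_add cong_mult cong_refl f)
    ultimately show ?thesis by simp
  qed
  moreover have "int d dvd (\<Prod>j<k. f * m + int j)"
  proof -
    have "fact k dvd pochhammer (f * m) k" by (rule fact_dvd_pochhammer)
    then have "int d dvd pochhammer (f * m) k" unfolding fk by (rule dvd_mult_right)
    then show ?thesis by (simp add: pochhammer_prod atLeast0LessThan)
  qed
  ultimately have "int d dvd f ^ k * (\<Prod>j<k. m + 4 * int j)"
    using cong_dvd_iff by blast
  moreover have "coprime (int d) (f ^ k)"
    using f by (metis cong_imp_coprime coprime_commute coprime_1_left cong_sym coprime_mult_left_iff coprime_power_right_iff)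
  ultimately have "int d dvd (\<Prod>j<k. m + 4 * int j)" by (simp add: coprime_dvd_mult_right_iff)
  moreover have "(2::int) ^ e dvd 2 ^ k" using ed(2) by (rule le_imp_power_dvd)
  ultimately show ?thesis unfolding fk by (rule mult_dvd_mono[rotated])
qed

text \<open>Of 8^k, the factor 4^k clears the quarters and 2^k the even part of k!.\<close>

lemma pochhammer_quarter_integral:
  "\<exists>z::int. 8 ^ k * (pochhammer (of_int m / 4) k / fact k :: real) = of_int z"
proof -
  obtain z where z: "2 ^ k * (\<Prod>j<k. m + 4 * int j) = fact k * z"
    using fact_dvd_prod_step_4[of k m] by (auto elim: dvdE)
  have "4 ^ k * pochhammer (of_int m / 4 :: real) k = (\<Prod>j<k. of_int (m + 4 * int j))"
  proof -
    have "4 ^ k * pochhammer (of_int m / 4 :: real) k = (\<Prod>j<k. 4 * (of_int m / 4 + real j))"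
      unfolding pochhammer_prod atLeast0LessThan by (simp only: prod.distrib prod_constant card_lessThan)
    also have "\<dots> = (\<Prod>j<k. of_int (m + 4 * int j))"
      by (intro prod.cong refl) (simp add: field_simps)
    finally show ?thesis .
  qed
  then have "8 ^ k * pochhammer (of_int m / 4 :: real) k = 2 ^ k * (\<Prod>j<k. of_int (m + 4 * int j))"
    using power_mult_distrib[of "2::real" 4 k] by simp
  also have "\<dots> = of_int (2 ^ k * (\<Prod>j<k. m + 4 * int j))" by simp
  also have "\<dots> = fact k * of_int z" unfolding z by simp
  finally show ?thesis by (intro exI[of _ z]) (simp add: field_simps)
qed

lemma pcoeff_integral:
  assumes "k \<le> r"
  shows "\<exists>z::int. 8 ^ r * pcoeff r k = of_int z"
proof -
  obtain a where a: "8 ^ k * (pochhammer (of_int (4 * int (r - k) + 5) / 4) k / fact k :: real) = of_int a"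
    using pochhammer_quarter_integral by blast
  obtain b where b: "8 ^ (r - k) * (pochhammer (of_int (4 * int k + 3) / 4) (r - k) / fact (r - k) :: real) = of_int b"
    using pochhammer_quarter_integral by blast
  have e1: "real r + 1/4 - real k + 1 = of_int (4 * int (r - k) + 5) / 4"
    using assms by (simp add: of_nat_diff field_simps)
  have e2: "real r - 1/4 - real (r - k) + 1 = of_int (4 * int k + 3) / 4"
    using assms by (simp add: of_nat_diff field_simps)
  have "pcoeff r k = (pochhammer (of_int (4 * int (r - k) + 5) / 4) k / fact k) * (pochhammer (of_int (4 * int k + 3) / 4) (r - k) / fact (r - k))"
    unfolding pcoeff_def gbinomial_pochhammer' e1 e2 ..
  moreover have "(8::real) ^ r = 8 ^ k * 8 ^ (r - k)" using assms by (simp flip: power_add)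
  ultimately have "8 ^ r * pcoeff r k = of_int (a * b)"
    unfolding of_int_mult a[symmetric] b[symmetric] by (simp only: mult_ac)
  then show ?thesis by blast
qed

section \<open>Linear independence of consecutive Pade approximants\<close>

lemma dvd_poly_of_vanishing_order:
  fixes p :: "complex poly"
  assumes "\<And>v::real. 1/16 \<le> v \<Longrightarrow> v < 1 \<Longrightarrow> norm (poly p (of_real v)) \<le> C * (1 - v) ^ m"
  shows "[:-1, 1:] ^ m dvd p"
  using assms
proof (induction m arbitrary: p)
  case (Suc m)
  have lim1: "((\<lambda>v. norm (poly p (of_real v))) \<longlongrightarrow> norm (poly p (of_real 1))) (at_left (1::real))"
    by (intro tendsto_intros)
  have lim2: "((\<lambda>v. C * (1 - v) ^ Suc m) \<longlongrightarrow> C * (1 - 1) ^ Suc m) (at_left (1::real))"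
    by (intro tendsto_intros)
  have ev: "eventually (\<lambda>v. norm (poly p (of_real v)) \<le> C * (1 - v) ^ Suc m) (at_left (1::real))"
    unfolding eventually_at_left_field
    by (rule exI[of _ "1/16"]) (use Suc.prems in auto)
  have "norm (poly p (of_real 1)) \<le> C * (1 - 1) ^ Suc m"
    by (rule tendsto_le[OF _ lim2 lim1 ev]) simp
  then have "poly p 1 = 0" by simp
  then have "[:-1, 1:] dvd p" by (simp add: poly_eq_0_iff_dvd)
  then obtain q where q: "p = [:-1, 1:] * q" by (elim dvdE)
  have "[:-1, 1:] ^ m dvd q"
  proof (rule Suc.IH)
    fix v :: real assume v: "1/16 \<le> v" "v < 1"
    have "poly p (of_real v) = (of_real v - 1) * poly q (of_real v)"
      unfolding q by (simp add: algebra_simps)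
    moreover have "norm (of_real v - 1 :: complex) = 1 - v"
      using v by (metis abs_of_neg diff_less_0_iff_less minus_diff_eq norm_of_real of_real_1 of_real_diff)
    ultimately have "(1 - v) * norm (poly q (of_real v)) \<le> (1 - v) * (C * (1 - v) ^ m)"
      using Suc.prems[OF v] by (simp add: norm_mult mult_ac)
    then show "norm (poly q (of_real v)) \<le> C * (1 - v) ^ m"
      using v by (simp add: mult_le_cancel_left)
  qed
  then show ?case unfolding q power_Suc by (rule mult_dvd_mono[OF dvd_refl])
qed auto

text \<open>As a polynomial in \<open>u\<close> the determinant has degree at most 2 r + 1.
  Rewritten with the remainders of both approximants it is seen to vanish at 1 to order 2 r + 1, so
  it is a constant times (u - 1)^(2 r + 1); its value at 0 shows that the constant is
  nonzero.\<close>

lemma pade_det_nonzero: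
  assumes "u \<noteq> 1"
  shows "padeA r u * padeB (Suc r) u \<noteq> padeA (Suc r) u * padeB r u"
proof -
  define pA where "pA = (\<lambda>r. \<Sum>k\<le>r. Polynomial.monom (complex_of_real (pcoeff r k)) k)"
  define pB where "pB = (\<lambda>r. \<Sum>k\<le>r. Polynomial.monom (complex_of_real (pcoeff r k)) (r - k))"
  have pA: "poly (pA r) u = padeA r u" and pB: "poly (pB r) u = padeB r u" for r u
    unfolding pA_def pB_def padeA_def padeB_def by (simp_all add: poly_sum poly_monom)
  have dA: "degree (pA r) \<le> r" for r
    unfolding pA_def by (rule degree_sum_le) (auto intro: order.trans[OF degree_monom_le])
  have dB: "degree (pB r) \<le> r" for r
    unfolding pB_def by (rule degree_sum_le) (auto intro: order.trans[OF degree_monom_le])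
  define D where "D = pA r * pB (Suc r) - pA (Suc r) * pB r"
  have dD: "degree D \<le> 2 * r + 1"
    unfolding D_def using dA[of r] dA[of "Suc r"] dB[of r] dB[of "Suc r"]
    by (intro degree_diff_le order.trans[OF degree_mult_le]) auto
  have nB: "norm (padeB r (complex_of_real v)) \<le> 4 ^ r" if "0 \<le> v" "v \<le> 1" for r v
  proof -
    have "norm (padeB r (of_real v)) \<le> (\<Sum>k\<le>r. norm (complex_of_real (pcoeff r k) * of_real v ^ (r - k)))"
      unfolding padeB_def by (rule norm_sum)
    also have "\<dots> \<le> (\<Sum>k\<le>r. pcoeff r k)"
    proof (rule sum_mono)
      fix k assume "k \<in> {..r}"
      then have "pcoeff r k > 0" by (simp add: pcoeff_pos)
      moreover have "v ^ (r - k) \<le> 1" using that by (simp add: power_le_one)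
      ultimately have "pcoeff r k * v ^ (r - k) \<le> pcoeff r k * 1" by (intro mult_left_mono) auto
      then show "norm (complex_of_real (pcoeff r k) * of_real v ^ (r - k)) \<le> pcoeff r k"
        using \<open>pcoeff r k > 0\<close> that by (simp add: norm_mult norm_power)
    qed
    also have "\<dots> \<le> 4 ^ r"
      unfolding sum_pcoeff using binomial_le_pow2[of "2*r" r] by (simp add: power_mult)
    finally show ?thesis .
  qed
  have rem: "norm (padeA r (of_real x ^ 4) - of_real x * padeB r (of_real x ^ 4)) \<le> (1 - x) ^ (2 * r + 1) * 64 ^ r"
    if x: "1/2 \<le> x" "x \<le> 1" for r and x :: real
  proof -
    have n: "norm (1 - complex_of_real x) = 1 - x"
      using x by (metis abs_of_nonneg diff_ge_0_iff_ge norm_of_real of_real_1 of_real_diff)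
    have "norm (padeA r (of_real x ^ 4) - of_real x * padeB r (of_real x ^ 4)) \<le> (1-x) * (4 * (1-x)^2 / (1-(1-x))^4) ^ r"
      by (rule pade_remainder) (use x n in auto)
    also have "\<dots> \<le> (1-x) * (64 * (1-x)^2) ^ r"
    proof (intro mult_left_mono power_mono)
      have "(1/2)^4 \<le> x^4" using x by (intro power_mono) auto
      then have "4 * (1-x)^2 / x^4 \<le> 4 * (1-x)^2 / (1/2)^4" using x by (intro divide_left_mono) auto
      then show "4 * (1-x)^2 / (1-(1-x))^4 \<le> 64 * (1-x)^2" by (simp add: power_divide)
    qed (use x in auto)
    also have "\<dots> = (1 - x) ^ (2 * r + 1) * 64 ^ r"
    proof -
      have e: "(1-x) ^ (2 * r + 1) = (1-x) * ((1-x)^2) ^ r" by (simp add: power_mult)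
      show ?thesis unfolding e power_mult_distrib by (simp only: mult_ac)
    qed
    finally show ?thesis .
  qed
  have "[:-1, 1:] ^ (2 * r + 1) dvd D"
  \<comment> \<open>The order is read off from an estimate for real v below 1. For v >= 1/16 the
    real fourth root x is at least 1/2, which yields the 64^r in the remainder bound, and 1 - x <= 1
    - v. The powers of 4 bound \<open>padeB\<close>.\<close>
  proof (rule dvd_poly_of_vanishing_order[where C = "64 ^ r * 4 ^ Suc r + 64 ^ Suc r * 4 ^ r"])
    fix v :: real assume v: "1/16 \<le> v" "v < 1"
    define x where "x = root 4 v"
    have x4: "x ^ 4 = v" unfolding x_def using v by (intro real_root_pow_pos2) auto
    have "root 4 ((1/2)^4) \<le> x" unfolding x_def using v by (subst real_root_le_iff) (auto simp: power_divide)
    then have x1: "1/2 \<le> x" by (simp add: real_root_power_cancel)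
    have x2: "x \<le> 1" unfolding x_def using v by simp
    have "v \<le> x" using x4 x1 x2 by (metis power_decreasing[of 1 4 x] power_one_right one_le_numeral divide_nonneg_nonneg order.trans zero_le_numeral zero_le_one)
    then have xv: "(1 - x) ^ m \<le> (1 - v) ^ m" for m using x2 by (intro power_mono) auto
    define u where "u = complex_of_real v"
    have ux: "of_real x ^ 4 = u" unfolding u_def x4[symmetric] by simp
    define G where "G = (\<lambda>r. padeA r u - of_real x * padeB r u)"
    have G: "norm (G r) \<le> (1 - x) ^ (2 * r + 1) * 64 ^ r" for r
      unfolding G_def using rem[OF x1 x2, of r] unfolding ux .
    have "poly D u = G r * padeB (Suc r) u - G (Suc r) * padeB r u"
      unfolding D_def G_def by (simp add: pA pB algebra_simps)
    also have "norm \<dots> \<le> norm (G r * padeB (Suc r) u) + norm (G (Suc r) * padeB r u)"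
      by (rule norm_triangle_ineq4)
    also have "\<dots> \<le> ((1 - v) ^ (2 * r + 1) * 64 ^ r) * 4 ^ Suc r + ((1 - v) ^ (2 * r + 1) * 64 ^ Suc r) * 4 ^ r"
    proof (unfold norm_mult, intro add_mono mult_mono)
      show "norm (G r) \<le> (1 - v) ^ (2 * r + 1) * 64 ^ r"
        using G[of r] xv[of "2*r+1"] by (meson mult_right_mono order.trans zero_le_numeral zero_le_power)
      have "(1 - x) ^ (2 * Suc r + 1) \<le> (1 - x) ^ (2 * r + 1)" using x1 x2 by (intro power_decreasing) auto
      also have "\<dots> \<le> (1 - v) ^ (2 * r + 1)" by (rule xv)
      finally show "norm (G (Suc r)) \<le> (1 - v) ^ (2 * r + 1) * 64 ^ Suc r"
        using G[of "Suc r"] by (meson mult_right_mono order.trans zero_le_numeral zero_le_power)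
      show "norm (padeB r u) \<le> 4 ^ r" "norm (padeB (Suc r) u) \<le> 4 ^ Suc r"
        unfolding u_def by (rule nB; use v in simp)+
    qed (use v in auto)
    finally show "norm (poly D (of_real v)) \<le> (64 ^ r * 4 ^ Suc r + 64 ^ Suc r * 4 ^ r) * (1 - v) ^ (2 * r + 1)"
      unfolding u_def by (simp add: algebra_simps)
  qed
  then obtain q where q: "D = [:-1, 1:] ^ (2 * r + 1) * q" by (elim dvdE)
  have c0: "padeA n 0 = of_real (pochhammer (3/4) n / fact n)" "padeB n 0 = of_real (pochhammer (5/4) n / fact n)" for n
  proof -
    have "padeA n 0 = of_real (pcoeff n 0)"
      unfolding padeA_def by (subst sum.atMost_shift) simp
    then show "padeA n 0 = of_real (pochhammer (3/4) n / fact n)"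
      by (simp add: pcoeff_def gbinomial_pochhammer')
    have "padeB n 0 = (\<Sum>k\<in>{n}. complex_of_real (pcoeff n k) * 0 ^ (n - k))"
      unfolding padeB_def by (rule sum.mono_neutral_right) auto
    then show "padeB n 0 = of_real (pochhammer (5/4) n / fact n)"
      by (simp add: pcoeff_def gbinomial_pochhammer')
  qed
  have "poly D 0 = of_real (pochhammer (3/4) r / fact r * (pochhammer (5/4) (Suc r) / fact (Suc r)) - pochhammer (3/4) (Suc r) / fact (Suc r) * (pochhammer (5/4) r / fact r))"
    unfolding D_def by (simp add: pA pB c0)
  also have "pochhammer (3/4) r / fact r * (pochhammer (5/4) (Suc r) / fact (Suc r)) - pochhammer (3/4) (Suc r) / fact (Suc r) * (pochhammer (5/4) r / fact r)
     = (1/2 :: real) * pochhammer (3/4) r * pochhammer (5/4) r / (fact r * fact (Suc r))"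
    unfolding pochhammer_Suc by (simp add: divide_simps) (simp add: algebra_simps)
  finally have D0: "poly D 0 = of_real ((1/2) * pochhammer (3/4) r * pochhammer (5/4) r / (fact r * fact (Suc r)))" .
  have "(1/2::real) * pochhammer (3/4) r * pochhammer (5/4) r / (fact r * fact (Suc r)) > 0"
    by (intro divide_pos_pos mult_pos_pos pochhammer_pos fact_gt_zero) auto
  then have "poly D 0 \<noteq> 0" unfolding D0 of_real_eq_0_iff by linarith
  then have q0: "poly q 0 \<noteq> 0" unfolding q by simp
  then have "q \<noteq> 0" by auto
  then have "degree D = 2 * r + 1 + degree q"
    unfolding q using degree_mult_eq[OF power_not_zero[of "[:-1, 1:] :: complex poly" "2 * r + 1"], of q]
    by (simp only: degree_linear_power) simp
  then have "degree q = 0" using dD by simp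
  then have "poly q u = poly q 0" by (auto elim!: degree_eq_zeroE)
  then have "poly D u \<noteq> 0" unfolding q using q0 assms by simp
  then show ?thesis unfolding D_def by (simp add: pA pB)
qed

subsection \<open>The quartic Thue equation\<close>

definition gauss_int :: "complex \<Rightarrow> bool" where
  "gauss_int z \<longleftrightarrow> Re z \<in> \<int> \<and> Im z \<in> \<int>"

lemma gauss_int_add: "gauss_int a \<Longrightarrow> gauss_int b \<Longrightarrow> gauss_int (a + b)"
  and gauss_int_diff: "gauss_int a \<Longrightarrow> gauss_int b \<Longrightarrow> gauss_int (a - b)"
  and gauss_int_mult: "gauss_int a \<Longrightarrow> gauss_int b \<Longrightarrow> gauss_int (a * b)"
  and gauss_int_of_int: "gauss_int (of_int m)"
  and gauss_int_cnj: "gauss_int a \<Longrightarrow> gauss_int (cnj a)"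
  by (auto simp: gauss_int_def)

lemma gauss_int_power: "gauss_int a \<Longrightarrow> gauss_int (a ^ n)"
  by (induction n) (auto intro: gauss_int_mult simp: gauss_int_def)

lemma gauss_int_sum: "(\<And>i. i \<in> A \<Longrightarrow> gauss_int (f i)) \<Longrightarrow> gauss_int (sum f A)"
  by (induction A rule: infinite_finite_induct) (auto intro: gauss_int_add simp: gauss_int_def)

lemma norm_gauss_int_ge_1:
  assumes "gauss_int z" "z \<noteq> 0"
  shows "norm z \<ge> 1"
proof -
  have "\<bar>Re z\<bar> \<ge> 1 \<or> \<bar>Im z\<bar> \<ge> 1"
    using assms by (auto simp: gauss_int_def complex_eq_iff intro: Ints_nonzero_abs_ge1)
  then show ?thesis using abs_Re_le_cmod[of z] abs_Im_le_cmod[of z] by linarith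
qed

text \<open>In this sector the other two factors of v^4 - 1 = (v - 1) (v + 1) (v^2 + 1) have real
  part at least 1.\<close>

lemma norm_diff_1_le_pow4:
  fixes v :: complex
  assumes "\<bar>Im v\<bar> \<le> Re v"
  shows "norm (v - 1) \<le> norm (v^4 - 1)"
proof -
  have "norm (v + 1) \<ge> 1" using assms complex_Re_le_cmod[of "v + 1"] by simp
  moreover have "(Im v)^2 \<le> (Re v)^2" using assms by (simp add: abs_le_square_iff[symmetric])
  then have "norm (v^2 + 1) \<ge> 1" using complex_Re_le_cmod[of "v^2 + 1"] by (simp add: Re_power2)
  ultimately have "1 * 1 \<le> norm (v + 1) * norm (v^2 + 1)" by (intro mult_mono) auto
  then have "norm (v - 1) * 1 \<le> norm (v - 1) * (norm (v + 1) * norm (v^2 + 1))"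
    by (intro mult_left_mono) auto
  moreover have "v^4 - 1 = (v - 1) * ((v + 1) * (v^2 + 1))"
    by (simp add: algebra_simps power2_eq_square power4_eq_xxxx)
  ultimately show ?thesis by (simp add: norm_mult)
qed

text \<open>The four rotations of the sector |Im v| <= Re v cover the plane, so dividing by a
  suitable unit reduces to \<open>norm_diff_1_le_pow4\<close>.\<close>

lemma nearest_fourth_root_of_unity:
  fixes v :: complex
  obtains i where "i^4 = 1" "norm i = 1" "gauss_int i" "norm (v - i) \<le> norm (v^4 - 1)"
proof -
  note result = that
  have main: thesis if i: "i \<in> {1, -1, \<i>, -\<i>}" "\<bar>Im (v / i)\<bar> \<le> Re (v / i)" for i
  proof -
    have p: "i^4 = 1" "norm i = 1" "gauss_int i" "i \<noteq> 0" using i by (auto simp: gauss_int_def power4_eq_xxxx)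
    have "norm (v - i) = norm (v / i - 1)"
      using p by (metis diff_divide_distrib div_by_1 divide_self norm_divide)
    also have "\<dots> \<le> norm ((v / i)^4 - 1)" by (rule norm_diff_1_le_pow4[OF i(2)])
    also have "\<dots> = norm (v^4 - 1)" using p by (simp add: power_divide)
    finally show thesis using result p by blast
  qed
  have "\<bar>Im v\<bar> \<le> Re v \<or> \<bar>Im v\<bar> \<le> - Re v \<or> \<bar>Re v\<bar> \<le> Im v \<or> \<bar>Re v\<bar> \<le> - Im v" by linarith
  then show thesis
    using main[of 1] main[of "-1"] main[of "\<i>"] main[of "-\<i>"] by (auto simp: Re_divide Im_divide)
qed

text \<open>A first crude bound |x - 1| <= 1/100 puts x + 1 and x^2 + 1 close to 2; their lower
  bounds 199/100 and 1979/1000 multiply to 393821/100000. A divisor this close to 4 is needed to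
  reach 1/470 in \<open>quartic_bound\<close>.\<close>

lemma fourth_root_near_1:
  fixes u :: complex
  assumes "norm (u - 1) \<le> 1/100"
  obtains x where "x^4 = u" "norm (1 - x) \<le> norm (u - 1) / (393821/100000)"
proof -
  define x0 where "x0 = csqrt (csqrt u)"
  have x0: "x0^4 = u" unfolding x0_def using power_mult[of "csqrt (csqrt u)" 2 2] by simp
  obtain i where i: "i^4 = 1" "norm i = 1" "gauss_int i" "norm (x0 - i) \<le> norm (x0^4 - 1)"
    by (rule nearest_fourth_root_of_unity)
  define x where "x = x0 / i"
  have x4: "x^4 = u" unfolding x_def using i x0 by (simp add: power_divide)
  have "i \<noteq> 0" using i by auto
  then have "norm (x - 1) = norm (x0 - i)"
    unfolding x_def using i by (metis diff_divide_distrib div_by_1 divide_self norm_divide)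
  then have n: "norm (x - 1) \<le> 1/100" using i x0 assms by simp
  have a: "norm (x + 1) \<ge> 199/100"
    using n norm_triangle_ineq2[of "2::complex" "1 - x"] by (simp add: norm_minus_commute algebra_simps)
  have "norm (x + 1) \<le> 201/100"
    using n norm_triangle_ineq[of "2::complex" "x - 1"] by (simp add: algebra_simps)
  then have "norm ((x - 1) * (x + 1)) \<le> (1/100) * (201/100)"
    unfolding norm_mult using n by (intro mult_mono) auto
  then have b: "norm (x^2 + 1) \<ge> 1979/1000"
    using norm_triangle_ineq2[of "2::complex" "- ((x - 1) * (x + 1))"] by (simp add: algebra_simps power2_eq_square norm_minus_commute)
  have "(199/100) * (1979/1000) \<le> norm (x + 1) * norm (x^2 + 1)" using a b by (intro mult_mono) auto
  then have "norm (1 - x) * (393821/100000) \<le> norm (1 - x) * (norm (x + 1) * norm (x^2 + 1))"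
    by (intro mult_left_mono) auto
  also have "\<dots> = norm ((x - 1) * ((x + 1) * (x^2 + 1)))" by (simp add: norm_mult norm_minus_commute)
  also have "(x - 1) * ((x + 1) * (x^2 + 1)) = u - 1"
    unfolding x4[symmetric] by (simp add: algebra_simps power2_eq_square power4_eq_xxxx)
  finally have "norm (1 - x) \<le> norm (u - 1) / (393821/100000)" by (simp add: field_simps)
  with x4 show thesis by (rule that)
qed

text \<open>8^r clears the coefficients and w^r the powers of \<open>c\<close>. In the application
  \<open>c\<close> is \<open>u\<close> and \<open>w\<close> is \<open>z1^4\<close>.\<close>

lemma gauss_int_pade_scaled:
  assumes "gauss_int (c * w)" "gauss_int w"
  shows "gauss_int (8^r * w^r * padeA r c)" "gauss_int (8^r * w^r * padeB r c)"
proof -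
  have *: "gauss_int (8^r * w^r * (of_real (pcoeff r k) * c^l))" if kl: "k \<le> r" "l \<le> r" for k l
  proof -
    obtain z where z: "8 ^ r * pcoeff r k = of_int z" using pcoeff_integral[OF kl(1)] by blast
    have "8^r * w^r * (of_real (pcoeff r k) * c^l) = of_real (8^r * pcoeff r k) * ((c * w)^l * w^(r-l))"
      using kl by (simp add: power_mult_distrib mult_ac flip: power_add)
    also have "\<dots> = of_int z * ((c * w)^l * w^(r-l))" unfolding z by simp
    finally show ?thesis using assms by (simp add: gauss_int_mult gauss_int_of_int gauss_int_power)
  qed
  show "gauss_int (8^r * w^r * padeA r c)" "gauss_int (8^r * w^r * padeB r c)"
    unfolding padeA_def padeB_def sum_distrib_left by (intro gauss_int_sum *; simp)+
qed

text \<open>The two bounds on \<open>y\<close> make the Pade remainder and the distance of the given solution from the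
  fourth root, respectively, contribute less than \<open>1/2\<close> to the linear form in \<open>quartic_bound\<close>; the
  second one is needed for \<open>r\<close> and \<open>r + 1\<close>, as only one of two consecutive forms is known to be nonzero.\<close>

lemma exponent_choice:
  fixes y :: real
  assumes "4225 * 1600^3 \<le> y"
  obtains r where "y < 4225 * 1600^r" "117 * 5408 ^ (2 * (r + 1)) < y^3"
proof -
  obtain n where "y < 1600 ^ n" using real_arch_pow[of 1600 y] by auto
  then have n: "y < 4225 * 1600 ^ n" using zero_less_power[of "1600::real" n] by linarith
  \<comment> \<open>Minimality gives y >= 4225 * 1600^(r - 1), so y^3 grows like (1600^3)^r, faster
    than (5408^2)^r. The lower bound on \<open>y\<close> forces r >= 4, from where on the remaining
    constants suffice.\<close>
  define r where "r = (LEAST r. y < 4225 * 1600 ^ r)"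
  have r: "y < 4225 * 1600 ^ r" unfolding r_def by (rule LeastI[of _ n]) (rule n)
  have "r > 3"
  proof (rule ccontr)
    assume "\<not> r > 3"
    then have "(1600::real) ^ r \<le> 1600 ^ 3" by (intro power_increasing) auto
    then show False using r assms by linarith
  qed
  then have "r = (r - 4) + 4" by simp
  then obtain k where k: "r = k + 4" by blast
  have "\<not> y < 4225 * 1600 ^ (k + 3)"
    using not_less_Least[of "k + 3" "\<lambda>r. y < 4225 * 1600 ^ r"] unfolding r_def[symmetric] k by simp
  then have "4225 * 1600 ^ (k + 3) \<le> y" by simp
  then have "(4225 * 1600 ^ (k + 3))^3 \<le> y^3" by (intro power_mono) auto
  moreover have "117 * 5408 ^ (2 * (r + 1)) < (4225 * 1600 ^ (k + 3) :: real)^3"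
  proof -
    have a: "(5408::real) ^ (2 * (r + 1)) = (5408^2) ^ k * 5408 ^ 10"
    proof -
      have "2 * (r + 1) = 2 * k + 10" using k by simp
      then show ?thesis by (simp only: power_add power_mult)
    qed
    have b: "(4225 * 1600 ^ (k + 3) :: real)^3 = (1600^3)^k * (4225^3 * 1600^9)"
    proof -
      have "(1600 ^ (k + 3) :: real)^3 = 1600 ^ (3 * k + 9)"
        unfolding power_mult[symmetric] by (rule arg_cong[where f = "\<lambda>n. 1600 ^ n"]) simp
      also have "\<dots> = (1600^3)^k * 1600^9" by (simp only: power_add power_mult)
      finally show ?thesis unfolding power_mult_distrib by (simp only: mult_ac)
    qed
    have "(5408^2::real) ^ k \<le> (1600^3) ^ k" by (intro power_mono) auto
    then have "(5408^2::real) ^ k * (117 * 5408 ^ 10) \<le> (1600^3) ^ k * (117 * 5408 ^ 10)"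
      by (intro mult_right_mono) auto
    also have "\<dots> < (1600^3) ^ k * (4225^3 * 1600^9)" by (intro mult_strict_left_mono) auto
    finally show ?thesis unfolding a b by simp
  qed
  ultimately have "117 * 5408 ^ (2 * (r + 1)) < y^3" by linarith
  with r show thesis by (rule that)
qed

lemma norm_1_plus_i: "norm (1 + \<i>) = sqrt 2" by (simp add: cmod_def)

text \<open>With z = s + t \<i> the hypothesis says |Im X| = 1 for X = (1 + \<i>) z^4. So X / cnj X
  is within 2 / |X| of 1, and \<open>\<rho>\<close> approximates the root \<open>x\<close> up to a
  fourth root of unity \<open>i\<close>. Were y large, two consecutive Gaussian integers
  \<open>N r\<close> and \<open>N (Suc r)\<close> would have norm below 1 and vanish, against the
  nonvanishing determinant.\<close>

lemma quartic_bound: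
  fixes s t :: int and y :: real
  assumes y: "y = of_int (s^2 + t^2)"
    and eq: "\<bar>s^4 + 4 * s^3 * t - 6 * s^2 * t^2 - 4 * s * t^3 + t^4\<bar> = 1"
  shows "y < 4225 * 1600^3"
proof (rule ccontr)
  assume "\<not> ?thesis"
  then have ybig: "4225 * 1600^3 \<le> y" by simp
  then have ypos: "y > 0" by (rule less_le_trans[rotated]) simp
  define z where "z = Complex (of_int s) (of_int t)"
  define z1 where "z1 = Complex 3 2"
  define X where "X = (1 + \<i>) * z^4"
  define X1 where "X1 = (1 + \<i>) * z1^4"
  have X1: "X1 = Complex (-239) 1" unfolding X1_def z1_def by (simp add: complex_eq_iff power4_eq_xxxx)
  have nz: "norm z = sqrt y" unfolding z_def y by (simp add: cmod_def)
  have nz1: "norm z1 = sqrt 13" unfolding z1_def by (simp add: cmod_def)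
  have z0: "z \<noteq> 0" "z1 \<noteq> 0" using nz nz1 ypos by auto
  have nX: "norm X = sqrt 2 * y^2"
    unfolding X_def norm_mult norm_power nz norm_1_plus_i using power_mult[of "sqrt y" 2 2] ypos by simp
  have X0: "X \<noteq> 0" "X1 \<noteq> 0" using z0 norm_1_plus_i unfolding X_def X1_def by auto
  define u where "u = cnj X1 / X1"
  have nu: "norm u = 1" unfolding u_def using X0 by (simp add: norm_divide)
  have u_eq: "u * X1 = cnj X1" unfolding u_def using X0 by simp
  \<comment> \<open>The constant exceeds 2 / 239 and is small enough that division by 393821/100000
    stays below 1/470.\<close>
  have u1': "norm (u - 1) \<le> 8369/1000000"
  proof -
    have "u - 1 = (cnj X1 - X1) / X1" unfolding u_def using X0 by (simp add: field_simps)
    then have "norm (u - 1) = norm (cnj X1 - X1) / norm X1" by (simp only: norm_divide)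
    also have "norm (cnj X1 - X1) = 2" unfolding X1 by (simp add: cmod_def)
    also have "norm X1 = sqrt 57122" unfolding X1 by (simp add: cmod_def)
    also have "2 / sqrt 57122 \<le> 2 / 239" by (intro divide_left_mono real_le_rsqrt) auto
    also have "\<dots> \<le> 8369/1000000" by simp
    finally show ?thesis .
  qed
  have "norm (u - 1) \<le> 1/100" using u1' by simp
  then obtain x where x: "x^4 = u" "norm (1 - x) \<le> norm (u - 1) / (393821/100000)"
    by (rule fourth_root_near_1)
  have xd: "norm (1 - x) \<le> 1/470" using x(2) u1' by simp
  have nx: "norm x = 1"
  proof (rule power_eq_imp_eq_base)
    show "norm x ^ 4 = 1 ^ 4" using nu x(1) by (metis norm_power power_one)
  qed auto
  have x0: "x \<noteq> 0" using nx by auto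
  define \<rho> where "\<rho> = cnj z1 * z / (z1 * cnj z)"
  define v where "v = \<rho> / x"
  have ci: "1 + \<i> \<noteq> 0" "1 - \<i> \<noteq> 0" by (simp_all add: complex_eq_iff)
  have ci': "cnj (1 + \<i>) = 1 - \<i>" by simp
  have v4: "v^4 = X / cnj X"
  proof -
    have "v^4 = (cnj z1^4 * z^4 / (z1^4 * cnj z^4)) / u"
      unfolding v_def \<rho>_def x(1)[symmetric] by (simp add: power_divide power_mult_distrib)
    also have "\<dots> = X / cnj X"
    proof -
      have "(a * p / (b * q)) / ((c' * a) / (c * b)) = (c * p) / (c' * q)"
        if "a \<noteq> 0" "b \<noteq> 0" "q \<noteq> 0" "c \<noteq> 0" "c' \<noteq> 0" for a b p q c c' :: complex
        using that by (simp add: mult.commute)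
      from this[of "cnj z1^4" "z1^4" "cnj z^4" "1 + \<i>" "cnj (1 + \<i>)" "z^4"] show ?thesis
        unfolding u_def X_def X1_def using z0 ci ci' by (simp add: mult_ac)
    qed
    finally show ?thesis .
  qed
  obtain i where i: "i^4 = 1" "norm i = 1" "gauss_int i" "norm (v - i) \<le> norm (v^4 - 1)"
    by (rule nearest_fourth_root_of_unity)
  have nv: "norm v = 1"
    unfolding v_def \<rho>_def using nx z0 by (simp add: norm_divide norm_mult)
  have vi: "norm (v - i) \<le> (3/2) / y^2"
  proof -
    have "v^4 - 1 = (X - cnj X) / cnj X" unfolding v4 using X0 by (simp add: field_simps)
    then have "norm (v^4 - 1) = norm (X - cnj X) / norm X" by (simp add: norm_divide)
    also have "norm (X - cnj X) = 2 * \<bar>Im X\<bar>" by (simp add: complex_diff_cnj norm_mult)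
    also have "Im X = of_int (s^4 + 4 * s^3 * t - 6 * s^2 * t^2 - 4 * s * t^3 + t^4)"
      unfolding X_def z_def by (simp add: power4_eq_xxxx power3_eq_cube power2_eq_square algebra_simps)
    also have "\<bar>real_of_int (s^4 + 4 * s^3 * t - 6 * s^2 * t^2 - 4 * s * t^3 + t^4)\<bar> = 1"
      using arg_cong[OF eq, of real_of_int] by (simp only: of_int_abs of_int_1)
    finally have "norm (v^4 - 1) = 2 / (sqrt 2 * y^2)" unfolding nX by simp
    also have "\<dots> = sqrt 2 / y^2"
      unfolding divide_divide_eq_left[symmetric] by (simp only: real_div_sqrt zero_le_numeral)
    also have "\<dots> \<le> (3/2) / y^2"
      by (intro divide_right_mono real_le_lsqrt) (auto simp: power2_eq_square)
    finally show ?thesis using i(4) by simp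
  qed
  have ne: "u \<noteq> 1" using u_eq unfolding X1 by (auto simp: complex_eq_iff)
  \<comment> \<open>8^r clears the Pade coefficients and (z1^4)^r the denominator of
    \<open>u\<close>, since u z1^4 = -\<i> cnj z1^4.\<close>
  define N where "N = (\<lambda>r. 8^r * (z1^4)^r * (i * z1 * cnj z * padeA r u - cnj z1 * z * padeB r u))"
  have gz: "gauss_int z" "gauss_int z1" by (auto simp: gauss_int_def z_def z1_def)
  have gN: "gauss_int (N r)" for r
  proof -
    have "u * z1^4 = - \<i> * cnj z1^4"
    proof -
      have "u * X1 = (1 - \<i>) * cnj z1^4" using u_eq unfolding X1_def by simp
      then have "(1 + \<i>) * (u * z1^4) = (1 + \<i>) * (- \<i> * cnj z1^4)" unfolding X1_def by (simp add: algebra_simps)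
      moreover have "1 + \<i> \<noteq> 0" by (simp add: complex_eq_iff)
      ultimately show ?thesis by (metis mult_cancel_left)
    qed
    moreover have "gauss_int (- \<i>)" by (simp add: gauss_int_def)
    ultimately have "gauss_int (u * z1^4)" using gz by (metis gauss_int_mult gauss_int_power gauss_int_cnj)
    then have g: "gauss_int (8^r * (z1^4)^r * padeA r u)" "gauss_int (8^r * (z1^4)^r * padeB r u)"
      using gz by (auto intro: gauss_int_pade_scaled gauss_int_power)
    have h: "gauss_int (i * z1 * cnj z)" "gauss_int (cnj z1 * z)"
      by (intro gauss_int_mult gauss_int_cnj gz i(3))+
    have "gauss_int ((i * z1 * cnj z) * (8^r * (z1^4)^r * padeA r u) - (cnj z1 * z) * (8^r * (z1^4)^r * padeB r u))"
      by (rule gauss_int_diff[OF gauss_int_mult[OF h(1) g(1)] gauss_int_mult[OF h(2) g(2)]])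
    then show ?thesis unfolding N_def by (simp add: algebra_simps)
  qed
  \<comment> \<open>Both error terms are below 1/2. Here 1352 = 8 * 169 with 169 = |z1|^4, and 5408
    = 1352 * 4 includes the bound on \<open>padeA\<close>. The remainder term shrinks by 1/40 per
    step, hence 1600 = 40^2, and 13 * 4225 < 235^2 with 235 = 470 / 2. Finally 117 = 13 * (9/4) * 4
    comes from squaring sqrt 13, 3/2 and 1/2.\<close>
  have small: "norm (N r) < 1" if r: "y < 4225 * 1600^r" "117 * 5408 ^ (2 * r) < y^3" for r
  proof -
    let ?c = "4 * (1/470)^2 / (1-1/470)^4 :: real"
    define G where "G = padeA r u - x * padeB r u"
    have G: "norm G \<le> (1/470) * ?c ^ r"
      unfolding G_def x(1)[symmetric] by (rule pade_remainder) (use nx xd in auto)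
    have id: "i * z1 * cnj z * padeA r u - cnj z1 * z * padeB r u = z1 * cnj z * (v * G - (v - i) * padeA r u)"
    proof -
      have "z1 * cnj z * (v * x) = cnj z1 * z" unfolding v_def \<rho>_def using x0 z0 by simp
      then show ?thesis unfolding G_def by (simp add: algebra_simps)
    qed
    have "norm (v * G - (v - i) * padeA r u) \<le> norm G + norm (v - i) * norm (padeA r u)"
      using norm_triangle_ineq4[of "v * G" "(v - i) * padeA r u"] by (simp add: norm_mult nv)
    also have "\<dots> \<le> (1/470) * ?c ^ r + ((3/2) / y^2) * 4^r"
      using G vi norm_padeA_le[OF nu] by (intro add_mono mult_mono) auto
    finally have b: "norm (v * G - (v - i) * padeA r u) \<le> (1/470) * ?c ^ r + ((3/2) / y^2) * 4^r" .
    have n13: "sqrt 13 ^ 4 = (169::real)" by (simp add: power4_eq_xxxx)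
    have "norm (N r) = 8^r * 169^r * (sqrt 13 * sqrt y * norm (v * G - (v - i) * padeA r u))"
      unfolding N_def id norm_mult norm_power complex_mod_cnj nz nz1 n13 by simp
    also have "\<dots> = 1352^r * (sqrt 13 * sqrt y * norm (v * G - (v - i) * padeA r u))"
      by (simp flip: power_mult_distrib)
    also have "\<dots> \<le> 1352^r * (sqrt 13 * sqrt y * ((1/470) * ?c ^ r + ((3/2) / y^2) * 4^r))"
      using b ypos by (intro mult_left_mono) auto
    also have "\<dots> = sqrt (13 * y) * (1/470) * (1352 * ?c) ^ r + sqrt (13 * y) * (3/2) * 5408^r / y^2"
    proof -
      have "(5408::real)^r = 1352^r * 4^r" by (simp flip: power_mult_distrib)
      moreover have "1352^r * (q * (c * p ^ r + e / Y * 4^r)) = q * c * (1352 * p) ^ r + q * e * (1352^r * 4^r) / Y"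
        for q c p e Y :: real
        by (simp add: power_mult_distrib algebra_simps)
      ultimately show ?thesis by (simp only: real_sqrt_mult)
    qed
    also have "\<dots> < 1/2 + 1/2"
    proof (rule add_strict_mono)
      have "(1352 * ?c) ^ r \<le> (1/40::real) ^ r"
        by (intro power_mono) (auto simp: power_divide)
      then have "sqrt (13 * y) * (1/470) * (1352 * ?c) ^ r \<le> sqrt (13 * y) * (1/470) * (1/40) ^ r"
        using ypos by (intro mult_left_mono) auto
      also have "sqrt (13 * y) < 235 * 40^r"
      proof (rule real_less_lsqrt)
        have "(40^r)^2 = (40^2::real)^r" by (metis power_mult mult.commute)
        then have "(235 * 40^r)^2 = 55225 * (1600::real)^r" by (simp add: power_mult_distrib)
        moreover have "(0::real) < 1600^r" by simp
        ultimately show "13 * y < (235 * 40^r)^2" using r(1) by linarith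
      qed (use ypos in auto)
      then have "sqrt (13 * y) * (1/470) * (1/40) ^ r < 1/2" by (simp add: power_divide field_simps)
      finally show "sqrt (13 * y) * (1/470) * (1352 * ?c) ^ r < 1/2" .
      have "sqrt (13 * y) * (3/2) * 5408^r = sqrt (13 * y * (9/4) * 5408^(2*r))"
      proof (rule real_sqrt_unique[symmetric])
        have "(5408 ^ r)^2 = (5408::real) ^ (2 * r)" by (metis power_mult mult.commute)
        moreover have "(sqrt (13 * y))^2 = 13 * y" using ypos by simp
        moreover have "(3/2 :: real)^2 = 9/4" by (simp add: power2_eq_square)
        ultimately show "(sqrt (13 * y) * (3/2) * 5408^r)^2 = 13 * y * (9/4) * 5408^(2*r)"
          by (simp only: power_mult_distrib)
      qed (use ypos in simp)
      also have "\<dots> < y^2/2"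
      proof (rule real_less_lsqrt)
        have "y * (117 * 5408^(2*r)) < y * y^3" using r(2) ypos by (intro mult_strict_left_mono) auto
        then show "13 * y * (9/4) * 5408^(2*r) < (y^2/2)^2" by (simp add: power2_eq_square power3_eq_cube)
      qed (use ypos in auto)
      finally show "sqrt (13 * y) * (3/2) * 5408^r / y^2 < 1/2" using ypos by (simp add: field_simps)
    qed
    finally show ?thesis by simp
  qed
  obtain r where r: "y < 4225 * 1600^r" "117 * 5408 ^ (2 * (r + 1)) < y^3"
    by (rule exponent_choice[OF ybig])
  have "(5408::real) ^ (2 * r) \<le> 5408 ^ (2 * (r + 1))" by (intro power_increasing) auto
  then have "norm (N r) < 1" using small[of r] r by linarith
  then have N0: "N r = 0" using norm_gauss_int_ge_1[OF gN] by (metis not_less)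
  have "y < 4225 * 1600 ^ Suc r" using r(1) zero_less_power[of "1600::real" r] by (simp only: power_Suc) linarith
  then have "norm (N (Suc r)) < 1" using small[of "Suc r"] r(2) by simp
  then have N1: "N (Suc r) = 0" using norm_gauss_int_ge_1[OF gN] by (metis not_less)
  define e where "e = cnj z1 * z"
  define d where "d = i * z1 * cnj z"
  have d0: "d \<noteq> 0" unfolding d_def using z0 i by auto
  have a: "d * padeA r u = e * padeB r u" "d * padeA (Suc r) u = e * padeB (Suc r) u"
    using N0 N1 z0 unfolding N_def d_def e_def by (auto simp: mult.assoc)
  have "d * (padeA r u * padeB (Suc r) u) = (d * padeA r u) * padeB (Suc r) u" by simp
  also have "\<dots> = (e * padeB (Suc r) u) * padeB r u" unfolding a(1) by simp
  also have "\<dots> = d * (padeA (Suc r) u * padeB r u)" unfolding a(2)[symmetric] by simp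
  finally have "padeA r u * padeB (Suc r) u = padeA (Suc r) u * padeB r u" using d0 by simp
  then show False using pade_det_nonzero[OF ne] by blast
qed

subsection \<open>The negative Pell equation and Ljunggren's equation\<close>

text \<open>The coordinates of (1 + sqrt 2)^(2 n + 1); each step multiplies by (1 + sqrt 2)^2 = 3 +
  2 sqrt 2.\<close>

primrec pell :: "nat \<Rightarrow> int \<times> int" where
  "pell 0 = (1, 1)"
| "pell (Suc n) = (3 * fst (pell n) + 4 * snd (pell n), 2 * fst (pell n) + 3 * snd (pell n))"

lemma pell_solution: "(fst (pell n))^2 + 1 = 2 * (snd (pell n))^2"
proof (induction n)
  case (Suc n)
  have "(3 * a + 4 * b)^2 + 1 = 2 * (2 * a + 3 * b)^2 + (a^2 + 1 - 2 * b^2)" for a b :: int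
    by (simp add: power2_eq_square algebra_simps)
  then show ?case using Suc by simp
qed simp

lemma pell_pos: "fst (pell n) > 0" "snd (pell n) > 0"
  by (induction n) auto

text \<open>Descent: division by 3 + 2 sqrt 2 maps (u, v) to (3 u - 4 v, 3 v - 2 u), which is again
  positive and has a smaller second entry once v >= 3.\<close>

lemma pell_complete:
  fixes u v :: int
  assumes "u > 0" "v > 0" "u^2 + 1 = 2 * v^2"
  shows "\<exists>n. pell n = (u, v)"
  using assms
proof (induction "nat v" arbitrary: u v rule: less_induct)
  case less
  show ?case
  proof (cases "v = 1")
    case True
    then have "u^2 = 1" using less.prems by simp
    then have "u = 1" using less.prems by (simp add: power2_eq_1_iff)
    then show ?thesis using True by (intro exI[of _ 0]) simp
  next
    case False
    have "v \<noteq> 2"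
    proof
      assume "v = 2"
      then have u: "u^2 = 7" using less.prems by simp
      have "u \<le> 2 \<or> u \<ge> 3" by linarith
      then have "u^2 \<le> 2^2 \<or> u^2 \<ge> 3^2" using less.prems by (meson power_mono less_imp_le zero_le_numeral)
      then show False using u by simp
    qed
    then have v3: "v \<ge> 3" using False less.prems by linarith
    then have vv: "v^2 \<ge> 3^2" by (intro power_mono) auto
    have "v^2 < u^2" using less.prems vv by simp
    then have uv: "v < u" using less.prems by (meson power_less_imp_less_base less_imp_le)
    have "(4 * v)^2 < (3 * u)^2" using less.prems vv by (simp add: power_mult_distrib)
    then have a: "4 * v < 3 * u" using less.prems by (meson power_less_imp_less_base less_imp_le mult_nonneg_nonneg zero_le_numeral)
    have "(2 * u)^2 < (3 * v)^2" using less.prems vv by (simp add: power_mult_distrib)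
    then have b: "2 * u < 3 * v" using less.prems by (meson power_less_imp_less_base less_imp_le mult_nonneg_nonneg zero_le_numeral)
    have "(3 * u - 4 * v)^2 + 1 - 2 * (3 * v - 2 * u)^2 = u^2 + 1 - 2 * v^2"
      by (simp add: power2_eq_square algebra_simps)
    then have "(3 * u - 4 * v)^2 + 1 = 2 * (3 * v - 2 * u)^2" using less.prems by simp
    then obtain n where "pell n = (3 * u - 4 * v, 3 * v - 2 * u)"
      using less.hyps[of "3 * v - 2 * u" "3 * u - 4 * v"] a b uv less.prems by auto
    then have "pell (Suc n) = (u, v)" by simp
    then show ?thesis by blast
  qed
qed

lemma pell_unit_power:
  "real_of_int (fst (pell n)) + real_of_int (snd (pell n)) * sqrt 2 = (1 + sqrt 2) ^ (2 * n + 1)"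
proof (induction n)
  case (Suc n)
  define a b where "a = real_of_int (fst (pell n))" and "b = real_of_int (snd (pell n))"
  have "2 * Suc n + 1 = 2 + (2 * n + 1)" by simp
  then have "(1 + sqrt 2) ^ (2 * Suc n + 1) = (1 + sqrt 2)^2 * (1 + sqrt 2) ^ (2 * n + 1)"
    by (simp only: power_add)
  also have "\<dots> = (3 + 2 * sqrt 2) * (a + b * sqrt 2)"
    unfolding Suc[folded a_def b_def, symmetric] by (simp add: power2_sum)
  also have "\<dots> = 3 * a + 2 * b * (sqrt 2 * sqrt 2) + (2 * a + 3 * b) * sqrt 2"
    by (simp only: algebra_simps)
  also have "\<dots> = (3 * a + 4 * b) + (2 * a + 3 * b) * sqrt 2" by simp
  finally show ?case by (simp add: a_def b_def)
qed simp

lemma snd_pell_ge: "snd (pell n) \<ge> 5 ^ n"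
proof (induction n)
  case (Suc n)
  have "(snd (pell n))^2 \<ge> 1^2" using pell_pos[of n] by (intro power_mono) auto
  then have "(snd (pell n))^2 \<le> (fst (pell n))^2" using pell_solution[of n] by simp
  then have "snd (pell n) \<le> fst (pell n)" using pell_pos[of n] by (meson power2_le_imp_le less_imp_le)
  then show ?case using Suc by simp
qed simp

text \<open>A certificate that no second entry along the Pell recursion is a square: the list
  supplies the integer square root of each successive \<open>b\<close>.\<close>

fun between_squares :: "int \<Rightarrow> int \<Rightarrow> int list \<Rightarrow> bool" where
  "between_squares a b [] = True"
| "between_squares a b (k # ks) \<longleftrightarrow> 0 \<le> k \<and> k^2 < b \<and> b < (k + 1)^2 \<and> between_squares (3 * a + 4 * b) (2 * a + 3 * b) ks"

lemma not_square_between: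
  fixes k y :: int
  assumes "0 \<le> k" "k^2 < b" "b < (k + 1)^2"
  shows "b \<noteq> y^2"
proof
  assume "b = y^2"
  then have "k^2 < \<bar>y\<bar>^2" "\<bar>y\<bar>^2 < (k + 1)^2" using assms by simp_all
  then have "k < \<bar>y\<bar>" "\<bar>y\<bar> < k + 1"
    using power_less_imp_less_base assms(1) by fastforce+
  then show False by simp
qed

lemma between_squares_sound:
  assumes "between_squares (fst (pell j)) (snd (pell j)) ks" "i < length ks"
  shows "snd (pell (j + i)) \<noteq> y^2"
  using assms
proof (induction ks arbitrary: i j)
  case (Cons k ks)
  show ?case
  proof (cases i)
    case 0
    then show ?thesis using Cons.prems not_square_between[of k "snd (pell j)" y] by simp
  next
    case (Suc i')
    then show ?thesis using Cons.IH[of "Suc j" i'] Cons.prems by simp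
  qed
qed simp

lemma pell_small_squares:
  assumes "n < 38" "snd (pell n) = y^2"
  shows "n = 0 \<or> n = 3"
proof (rule ccontr)
  assume "\<not> ?thesis"
  then have "n = 1 + 0 \<or> n = 1 + 1 \<or> 4 \<le> n" by linarith
  moreover have "between_squares (fst (pell 1)) (snd (pell 1)) [2, 5]" by simp
  moreover have p4: "pell 4 = (1393, 985)" by (simp add: numeral_eq_Suc)
  \<comment> \<open>The integer square roots of \<open>snd (pell n)\<close> for n = 4, ..., 37.
    Indices 1 and 2 are covered by [2, 5]; indices 0 and 3 give the squares 1 and 169.\<close>
  obtain ks where ks: "length ks = 34" "between_squares 1393 985 ks"
    by (rule that[of "[31, 75, 182, 441, 1066, 2573, 6214, 15001, 36217, 87437, 211093, 509624, 1230343, 2970311, 7170966, 17312244, 41795454, 100903153, 243601760, 588106675, 1419815110, 3427736897, 8275288905, 19978314707, 48231918319, 116442151345, 281116221011, 678674593367, 1638465407746, 3955605408861, 9549676225469, 23054957859800, 55659591945070, 134374141749942]"]) simp_all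
  ultimately show False
  proof (elim disjE)
    assume "4 \<le> n"
    then have "n - 4 < length ks" unfolding ks(1) using assms(1) by linarith
    then show False using between_squares_sound[of 4 ks "n - 4" y] ks(2) p4 assms \<open>4 \<le> n\<close> by simp
  qed (use between_squares_sound[of 1 "[2, 5]" 0 y] between_squares_sound[of 1 "[2, 5]" 1 y] assms in simp_all)
qed

lemma quartic_small:
  fixes u y :: int
  assumes "u > 0" "y > 0" "u^2 + 1 = 2 * y ^ 4" "y < 4225 * 1600 ^ 3"
  shows "y = 1 \<or> y = 13"
proof -
  obtain n where n: "pell n = (u, y^2)"
    using pell_complete[of u "y^2"] assms by (auto simp flip: power_mult)
  \<comment> \<open>The growth rate 5 suffices here: 5^38 exceeds the square of the bound on
    \<open>y\<close>.\<close>
  have "n < 38"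
  proof (rule ccontr)
    assume "\<not> n < 38"
    then have "(5::int) ^ 38 \<le> 5 ^ n" by (intro power_increasing) auto
    also have "\<dots> \<le> y^2" using snd_pell_ge[of n] n by simp
    also have "\<dots> < (4225 * 1600 ^ 3)^2" using assms by (intro power_strict_mono) auto
    finally show False by simp
  qed
  then have "n = 0 \<or> n = 3" using pell_small_squares[of n y] n by simp
  then have "y^2 = 1^2 \<or> y^2 = 13^2" using n by (auto simp: numeral_3_eq_3)
  then show ?thesis
    using assms power_eq_imp_eq_base[of y 2 1] power_eq_imp_eq_base[of y 2 13] by auto
qed

section \<open>Thue's lemma and sums of two squares\<close>

lemma thue_lemma:
  fixes m c :: int and S T :: nat
  assumes "m > 0" "m < (int S + 1) * (int T + 1)"
  obtains s t where "s \<noteq> 0 \<or> t \<noteq> 0" "\<bar>s\<bar> \<le> int S" "\<bar>t\<bar> \<le> int T" "m dvd s - c * t"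
proof -
  define A where "A = {0..int S} \<times> {0..int T}"
  define f where "f = (\<lambda>(s, t). (s - c * t) mod m)"
  have "f ` A \<subseteq> {0..<m}" unfolding f_def using assms by auto
  then have "card (f ` A) \<le> card {0..<m}" by (intro card_mono) auto
  then have "int (card (f ` A)) \<le> m" using assms(1) by simp
  moreover have "card A = (S + 1) * (T + 1)" unfolding A_def by (simp add: card_cartesian_product nat_add_distrib)
  moreover have "int ((S + 1) * (T + 1)) > m" using assms by (simp add: algebra_simps)
  ultimately have "card (f ` A) < card A" by linarith
  then have "\<not> inj_on f A" by (rule pigeonhole)
  then obtain p q where pq: "p \<in> A" "q \<in> A" "p \<noteq> q" "f p = f q" unfolding inj_on_def by blast
  define s where "s = fst p - fst q"
  define t where "t = snd p - snd q"
  have "s \<noteq> 0 \<or> t \<noteq> 0" using pq(3) unfolding s_def t_def by (auto simp: prod_eq_iff)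
  moreover have "\<bar>s\<bar> \<le> int S" "\<bar>t\<bar> \<le> int T" using pq(1,2) unfolding A_def s_def t_def by auto
  moreover have "m dvd s - c * t"
  proof -
    have "m dvd (fst p - c * snd p) - (fst q - c * snd q)"
      using pq(4) unfolding f_def by (simp add: case_prod_beta mod_eq_dvd_iff)
    then show ?thesis unfolding s_def t_def by (simp add: algebra_simps)
  qed
  ultimately show thesis by (rule that)
qed

lemma int_sqrt_ex:
  fixes m :: int
  assumes "m \<ge> 0"
  obtains S :: nat where "(int S)^2 \<le> m" "m < (int S + 1)^2"
proof -
  define S where "S = nat \<lfloor>sqrt (of_int m)\<rfloor>"
  have S: "int S = \<lfloor>sqrt (of_int m)\<rfloor>" unfolding S_def using assms by simp
  have a: "of_int (int S) \<le> sqrt (of_int m)" "sqrt (of_int m) < of_int (int S) + 1"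
    unfolding S by linarith+
  have "(of_int (int S))^2 \<le> (sqrt (of_int m))^2"
    by (rule power_mono[OF a(1)]) simp
  moreover have "(sqrt (of_int m))^2 < (of_int (int S) + 1)^2"
    by (rule power_strict_mono[OF a(2)]) (use assms in simp_all)
  ultimately have "(of_int (int S))^2 \<le> (of_int m :: real)" "of_int m < (of_int (int S) + 1 :: real)^2"
    using assms by auto
  then have "of_int ((int S)^2) \<le> (of_int m :: real)" "of_int m < (of_int ((int S + 1)^2) :: real)"
    by simp_all
  then have "(int S)^2 \<le> m" "m < (int S + 1)^2" unfolding of_int_le_iff of_int_less_iff by auto
  then show thesis by (rule that)
qed

text \<open>Thue's lemma with a square box gives s^2 + t^2 = k y with k = 1 or k = 2. For k = 2, s +
  t \<i> is divided by 1 + \<i>, which keeps the congruence because y is odd.\<close>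

lemma sum_two_squares_of_root:
  fixes u y :: int
  assumes y: "y > 0" "odd y" and u: "y dvd u^2 + 1"
  obtains s t where "s^2 + t^2 = y" "y dvd s - u * t"
proof -
  obtain S where S: "(int S)^2 \<le> y" "y < (int S + 1)^2" using int_sqrt_ex[of y] y by auto
  then obtain s t where st: "s \<noteq> 0 \<or> t \<noteq> 0" "\<bar>s\<bar> \<le> int S" "\<bar>t\<bar> \<le> int S" "y dvd s - u * t"
    using thue_lemma[of y S S u] y by (auto simp: power2_eq_square)
  have us: "y dvd t + u * s"
  proof -
    have "t + u * s = u * (s - u * t) + (u^2 + 1) * t" by (simp add: power2_eq_square algebra_simps)
    then show ?thesis using st(4) u by simp
  qed
  have "s^2 + t^2 = (s - u * t) * s + (t + u * s) * t" by (simp add: power2_eq_square algebra_simps)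
  then have "y dvd s^2 + t^2" using st(4) us by simp
  then obtain k where k: "s^2 + t^2 = y * k" by (elim dvdE)
  have "s^2 \<le> (int S)^2" "t^2 \<le> (int S)^2" using st(2,3) abs_le_square_iff[of s "int S"] abs_le_square_iff[of t "int S"] by simp_all
  then have "y * k \<le> y * 2" using S k by linarith
  then have "k \<le> 2" using y by simp
  moreover have "s^2 + t^2 > 0" using st(1) by (simp add: sum_power2_gt_zero_iff)
  then have "k > 0" using k y by (simp add: zero_less_mult_iff)
  ultimately have "k = 1 \<or> k = 2" by linarith
  then show thesis
  proof
    assume "k = 1"
    then show thesis using that[of s t] k st(4) by simp
  next
    assume k2: "k = 2"
    then have "even (s^2 + t^2)" using k by simp
    then have "even (s + t)" by simp
    then obtain a where a: "s + t = 2 * a" by (elim evenE)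
    define b where "b = t - a"
    have s: "s = a - b" and t: "t = a + b" using a unfolding b_def by auto
    have "a^2 + b^2 = y" using k k2 unfolding s t by (simp add: power2_eq_square algebra_simps)
    moreover have "y dvd 2 * (a - u * b)"
    proof -
      have "2 * (a - u * b) = (s - u * t) + (t + u * s)" unfolding s t by (simp add: algebra_simps)
      then show ?thesis using st(4) us by simp
    qed
    then have "y dvd a - u * b" using y coprime_dvd_mult_right_iff[of y 2 "a - u * b"] by simp
    ultimately show thesis by (rule that)
  qed
qed

text \<open>With z = s + t \<i>, z^2 = E + F \<i> and z^4 = M + N \<i>, the congruence s = u t
  modulo y lifts to M = u N modulo y^4. The quotients w = (M - u N) / y^4 and e = (u M + N) / y^4
  satisfy w^2 + e^2 = 2, hence both are signs, and w M + e N = 1. This stands in for factoring u +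
  \<i> in the Gaussian integers.\<close>

theorem ljunggren:
  fixes u y :: int
  assumes "y > 0" "u^2 + 1 = 2 * y ^ 4"
  shows "y = 1 \<or> y = 13"
proof -
  have oddy: "odd y"
  proof
    assume "even y"
    then have "4 dvd 2 * y ^ 4" by (auto elim!: evenE simp: power4_eq_xxxx)
    then have "4 dvd u^2 + 1" using assms by simp
    then show False using square_mod_4[of u] by presburger
  qed
  have "y dvd u^2 + 1" unfolding assms(2) by (simp add: power4_eq_xxxx)
  then obtain s t where st: "s^2 + t^2 = y" "y dvd s - u * t"
    using sum_two_squares_of_root[of y u] assms oddy by blast
  define E F where "E = s^2 - t^2" and "F = 2 * s * t"
  define M N where "M = E^2 - F^2" and "N = 2 * E * F"
  have "E - u * F = (s - u * t)^2 - (u^2 + 1) * t^2"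
    unfolding E_def F_def by (simp add: power2_eq_square algebra_simps)
  moreover have "y^2 dvd (s - u * t)^2" using st(2) by (rule dvd_power_same)
  moreover have "y^2 dvd (u^2 + 1) * t^2" unfolding assms(2) by (simp add: le_imp_power_dvd)
  ultimately have EF: "y^2 dvd E - u * F" by simp
  have "M - u * N = (E - u * F)^2 - (u^2 + 1) * F^2"
    unfolding M_def N_def by (simp add: power2_eq_square algebra_simps)
  moreover have "(y^2)^2 dvd (E - u * F)^2" using EF by (rule dvd_power_same)
  moreover have "y ^ 4 dvd (u^2 + 1) * F^2" unfolding assms(2) by simp
  ultimately have "y ^ 4 dvd M - u * N" by (simp flip: power_mult)
  then obtain w where w: "M - u * N = y ^ 4 * w" by (elim dvdE)
  have MN: "M^2 + N^2 = y ^ 4"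
    unfolding M_def N_def E_def F_def st(1)[symmetric] by (simp add: power2_eq_square power4_eq_xxxx algebra_simps)
  have id: "(u * M + N)^2 + (M - u * N)^2 = 2 * (y ^ 4)^2"
  proof -
    have "(u * M + N)^2 + (M - u * N)^2 = (u^2 + 1) * (M^2 + N^2)" by (simp add: power2_eq_square algebra_simps)
    then show ?thesis unfolding MN assms(2) by (simp add: power2_eq_square)
  qed
  have y4: "y ^ 4 > 0" using assms by simp
  have "(y ^ 4)^2 * w^2 \<le> (y ^ 4)^2 * 2"
    using id zero_le_power2[of "u * M + N"] unfolding w power_mult_distrib by linarith
  then have "w^2 \<le> 2" using y4 by (simp add: mult_le_cancel_left)
  then have w1: "\<bar>w\<bar> \<le> 1" using power_mono[of 2 "\<bar>w\<bar>" 2] by (cases "\<bar>w\<bar> \<ge> 2") auto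
  have oddu: "odd u" using odd_of_square_plus_1[OF assms(2)] .
  have "odd (M^2 + N^2)" unfolding MN using oddy by simp
  then have "odd (M - u * N)" using oddu by simp
  then have "odd w" unfolding w by simp
  then have wsq: "w = 1 \<or> w = -1" using w1 by presburger
  then have w2: "w^2 = 1" by auto
  then have "(u * M + N)^2 = (y ^ 4)^2" using id unfolding w by (simp add: power_mult_distrib)
  then have "u * M + N = y ^ 4 \<or> u * M + N = - (y ^ 4)" unfolding power2_eq_iff .
  then obtain e where e: "u * M + N = y ^ 4 * e" "e = 1 \<or> e = -1" by (metis mult.right_neutral mult_minus_right)
  have "y ^ 4 * (w * M + e * N) = y ^ 4 * 1"
  proof -
    have "M * (M - u * N) + N * (u * M + N) = y ^ 4" using MN by (simp add: power2_eq_square algebra_simps)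
    then show ?thesis unfolding w e(1) by (simp add: algebra_simps)
  qed
  then have wM: "w * M + e * N = 1" using y4 by simp
  \<comment> \<open>Changing the sign of \<open>t\<close> changes only the sign of N, so the quartic
    form, which is the sum of the real and imaginary parts of the fourth power, takes the value M +
    w e N = w (w M + e N) = w.\<close>
  define t' where "t' = (w * e) * t"
  have we: "(w * e)^2 = 1" using wsq e(2) by auto
  have "s ^ 4 + 4 * s ^ 3 * t' - 6 * s^2 * t'^2 - 4 * s * t' ^ 3 + t' ^ 4 = M + (w * e) * N"
  proof -
    have "t'^2 = t^2" "t' ^ 3 = (w * e) * t ^ 3" "t' ^ 4 = t ^ 4"
      unfolding t'_def using wsq e(2) by auto
    note t = this
    show ?thesis
      unfolding t unfolding t'_def M_def N_def E_def F_def
      by (simp add: power2_eq_square power3_eq_cube power4_eq_xxxx algebra_simps)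
  qed
  moreover have "\<bar>M + (w * e) * N\<bar> = 1" using wM wsq e(2) by auto
  ultimately have "\<bar>s ^ 4 + 4 * s ^ 3 * t' - 6 * s^2 * t'^2 - 4 * s * t' ^ 3 + t' ^ 4\<bar> = 1" by simp
  moreover have "s^2 + t'^2 = y" using st(1) wsq e(2) unfolding t'_def by auto
  ultimately have "real_of_int y < 4225 * 1600 ^ 3"
    using quartic_bound[of "of_int y" s t'] by simp
  then have "y < 4225 * 1600 ^ 3" by simp
  moreover have "u \<noteq> 0" using oddu by auto
  ultimately show ?thesis using quartic_small[of "\<bar>u\<bar>" y] assms by simp
qed

subsection \<open>Lehmer numbers equal to plus or minus one\<close>

text \<open>With \<open>\<alpha> \<beta> = y\<close> and \<open>\<alpha>\<^sup>2 + \<beta>\<^sup>2 = 2 (y - h)\<close>, the \<open>k\<close>-th term is the Lehmer number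
  \<open>(\<alpha>\<^sup>n - \<beta>\<^sup>n) / (\<alpha> - \<beta>)\<close> of odd index \<open>n = 2 k + 1\<close>.\<close>

fun lehmer :: "int \<Rightarrow> int \<Rightarrow> nat \<Rightarrow> int" where
  "lehmer h y 0 = 1"
| "lehmer h y (Suc 0) = 3 * y - 2 * h"
| "lehmer h y (Suc (Suc k)) = 2 * (y - h) * lehmer h y (Suc k) - y^2 * lehmer h y k"

text \<open>A two-adic expansion: modulo \<open>2\<^sup>v\<^sup>+\<^sup>2 q\<^sup>2\<close> the power depends linearly on the exponent \<open>2\<^sup>v k\<close>,
  so a linear functional that is nonzero on \<open>\<beta>\<close> to low two-adic order separates it from \<open>1\<close>.\<close>

lemma odd_power_lift:
  fixes \<beta> q :: "'a :: comm_ring_1" and S :: "'a set"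
  assumes S: "1 \<in> S" "0 \<in> S" "\<And>a b. a \<in> S \<Longrightarrow> b \<in> S \<Longrightarrow> a + b \<in> S" "\<And>a b. a \<in> S \<Longrightarrow> b \<in> S \<Longrightarrow> a * b \<in> S"
    and b: "\<beta> \<in> S" "q \<in> S" "\<gamma> \<in> S" "\<beta> * \<beta> = 8 * \<gamma>"
  shows "\<exists>\<rho>\<in>S. (1 + q * \<beta>) ^ (2 ^ v * k) = 1 + 2 ^ v * q * (of_nat k * \<beta> + 4 * q * \<rho>)"
proof -
  have nat: "of_nat n \<in> S" for n by (induction n) (auto intro: S)
  have pow2: "2 ^ n \<in> S" for n using nat[of "2 ^ n"] by simp
  show ?thesis
  proof (induction v)
    case 0
    have "\<exists>\<rho>\<in>S. (1 + q * \<beta>) ^ k = 1 + q * (of_nat k * \<beta> + 8 * q * \<rho>)"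
    proof (induction k)
      case 0
      then show ?case using S by (intro bexI[of _ 0]) auto
    next
      case (Suc k)
      then obtain \<rho> where \<rho>: "\<rho> \<in> S" "(1 + q * \<beta>) ^ k = 1 + q * (of_nat k * \<beta> + 8 * q * \<rho>)" by blast
      have "(1 + q * \<beta>) ^ Suc k = (1 + q * \<beta>) * (1 + q * (of_nat k * \<beta> + 8 * q * \<rho>))"
        using \<rho>(2) by simp
      also have "\<dots> = 1 + q * (of_nat (Suc k) * \<beta> + 8 * q * (\<rho> + q * (\<beta> * \<rho>))) + q * q * of_nat k * (\<beta> * \<beta>)"
        by (simp add: algebra_simps)
      also have "\<dots> = 1 + q * (of_nat (Suc k) * \<beta> + 8 * q * (\<rho> + q * (\<beta> * \<rho>) + of_nat k * \<gamma>))"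
        unfolding b(4) by (simp add: algebra_simps)
      finally show ?case
        using \<rho>(1) b by (intro bexI[of _ "\<rho> + q * (\<beta> * \<rho>) + of_nat k * \<gamma>"]) (auto intro!: S nat)
    qed
    then obtain \<rho> where "\<rho> \<in> S" "(1 + q * \<beta>) ^ k = 1 + q * (of_nat k * \<beta> + 8 * q * \<rho>)" by blast
    then show ?case using nat[of 2] by (intro bexI[of _ "of_nat 2 * \<rho>"]) (auto intro: S simp: mult.assoc)
  next
    case (Suc v)
    then obtain \<rho> where \<rho>: "\<rho> \<in> S" "(1 + q * \<beta>) ^ (2 ^ v * k) = 1 + 2 ^ v * q * (of_nat k * \<beta> + 4 * q * \<rho>)" by blast
    let ?b = "of_nat k * \<beta> + 4 * q * \<rho>"
    define c where "c = of_nat k * (of_nat k * \<gamma>) + of_nat k * (q * (\<beta> * \<rho>)) + of_nat 2 * (q * (q * (\<rho> * \<rho>)))"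
    have cS: "c \<in> S" unfolding c_def using \<rho>(1) b by (intro S nat) auto
    \<comment> \<open>Squaring the expansion adds the error 2^(2 v) q^2 * 8 c, which has the
      required shape 2^(v + 1) q * (4 q * 2^v c).\<close>
    have sq: "?b * ?b = 8 * c"
    proof -
      have "?b * ?b
        = of_nat k * (of_nat k * (\<beta> * \<beta>)) + 8 * (of_nat k * (q * (\<beta> * \<rho>)) + of_nat 2 * (q * (q * (\<rho> * \<rho>))))"
        by (simp add: algebra_simps)
      then show ?thesis unfolding b(4) c_def by (simp add: algebra_simps)
    qed
    have "(1 + q * \<beta>) ^ (2 ^ Suc v * k) = (1 + q * \<beta>) ^ (2 ^ v * k) * (1 + q * \<beta>) ^ (2 ^ v * k)"
      by (simp only: power_Suc mult_2 distrib_right power_add)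
    also have "\<dots> = 1 + 2 ^ Suc v * q * ?b
        + (2 ^ v * q) * (2 ^ v * q) * (?b * ?b)"
      unfolding \<rho>(2) by (simp add: algebra_simps)
    also have "\<dots> = 1 + 2 ^ Suc v * q * (of_nat k * \<beta> + 4 * q * (\<rho> + 2 ^ v * c))"
      unfolding sq by (simp add: algebra_simps)
    finally show ?case
      using \<rho>(1) cS pow2 by (intro bexI[of _ "\<rho> + 2 ^ v * c"]) (auto intro!: S)
  qed
qed

text \<open>\<open>T\<close> stands for \<alpha>^2, a root of X^2 - 2 (y - h) X + y^2, and
  \<open>w\<close> for the linear functional taking the first two Lehmer numbers at 1 and
  \<open>T\<close>; the recurrence gives the other powers. The hypotheses make the discriminant -4 h
  (2 y - h) negative, so \<open>T\<close> is not real and the functional exists.\<close>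

lemma lehmer_functional:
  fixes h y :: int
  assumes "0 < h" "h < 2 * y"
  obtains T :: complex and w :: "complex \<Rightarrow> real" where
    "T * T = of_int (2 * (y - h)) * T - of_int (y^2)"
    "\<And>a b. w (a + b) = w a + w b" "\<And>c z. w (of_int c * z) = of_int c * w z" "w 1 = 1"
    "\<And>k. w (T ^ k) = of_int (lehmer h y k)"
proof -
  define d where "d = sqrt (of_int (h * (2 * y - h)))"
  have d: "d > 0" "d * d = of_int (h * (2 * y - h))"
    unfolding d_def using assms by auto
  define T where "T = Complex (of_int (y - h)) d"
  define \<omega> where "\<omega> = Complex 1 ((of_int (y - h) - of_int (3 * y - 2 * h)) / d)"
  define w where "w = (\<lambda>z. Re (\<omega> * z))"
  have T: "T * T = of_int (2 * (y - h)) * T - of_int (y^2)"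
    unfolding T_def by (rule complex_eqI) (simp_all add: d(2) algebra_simps power2_eq_square)
  have w: "w (a + b) = w a + w b" "w (of_int c * z) = of_int c * w z" for a b c z
    unfolding w_def by (simp_all add: algebra_simps)
  have "w (T ^ k) = of_int (lehmer h y k)" for k
  proof (induction k rule: lehmer.induct[of "\<lambda>_ _ k. w (T ^ k) = of_int (lehmer h y k)" h y])
    case (1 h y)
    then show ?case by (simp add: w_def \<omega>_def)
  next
    case 2
    then show ?case using d(1) by (simp add: w_def \<omega>_def T_def)
  next
    case (3 h' y' k)
    have "T ^ Suc (Suc k) = (T * T) * T ^ k" by simp
    also have "\<dots> = of_int (2 * (y - h)) * T ^ Suc k + of_int (- (y^2)) * T ^ k"
      unfolding T by (simp add: algebra_simps)
    finally have "w (T ^ Suc (Suc k)) = of_int (2 * (y - h)) * w (T ^ Suc k) + of_int (- (y^2)) * w (T ^ k)"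
      by (simp only: w)
    then show ?case using 3 by simp
  qed
  moreover have "w 1 = 1" by (simp add: w_def \<omega>_def)
  ultimately show thesis using that[of T w] T w by blast
qed

text \<open>The ring Z[T] when \<open>T\<close> is a quadratic integer. It serves as
  \<open>S\<close> in \<open>odd_power_lift\<close>, and the functional \<open>w\<close> takes
  integer values on it.\<close>

definition zspan :: "complex \<Rightarrow> complex set" where
  "zspan T = {of_int a + of_int b * T | a b. True}"

lemma zspanI: "z = of_int a + of_int b * T \<Longrightarrow> z \<in> zspan T"
  unfolding zspan_def by blast

lemma zspan_ring:
  assumes "T * T = of_int P * T - of_int Q"
  shows "of_int n \<in> zspan T" "T \<in> zspan T" "a \<in> zspan T \<Longrightarrow> b \<in> zspan T \<Longrightarrow> a + b \<in> zspan T"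
    "a \<in> zspan T \<Longrightarrow> b \<in> zspan T \<Longrightarrow> a * b \<in> zspan T" "a \<in> zspan T \<Longrightarrow> b \<in> zspan T \<Longrightarrow> a - b \<in> zspan T"
proof -
  show "of_int n \<in> zspan T" by (rule zspanI[of _ n 0]) simp
  show "T \<in> zspan T" by (rule zspanI[of _ 0 1]) simp
  assume "a \<in> zspan T" "b \<in> zspan T"
  then obtain m n p q where ab: "a = of_int m + of_int n * T" "b = of_int p + of_int q * T" unfolding zspan_def by blast
  show "a + b \<in> zspan T" unfolding ab by (rule zspanI[of _ "m + p" "n + q"]) (simp add: algebra_simps)
  show "a - b \<in> zspan T" unfolding ab by (rule zspanI[of _ "m - p" "n - q"]) (simp add: algebra_simps)
  have "a * b = of_int (m * p) + of_int (m * q + n * p) * T + of_int (n * q) * (T * T)"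
    unfolding ab by (simp add: algebra_simps)
  also have "\<dots> = of_int (m * p - n * q * Q) + of_int (m * q + n * p + n * q * P) * T"
    unfolding assms by (simp add: algebra_simps)
  finally show "a * b \<in> zspan T" by (rule zspanI)
qed

lemma zspan_functional:
  assumes "\<And>a b. w (a + b) = w a + w b" "\<And>c z. w (of_int c * z) = of_int c * w z" "w 1 = (1::real)" "w T = of_int t"
    and "z \<in> zspan T"
  obtains n :: int where "w z = of_int n"
proof -
  obtain a b where z: "z = of_int a * 1 + of_int b * T" using assms(5) unfolding zspan_def by auto
  have "w z = of_int (a + b * t)" unfolding z by (simp only: assms(1-4)) simp
  then show thesis by (rule that)
qed

text \<open>Lift the power of T = 1 + (T - 1) with m = 2^v k, k odd: the Lehmer number becomes 1 +
  2^v (k (3 y - 9) + 4 n), and 3 y - 9 = 2 modulo 4 makes the bracket nonzero. The shape of y is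
  that of 3 s^2 + 2 with s odd.\<close>

lemma lehmer_4_neq_1:
  fixes e :: int
  assumes "e \<ge> 0" "m > 0"
  shows "lehmer 4 (5 + 24 * e) m \<noteq> 1"
proof
  define y where "y = 5 + 24 * e"
  assume "lehmer 4 (5 + 24 * e) m = 1"
  then have eq: "lehmer 4 y m = 1" unfolding y_def .
  obtain T :: complex and w :: "complex \<Rightarrow> real" where T: "T * T = of_int (2 * (y - 4)) * T - of_int (y^2)"
    and w: "\<And>a b. w (a + b) = w a + w b" "\<And>c z. w (of_int c * z) = of_int c * w z" "w 1 = 1"
    and wT: "\<And>k. w (T ^ k) = of_int (lehmer 4 y k)"
    by (rule lehmer_functional[of 4 y]) (use assms y_def in auto)
  obtain v k where vk: "odd k" "m = 2 ^ v * k" using pos_eq_power_2_times_odd assms by blast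
  note R = zspan_ring[OF T]
  have wT1: "w T = of_int (3 * y - 8)" using wT[of 1] by simp
  have one: "1 \<in> zspan T" "0 \<in> zspan T" using R(1)[of 1] R(1)[of 0] by auto
  have g: "(T - 1) * (T - 1) = 8 * (of_int (- 3 - 30 * e - 72 * e^2) + of_int (6 * e) * T)"
  proof -
    have "(T - 1) * (T - 1) = T * T - 2 * T + 1" by (simp add: algebra_simps)
    then show ?thesis unfolding T y_def by (simp add: algebra_simps power2_eq_square)
  qed
  have "\<exists>\<rho>\<in>zspan T. (1 + 1 * (T - 1)) ^ (2 ^ v * k) = 1 + 2 ^ v * 1 * (of_nat k * (T - 1) + 4 * 1 * \<rho>)"
    by (rule odd_power_lift[OF one R(3,4) R(5)[OF R(2) one(1)] one(1) zspanI[OF refl] g])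
  then obtain \<rho> where \<rho>: "\<rho> \<in> zspan T" "T ^ m = 1 + 2 ^ v * (of_nat k * (T - 1) + 4 * \<rho>)"
    unfolding vk(2) by auto
  obtain n where n: "w \<rho> = of_int n" by (rule zspan_functional[OF w wT1 \<rho>(1)])
  have "T ^ m = 1 + of_int (2 ^ v) * (of_int (int k) * (T + of_int (-1) * 1) + of_int 4 * \<rho>)"
    unfolding \<rho>(2) by simp
  then have "w (T ^ m) = 1 + of_int (2 ^ v) * (of_int (int k) * (of_int (3 * y - 8) + of_int (-1) * 1) + of_int 4 * of_int n)"
    by (simp only: w wT1 n)
  then have "of_int (2 ^ v * (int k * (3 * y - 9) + 4 * n)) = (0::real)" unfolding wT eq by (simp add: algebra_simps)
  then have "int k * (3 * y - 9) + 4 * n = 0" unfolding of_int_eq_0_iff by simp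
  moreover have "int k * (3 * y - 9) = 4 * (int k * (1 + 18 * e)) + 2 * int k" unfolding y_def by (simp add: algebra_simps)
  ultimately have "4 * (int k * (1 + 18 * e)) + 2 * int k + 4 * n = 0" by simp
  then have "even (int k)" by presburger
  then show False using vk(1) by simp
qed

text \<open>Excludes the value -1, which \<open>lehmer_4_neq_1\<close> leaves open.\<close>

lemma lehmer_4_mod_3:
  assumes "y mod 3 = 2"
  shows "lehmer 4 y k mod 3 = 1 \<and> lehmer 4 y (Suc k) mod 3 = 1"
proof (induction k)
  case 0
  then show ?case using assms by simp presburger
next
  case (Suc k)
  have "[y = 2] (mod 3)" "[lehmer 4 y k = 1] (mod 3)" "[lehmer 4 y (Suc k) = 1] (mod 3)"
    using assms Suc by (auto simp: cong_def)
  then have "[lehmer 4 y (Suc (Suc k)) = 2 * (2 - 4) * 1 - 2^2 * 1] (mod 3)"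
    unfolding lehmer.simps by (intro cong_diff cong_mult cong_pow cong_refl)
  then have "lehmer 4 y (Suc (Suc k)) mod 3 = 1" by (simp add: cong_def)
  then show ?case using Suc by simp
qed

text \<open>Here T^2 = -(1 + q \<beta>) with q = y - 1, so the lift applies to powers of T^2 and the
  parities of \<open>m\<close> are separated. Up to sign the Lehmer number is 1 + q^2 2^v (4 n - 5
  k) for m = 2^(v + 1) k with k odd, and 1 + q (3 + 4 z) for odd m. Both differ from 1, and from -1
  because 4 divides q.\<close>

lemma lehmer_1_ne_pm1:
  fixes q' :: int
  assumes "q' > 0" "m > 0"
  shows "lehmer 1 (1 + 4 * q') m \<noteq> 1" "lehmer 1 (1 + 4 * q') m \<noteq> - 1"
proof -
  define q where "q = 4 * q'"
  define y where "y = 1 + q"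
  have q4: "q \<ge> 4" unfolding q_def using assms by simp
  obtain T :: complex and w :: "complex \<Rightarrow> real" where T: "T * T = of_int (2 * (y - 1)) * T - of_int (y^2)"
    and w: "\<And>a b. w (a + b) = w a + w b" "\<And>c z. w (of_int c * z) = of_int c * w z" "w 1 = 1"
    and wT: "\<And>k. w (T ^ k) = of_int (lehmer 1 y k)"
    by (rule lehmer_functional[of 1 y]) (use assms y_def q_def in auto)
  note R = zspan_ring[OF T]
  have one: "1 \<in> zspan T" "0 \<in> zspan T" using R(1)[of 1] R(1)[of 0] by auto
  have wT1: "w T = of_int (3 * y - 2)" using wT[of 1] by simp
  have wT2: "w (T * T) = of_int (5 * q^2 - 1)"
    using wT[of 2] unfolding y_def by (simp add: numeral_2_eq_2 power2_eq_square algebra_simps)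
  define \<beta> where "\<beta> = of_int (2 + q) * 1 + of_int (-2) * T"
  define \<gamma> where "\<gamma> = of_int (2 * q' - 4 * q' - 8 * q'^2 + 2 * q'^2) + of_int (4 * q' - 1 - 2 * q') * T"
  have bS: "\<beta> \<in> zspan T" "\<gamma> \<in> zspan T"
    unfolding \<beta>_def \<gamma>_def mult_1_right by (rule zspanI[OF refl])+
  have g: "\<beta> * \<beta> = 8 * \<gamma>"
  proof -
    have "\<beta> * \<beta> = of_int ((2 + q)^2) - of_int (4 * (2 + q)) * T + 4 * (T * T)"
      unfolding \<beta>_def by (simp add: algebra_simps power2_eq_square)
    then show ?thesis unfolding T \<gamma>_def y_def q_def by (simp add: algebra_simps power2_eq_square)
  qed
  have N: "T * T = - (1 + of_int q * \<beta>)"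
    unfolding T \<beta>_def y_def by (simp add: algebra_simps power2_eq_square)
  have key: "\<exists>\<rho>\<in>zspan T. (1 + of_int q * \<beta>) ^ (2 ^ v * k) = 1 + 2 ^ v * of_int q * (of_nat k * \<beta> + 4 * of_int q * \<rho>)" for v k
    by (rule odd_power_lift[OF one R(3,4) bS(1) R(1) bS(2) g])
  have Tpow: "T ^ (2 * j) = of_int ((-1) ^ j) * (1 + of_int q * \<beta>) ^ j" for j
  proof -
    have "T ^ (2 * j) = (T * T) ^ j" by (simp add: power_mult power2_eq_square)
    also have "\<dots> = (-1) ^ j * (1 + of_int q * \<beta>) ^ j" unfolding N by (metis mult_minus1 power_mult_distrib)
    finally show ?thesis by simp
  qed
  have sgn: "(-1) ^ j = (1::int) \<or> (-1) ^ j = (-1::int)" for j :: nat by (cases "even j") auto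
  have ne: "lehmer 1 y m \<noteq> 1 \<and> lehmer 1 y m \<noteq> - 1"
  proof (cases "even m")
    case True
    then obtain j where j: "m = 2 * j" by (elim evenE)
    then have "j > 0" using assms by simp
    then obtain v k where vk: "odd k" "j = 2 ^ v * k" using pos_eq_power_2_times_odd by blast
    obtain \<rho> where \<rho>: "\<rho> \<in> zspan T" "(1 + of_int q * \<beta>) ^ j = 1 + 2 ^ v * of_int q * (of_nat k * \<beta> + 4 * of_int q * \<rho>)"
      using key[of v k] unfolding vk(2) by blast
    obtain n where n: "w \<rho> = of_int n" by (rule zspan_functional[OF w wT1 \<rho>(1)])
    let ?z = "q * (q * (2 ^ v * (4 * n - 5 * int k)))"
    have "T ^ m = of_int ((-1) ^ j) * (1 + of_int (2 ^ v * q) * (of_int (int k) * (of_int (2 + q) * 1 + of_int (-2) * T) + of_int (4 * q) * \<rho>))"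
      unfolding j Tpow \<rho>(2) by (simp add: \<beta>_def)
    then have "w (T ^ m) = of_int ((-1) ^ j) * (1 + of_int (2 ^ v * q) * (of_int (int k) * (of_int (2 + q) * 1 + of_int (-2) * of_int (3 * y - 2)) + of_int (4 * q) * of_int n))"
      by (simp only: w wT1 n)
    also have "\<dots> = of_int ((-1) ^ j * (1 + ?z))"
      unfolding y_def by (simp add: algebra_simps)
    finally have L: "lehmer 1 y m = (-1) ^ j * (1 + ?z)"
      unfolding wT by (simp only: of_int_eq_iff)
    have "4 * n - 5 * int k \<noteq> 0"
    proof
      assume "4 * n - 5 * int k = 0"
      then have "5 * int k = 2 * (2 * n)" by simp
      then have "even (5 * int k)" by (metis dvd_triv_left)
      then show False using vk(1) by simp
    qed
    then have nz: "?z \<noteq> 0" using q4 by simp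
    moreover have "?z \<noteq> - 2"
    proof
      assume "?z = - 2"
      moreover have "4 dvd q * c" for c unfolding q_def by simp
      ultimately have "4 dvd (-2::int)" by metis
      then show False by simp
    qed
    ultimately show ?thesis unfolding L using sgn[of j] by auto
  next
    case False
    then obtain j where j: "m = 2 * j + 1" by (elim oddE)
    obtain \<rho> where \<rho>: "\<rho> \<in> zspan T" "(1 + of_int q * \<beta>) ^ j = 1 + of_int q * (of_nat j * \<beta> + 4 * of_int q * \<rho>)"
      using key[of 0 j] by auto
    have "T * \<rho> \<in> zspan T" using R(2,4) \<rho>(1) by blast
    then obtain n where n: "w (T * \<rho>) = of_int n" by (rule zspan_functional[OF w wT1])
    have "T ^ m = T * T ^ (2 * j)" unfolding j by simp
    also have "\<dots> = of_int ((-1) ^ j) * (T + of_int q * (of_int (int j) * (of_int (2 + q) * T + of_int (-2) * (T * T)) + of_int (4 * q) * (T * \<rho>)))"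
      unfolding Tpow \<rho>(2) by (simp add: \<beta>_def algebra_simps)
    finally have "w (T ^ m) = of_int ((-1) ^ j) * (of_int (3 * y - 2) + of_int q * (of_int (int j) * (of_int (2 + q) * of_int (3 * y - 2) + of_int (-2) * of_int (5 * q^2 - 1)) + of_int (4 * q) * of_int n))"
      by (simp only: w wT1 wT2 n)
    also have "\<dots> = of_int ((-1) ^ j * (1 + q * (3 + 4 * (int j * (1 + 7 * q' - 7 * q * q') + q * n))))"
      unfolding y_def q_def by (simp add: algebra_simps power2_eq_square)
    finally have L: "lehmer 1 y m = (-1) ^ j * (1 + q * (3 + 4 * (int j * (1 + 7 * q' - 7 * q * q') + q * n)))"
      unfolding wT by (simp only: of_int_eq_iff)
    define z where "z = int j * (1 + 7 * q' - 7 * q * q') + q * n"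
    have "3 + 4 * z \<noteq> 0" by presburger
    then have "q * (3 + 4 * z) \<noteq> 0" using q4 by simp
    moreover have "q * (3 + 4 * z) \<noteq> - 2"
    proof
      assume "q * (3 + 4 * z) = - 2"
      moreover have "4 dvd q * c" for c unfolding q_def by simp
      ultimately have "4 dvd (-2::int)" by metis
      then show False by simp
    qed
    ultimately show ?thesis unfolding L z_def[symmetric] using sgn[of j] by auto
  qed
  then show "lehmer 1 (1 + 4 * q') m \<noteq> 1" "lehmer 1 (1 + 4 * q') m \<noteq> - 1"
    unfolding y_def q_def by auto
qed

text \<open>As y^2 = 1 + 8 f, one gets T^2 = -(1 + 8 \<beta>) with \<beta> = f - g T, and w takes
  the odd value 153 - 10 g^2 at \<beta>; so the Lehmer number is, up to sign, 1 + 8 * 2^v times an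
  odd number. The lift uses 4 \<beta> and q = 2, since (4 \<beta>)^2 is divisible by 8 without any
  condition on \<beta>.\<close>

lemma lehmer_35_even:
  fixes g :: int
  assumes "35 < 2 * (35 + 4 * g)" "m > 0" "even m"
  shows "lehmer 35 (35 + 4 * g) m \<noteq> 1" "lehmer 35 (35 + 4 * g) m \<noteq> - 1"
proof -
  define y where "y = 35 + 4 * g"
  define f where "f = (2 * g + 17) * (g + 9)"
  have yf: "y^2 = 1 + 8 * f" unfolding y_def f_def by (simp add: power2_eq_square algebra_simps)
  obtain T :: complex and w :: "complex \<Rightarrow> real" where T: "T * T = of_int (2 * (y - 35)) * T - of_int (y^2)"
    and w: "\<And>a b. w (a + b) = w a + w b" "\<And>c z. w (of_int c * z) = of_int c * w z" "w 1 = 1"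
    and wT: "\<And>k. w (T ^ k) = of_int (lehmer 35 y k)"
    by (rule lehmer_functional[of 35 y]) (use assms y_def in auto)
  note R = zspan_ring[OF T]
  have one: "1 \<in> zspan T" "0 \<in> zspan T" using R(1)[of 1] R(1)[of 0] by auto
  have wT1: "w T = of_int (3 * y - 70)" using wT[of 1] by simp
  define \<beta> where "\<beta> = of_int f + of_int (- g) * T"
  have bS: "\<beta> \<in> zspan T" unfolding \<beta>_def by (rule zspanI[OF refl])
  have bS4: "4 * \<beta> \<in> zspan T" using R(4)[OF R(1)[of 4] bS] by simp
  have cS: "2 * (\<beta> * \<beta>) \<in> zspan T" using R(4)[OF R(1)[of 2] R(4)[OF bS bS]] by simp
  have two: "2 \<in> zspan T" using R(1)[of 2] by simp
  have N: "T * T = - (1 + 2 * (4 * \<beta>))"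
    unfolding T \<beta>_def yf by (simp add: y_def algebra_simps)
  obtain j where j: "m = 2 * j" using assms(3) by (elim evenE)
  then have "j > 0" using assms by simp
  then obtain v k where vk: "odd k" "j = 2 ^ v * k" using pos_eq_power_2_times_odd by blast
  have "\<exists>\<rho>\<in>zspan T. (1 + 2 * (4 * \<beta>)) ^ (2 ^ v * k) = 1 + 2 ^ v * 2 * (of_nat k * (4 * \<beta>) + 4 * 2 * \<rho>)"
    by (rule odd_power_lift[OF one R(3,4) bS4 two cS]) simp_all
  then obtain \<rho> where \<rho>: "\<rho> \<in> zspan T" "(1 + 2 * (4 * \<beta>)) ^ j = 1 + 2 ^ v * 2 * (of_nat k * (4 * \<beta>) + 4 * 2 * \<rho>)"
    unfolding vk(2) by blast
  obtain n where n: "w \<rho> = of_int n" by (rule zspan_functional[OF w wT1 \<rho>(1)])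
  have "T ^ m = (T * T) ^ j" unfolding j by (simp add: power_mult power2_eq_square)
  also have "\<dots> = (-1) ^ j * (1 + 2 * (4 * \<beta>)) ^ j" unfolding N by (metis mult_minus1 power_mult_distrib)
  also have "\<dots> = of_int ((-1) ^ j) * (1 + of_int (8 * 2 ^ v) * (of_int (int k) * (of_int f * 1 + of_int (- g) * T) + of_int 2 * \<rho>))"
    unfolding \<rho>(2) by (simp add: \<beta>_def)
  finally have "w (T ^ m) = of_int ((-1) ^ j) * (1 + of_int (8 * 2 ^ v) * (of_int (int k) * (of_int f * 1 + of_int (- g) * of_int (3 * y - 70)) + of_int 2 * of_int n))"
    by (simp only: w wT1 n)
  also have "\<dots> = of_int ((-1) ^ j * (1 + 8 * (2 ^ v * (int k * (f - g * (3 * y - 70)) + 2 * n))))"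
    by simp
  also have "f - g * (3 * y - 70) = 153 - 10 * g^2"
    unfolding f_def y_def by (simp add: power2_eq_square algebra_simps)
  finally have L: "lehmer 35 y m = (-1) ^ j * (1 + 8 * (2 ^ v * (int k * (153 - 10 * g^2) + 2 * n)))"
    unfolding wT by (simp only: of_int_eq_iff)
  have "odd (int k * (153 - 10 * g^2) + 2 * n)" using vk(1) by simp
  then have "int k * (153 - 10 * g^2) + 2 * n \<noteq> 0" by (metis even_zero)
  then have nz: "2 ^ v * (int k * (153 - 10 * g^2) + 2 * n) \<noteq> 0" by simp
  have "1 + 8 * z \<noteq> 1 \<and> 1 + 8 * z \<noteq> -1" if "z \<noteq> 0" for z :: int using that by presburger
  from this[OF nz] have "lehmer 35 y m \<noteq> 1 \<and> lehmer 35 y m \<noteq> - 1"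
    unfolding L by (cases "even j") auto
  then show "lehmer 35 (35 + 4 * g) m \<noteq> 1" "lehmer 35 (35 + 4 * g) m \<noteq> - 1"
    unfolding y_def by auto
qed

text \<open>Modulo a divisor of \<open>h\<close> the characteristic polynomial X^2 - 2 (y - h) X +
  y^2 becomes (X - y)^2. For h = 35 this is applied modulo 5 and 7, where it relates p = 2 k + 1 to
  a power of y.\<close>

lemma lehmer_cong_double_root:
  assumes "[h = 0] (mod m)"
  shows "[lehmer h y k = (2 * int k + 1) * y ^ k] (mod m)"
proof -
  have "[lehmer h y k = (2 * int k + 1) * y ^ k] (mod m) \<and> [lehmer h y (Suc k) = (2 * int (Suc k) + 1) * y ^ Suc k] (mod m)"
  proof (induction k)
    case 0
    have "[3 * y - 2 * h = 3 * y - 2 * 0] (mod m)" by (intro cong_diff cong_mult cong_refl assms)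
    then show ?case by simp
  next
    case (Suc k)
    have "[lehmer h y (Suc (Suc k)) = 2 * (y - 0) * ((2 * int (Suc k) + 1) * y ^ Suc k) - y^2 * ((2 * int k + 1) * y ^ k)] (mod m)"
      unfolding lehmer.simps by (intro cong_diff cong_mult cong_refl assms) (use Suc in auto)
    also have "2 * (y - 0) * ((2 * int (Suc k) + 1) * y ^ Suc k) - y^2 * ((2 * int k + 1) * y ^ k) = (2 * int (Suc (Suc k)) + 1) * y ^ Suc (Suc k)"
      by (simp add: power2_eq_square algebra_simps)
    finally show ?case using Suc by blast
  qed
  then show ?thesis by blast
qed

lemma lehmer_35_mod_3:
  assumes "y mod 3 = 1"
  shows "[lehmer 35 y k = (-1) ^ k] (mod 3) \<and> [lehmer 35 y (Suc k) = (-1) ^ Suc k] (mod 3)"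
proof (induction k)
  case 0
  have "(3 * y - 70) mod 3 = (-1) mod 3" by presburger
  then show ?case by (simp add: cong_def)
next
  case (Suc k)
  have y: "[y = 1] (mod 3)" using assms by (simp add: cong_def)
  have "[lehmer 35 y (Suc (Suc k)) = 2 * (1 - 35) * (-1) ^ Suc k - 1^2 * (-1) ^ k] (mod 3)"
    unfolding lehmer.simps by (intro cong_diff cong_mult cong_pow cong_refl y) (use Suc in auto)
  also have "2 * (1 - 35) * (-1) ^ Suc k - 1^2 * (-1) ^ k = (-1) ^ Suc (Suc k) + 3 * (22 * (-1) ^ k :: int)" by simp
  also have "[(-1) ^ Suc (Suc k) + 3 * (22 * (-1) ^ k) = (-1) ^ Suc (Suc k)] (mod (3::int))"
    by (simp only: cong_def mod_mult_self2)
  finally show ?case using Suc by blast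
qed

text \<open>Terms four apart agree modulo 16, because y^2 = 1 modulo 8 and 2 (y - 35) = 8 g. For the
  value -1 this yields g = 1 modulo 4.\<close>

lemma lehmer_35_mod_16:
  fixes g :: int
  shows "[lehmer 35 (35 + 4 * g) (4 * i + 1) = 35 + 12 * g] (mod 16)"
proof (induction i)
  case 0
  then show ?case by simp
next
  case (Suc i)
  define y where "y = 35 + 4 * g"
  define L where "L = lehmer 35 y"
  define k where "k = 4 * i + 1"
  have y2: "y^2 = 1 + 8 * (2 * g^2 + 35 * g + 153)" unfolding y_def by (simp add: power2_eq_square algebra_simps)
  define f where "f = 2 * g^2 + 35 * g + 153"
  have rec: "L (Suc (Suc n)) = 8 * g * L (Suc n) - (1 + 8 * f) * L n" for n
    using y2 unfolding L_def f_def by (simp add: y_def)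
  have "L (Suc (Suc (Suc (Suc k)))) = 8 * g * (8 * g * L (Suc (Suc k)) - (1 + 8 * f) * L (Suc k)) - (1 + 8 * f) * (8 * g * L (Suc k) - (1 + 8 * f) * L k)"
    by (simp only: rec)
  also have "\<dots> = L k + 16 * (g * (4 * g * L (Suc (Suc k)) - (1 + 8 * f) * L (Suc k)) + (f + 4 * f^2) * L k)"
    by (simp add: power2_eq_square algebra_simps)
  finally have "L (Suc (Suc (Suc (Suc k)))) = L k + 16 * (g * (4 * g * L (Suc (Suc k)) - (1 + 8 * f) * L (Suc k)) + (f + 4 * f^2) * L k)" .
  then have "[L (Suc (Suc (Suc (Suc k)))) = L k] (mod 16)" by (simp only: cong_def mod_mult_self2)
  note h = cong_trans[OF this]
  have e: "4 * Suc i + 1 = Suc (Suc (Suc (Suc k)))" unfolding k_def by simp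
  show ?case unfolding e using h Suc unfolding L_def y_def k_def by blast
qed

text \<open>Modulo g one has y = 35 and the middle coefficient 8 g vanishes, so two steps of the
  recurrence multiply by -(35^2). For the value -1 this yields that g divides 35^k + 1.\<close>

lemma lehmer_35_mod_gap:
  fixes g :: int
  shows "[lehmer 35 (35 + 4 * g) (4 * i + 1) = 35 ^ (4 * i + 1)] (mod g)"
proof (induction i)
  case 0
  have "[35 + 12 * g = 35] (mod g)" by (simp add: cong_def)
  then show ?case by simp
next
  case (Suc i)
  define y where "y = 35 + 4 * g"
  define L where "L = lehmer 35 y"
  define k where "k = 4 * i + 1"
  have y: "[y = 35] (mod g)" unfolding y_def by (simp add: cong_def)
  have rec: "[L (Suc (Suc n)) = - (35^2 * L n)] (mod g)" for n
  proof -
    have "[8 * g * L (Suc n) - y^2 * L n = 0 - 35^2 * L n] (mod g)"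
      by (intro cong_diff cong_mult cong_pow y cong_refl) (simp add: cong_0_iff)
    then show ?thesis unfolding L_def by (simp add: y_def)
  qed
  have "[L (Suc (Suc (Suc (Suc k)))) = - (35^2 * L (Suc (Suc k)))] (mod g)" by (rule rec)
  also have "[- (35^2 * L (Suc (Suc k))) = - (35^2 * (- (35^2 * L k)))] (mod g)"
    by (simp only: cong_minus_minus_iff) (intro cong_mult cong_refl rec)
  also have "[- (35^2 * (- (35^2 * L k))) = - (35^2 * (- (35^2 * 35 ^ k)))] (mod g)"
    by (simp only: cong_minus_minus_iff) (intro cong_mult cong_refl, simp only: cong_minus_minus_iff, intro cong_mult cong_refl, use Suc in \<open>simp add: L_def k_def y_def\<close>)
  also have "- (35^2 * (- (35^2 * 35 ^ k))) = (35 :: int) ^ Suc (Suc (Suc (Suc k)))" by simp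
  finally have h: "[L (Suc (Suc (Suc (Suc k)))) = 35 ^ Suc (Suc (Suc (Suc k)))] (mod g)" .
  have e: "4 * Suc i + 1 = Suc (Suc (Suc (Suc k)))" unfolding k_def by simp
  show ?case unfolding e using h unfolding L_def y_def by blast
qed

text \<open>With a = s sqrt 3 and b = sqrt (-35), 2^k times the Lehmer number is ((a + b)^p - (a -
  b)^p) / (2 b). In its expansion the inner binomial coefficients are divisible by p, the powers a^p
  cancel, and b^(p - 1) = (-35)^k is left.\<close>

lemma lehmer_35_prime_cong:
  assumes p: "prime p" "p = 2 * k + 1" and y: "3 * s^2 + 35 = 2 * y"
  shows "int p dvd 2 ^ k * lehmer 35 y k - (-35) ^ k"
proof -
  define a b where "a = of_real (sqrt 3) * (of_int s :: complex)" and "b = \<i> * of_real (sqrt 35)"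
  have aa: "a * a = of_int (3 * s^2)"
  proof -
    have "a * a = of_real (sqrt 3 * sqrt 3) * of_int (s * s)"
      unfolding a_def by (simp only: of_real_mult of_int_mult mult_ac)
    also have "sqrt 3 * sqrt 3 = (3::real)" by simp
    finally show ?thesis by (simp add: power2_eq_square)
  qed
  have bb: "b * b = - 35"
  proof -
    have "b * b = (\<i> * \<i>) * of_real (sqrt 35 * sqrt 35)" unfolding b_def by (simp only: of_real_mult mult_ac)
    also have "sqrt 35 * sqrt 35 = (35::real)" by simp
    finally show ?thesis by simp
  qed
  have b0: "b \<noteq> 0" using bb by auto
  have yc: "3 * (of_int s)^2 + 35 = 2 * (of_int y :: complex)"
    using arg_cong[OF y, of "of_int :: int \<Rightarrow> complex"] by simp
  define V where "V = (\<lambda>k. (a + b) ^ (2 * k + 1) - (a - b) ^ (2 * k + 1))"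
  have V: "V k = 2 * b * of_int (2 ^ k * lehmer 35 y k) \<and> V (Suc k) = 2 * b * of_int (2 ^ Suc k * lehmer 35 y (Suc k))" for k
  proof (induction k)
    case 0
    have "V (Suc 0) = 2 * b * (3 * (a * a) + b * b)"
      unfolding V_def by (simp add: algebra_simps numeral_3_eq_3)
    also have "3 * (a * a) + b * b = 3 * (3 * (of_int s)^2 + 35) - 140" unfolding aa bb by simp
    also have "\<dots> = of_int (2 ^ Suc 0 * lehmer 35 y (Suc 0))" unfolding yc by simp
    finally show ?case by (simp add: V_def)
  next
    case (Suc k)
    have r: "V (Suc (Suc k)) = (2 * (a * a + b * b)) * V (Suc k) - ((a * a - b * b) * (a * a - b * b)) * V k"
    proof -
      have "X ^ (2 * Suc (Suc k) + 1) = X * X * X * X * X ^ (2 * k + 1)" "X ^ (2 * Suc k + 1) = X * X * X ^ (2 * k + 1)" for X :: complex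
        by simp_all
      note X = this
      have "2 * (a * a + b * b) = (a + b) * (a + b) + (a - b) * (a - b)"
        "(a * a - b * b) * (a * a - b * b) = (a + b) * (a + b) * ((a - b) * (a - b))"
        by (simp_all add: algebra_simps)
      moreover have "x * x * x * x * p - z * z * z * z * q = (x * x + z * z) * (x * x * p - z * z * q) - (x * x * (z * z)) * (p - q)"
        for x z p q :: complex by (simp add: algebra_simps)
      ultimately show ?thesis unfolding V_def X by presburger
    qed
    have e1: "2 * (a * a + b * b) = 4 * of_int (y - 35)"
    proof -
      have "2 * (a * a + b * b) = 2 * (3 * (of_int s)^2 + 35) - 140" unfolding aa bb by simp
      then show ?thesis unfolding yc by simp
    qed
    have e2: "a * a - b * b = 2 * of_int y"
      using yc unfolding aa bb by simp
    show ?case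
      using Suc unfolding r e1 e2 by (simp add: power2_eq_square algebra_simps)
  qed
  define c where "c = (\<lambda>i. if even i then int (p choose i) * (3 * s^2) ^ (i div 2) * (-35) ^ (k - i div 2) else 0)"
  have "V k = (\<Sum>i\<le>p. of_nat (p choose i) * a ^ i * b ^ (p - i)) - (\<Sum>i\<le>p. of_nat (p choose i) * a ^ i * (- b) ^ (p - i))"
    unfolding V_def p(2)[symmetric] using binomial_ring[of a b p] binomial_ring[of a "- b" p] by simp
  also have "\<dots> = (\<Sum>i\<le>p. 2 * b * of_int (c i))"
    unfolding sum_subtractf[symmetric]
  proof (rule sum.cong[OF refl])
    fix i assume "i \<in> {..p}"
    then have ip: "i \<le> p" by simp
    show "of_nat (p choose i) * a ^ i * b ^ (p - i) - of_nat (p choose i) * a ^ i * (- b) ^ (p - i) = 2 * b * of_int (c i)"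
    proof (cases "even i")
      case True
      then obtain j where j: "i = 2 * j" by (elim evenE)
      then have pj: "p - i = Suc (2 * (k - j))" using ip p(2) by arith
      have "(- b) ^ (p - i) = - (b ^ (p - i))" unfolding pj by simp
      moreover have "b ^ (p - i) = b * (b * b) ^ (k - j)" unfolding pj by (simp add: power_mult power2_eq_square)
      moreover have "a ^ i = (a * a) ^ j" unfolding j by (simp add: power_mult power2_eq_square)
      ultimately show ?thesis unfolding c_def using j aa bb by simp
    next
      case False
      then have "even (p - i)" using ip p(2) by simp
      then show ?thesis unfolding c_def using False by simp
    qed
  qed
  also have "\<dots> = 2 * b * of_int (\<Sum>i\<le>p. c i)" by (simp add: sum_distrib_left)
  finally have "2 * b * of_int (2 ^ k * lehmer 35 y k) = 2 * b * of_int (\<Sum>i\<le>p. c i)" using V[of k] by simp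
  then have "(of_int (2 ^ k * lehmer 35 y k) :: complex) = of_int (\<Sum>i\<le>p. c i)" using b0 by simp
  then have "2 ^ k * lehmer 35 y k = (\<Sum>i\<le>p. c i)" by (simp only: of_int_eq_iff)
  also have "\<dots> = c 0 + (\<Sum>i\<in>{1..p}. c i)"
  proof -
    have "{..p} = insert 0 {1..p}" by auto
    then show ?thesis by simp
  qed
  finally have "2 ^ k * lehmer 35 y k - (-35) ^ k = (\<Sum>i\<in>{1..p}. c i)" by (simp add: c_def)
  note e = this
  have c: "int p dvd c i" if "i \<in> {1..p}" for i
  proof (cases "even i")
    case True
    then have "0 < i" "i < p" using that p(2) by (auto simp: le_less)
    then have "p dvd p choose i" using p(1) by (intro dvd_choose_prime) auto
    then have "int p dvd int (p choose i)" by simp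
    then show ?thesis unfolding c_def using True by simp
  qed (simp add: c_def)
  show ?thesis unfolding e by (rule dvd_sum) (rule c)
qed

text \<open>Gauss's lemma: for p = 8 m + 7 the doubles exceeding (p - 1) / 2 are those of 2 m + 2,
  ..., 4 m + 3, an even number of them.\<close>

lemma Legendre_2:
  assumes "prime p" "p mod 8 = 7"
  shows "Legendre 2 (int p) = 1"
proof -
  obtain m where m: "p = 8 * m + 7" using assms(2) by (metis mult_div_mod_eq)
  have "\<not> int p dvd 2" using m by (auto dest: zdvd_imp_le)
  then interpret GAUSS p 2
    by unfold_locales (use assms m in \<open>auto simp: cong_0_iff\<close>)
  have "E = (\<lambda>x. x * 2) ` {2 * int m + 2..4 * int m + 3}"
  proof -
    have h: "(int p - 1) div 2 = 4 * int m + 3" using m by simp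
    have "C = (\<lambda>x. x * 2) ` {0<..4 * int m + 3}"
      unfolding C_def B_def A_def image_image h using m by (intro image_cong refl) (auto intro!: mod_pos_pos_trivial)
    then show ?thesis unfolding E_def h by (auto simp: image_iff)
  qed
  then have "card E = card {2 * int m + 2..4 * int m + 3}"
    by (simp add: card_image inj_on_def)
  also have "\<dots> = 2 * m + 2" by simp
  finally show ?thesis using gauss_lemma by simp
qed

text \<open>For such p the Legendre symbols of -1, 2, 5 and 7 are -1, 1, (p/5) = 1 and -(p/7) = -1.
  Hence -70 is a quadratic residue and its k-th power is 1 by Euler's criterion.\<close>

lemma not_minus_70_power:
  assumes p: "prime p" "p = 2 * k + 1" "p mod 8 = 7" and "p mod 5 = 1 \<or> p mod 5 = 4" and "p mod 7 = 1 \<or> p mod 7 = 2 \<or> p mod 7 = 4"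
  shows "\<not> [(-70) ^ k = -1] (mod int p)"
proof
  assume A: "[(-70) ^ k = -1] (mod int p)"
  have kodd: "odd k" using p(2,3) by presburger
  have p2: "2 < p" using p(3) mod_less_eq_dividend[of p 8] by simp
  have p5: "p \<noteq> 5" and p7: "p \<noteq> 7" using assms by auto
  have half: "(p - 1) div 2 = k" using p(2) by simp
  have pr5: "prime (5::nat)" and pr7: "prime (7::nat)" by simp_all
  have q5: "Legendre (int p) 5 = 1"
  proof -
    have "[1^2 = int p] (mod 5) \<or> [2^2 = int p] (mod 5)"
      using assms(4) zmod_int[of p 5] by (auto simp: cong_def)
    then have "QuadRes 5 (int p)" unfolding QuadRes_def by blast
    moreover have "\<not> [int p = 0] (mod 5)" using assms(4) by (auto simp: cong_def) presburger+
    ultimately show ?thesis by (simp add: Legendre_def)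
  qed
  have q7: "Legendre (int p) 7 = 1"
  proof -
    have "[1^2 = int p] (mod 7) \<or> [3^2 = int p] (mod 7) \<or> [2^2 = int p] (mod 7)"
      using assms(5) zmod_int[of p 7] by (auto simp: cong_def)
    then have "QuadRes 7 (int p)" unfolding QuadRes_def by blast
    moreover have "\<not> [int p = 0] (mod 7)" using assms(5) by (auto simp: cong_def) presburger+
    ultimately show ?thesis by (simp add: Legendre_def)
  qed
  have l5: "Legendre 5 (int p) = 1"
    using Quadratic_Reciprocity[OF p(1) p2 pr5 _ p5] q5 unfolding half by simp
  have l7: "Legendre 7 (int p) = -1"
    using Quadratic_Reciprocity[OF p(1) p2 pr7 _ p7] q7 kodd unfolding half by simp
  have ec: "[Legendre a (int p) = a ^ k] (mod int p)" for a
    using euler_criterion[OF p(1) p2, of a] unfolding half .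
  have "(-70) ^ k = (-1) ^ k * 2 ^ k * 5 ^ k * (7::int) ^ k" by (simp flip: power_mult_distrib)
  moreover have "[(-1) ^ k * 2 ^ k * 5 ^ k * (7::int) ^ k = (-1) ^ k * 1 * 1 * (-1)] (mod int p)"
    using ec[of 2] ec[of 5] ec[of 7] unfolding l5 l7 Legendre_2[OF p(1,3)]
    by (intro cong_mult cong_refl) (auto intro: cong_sym)
  ultimately have "[(-70) ^ k = 1] (mod int p)" using kodd by simp
  then have "[1 = -1] (mod int p)" using A by (meson cong_sym cong_trans)
  then have "int p dvd 2" by (simp add: cong_iff_dvd_diff)
  then show False using p2 by (auto dest: zdvd_imp_le)
qed

text \<open>A root of z^2 + 3 gives w = (z - 1) / 2 with w^2 + w + 1 = 0 and w^3 = 1 modulo l. If l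
  = 3 m + 2, Fermat turns w^(l - 1) = w^(3 m + 1) into w = 1, so l divides 3.\<close>

lemma prime_mod_3_of_root_minus_3:
  fixes l :: nat
  assumes "prime l" "l > 3" "int l dvd z^2 + 3"
  shows "l mod 3 = 1"
proof (rule ccontr)
  assume "l mod 3 \<noteq> 1"
  moreover have "l mod 3 \<noteq> 0"
    using assms(1,2) by (metis dvd_eq_mod_eq_0 less_irrefl_nat prime_nat_iff numeral_eq_one_iff semiring_norm(86))
  ultimately have "l mod 3 = 2" by presburger
  then obtain m where m: "l = 3 * m + 2" by (metis mult_div_mod_eq)
  have oddl: "odd l" using assms(1,2) prime_odd_nat[of l] by simp
  define z1 where "z1 = z mod int l"
  \<comment> \<open>An odd nonnegative representative, so that (z2 - 1) / 2 is a natural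
    number.\<close>
  define z2 where "z2 = (if odd z1 then z1 else z1 + int l)"
  have "odd z2" unfolding z2_def using oddl by simp
  moreover have z20: "z2 \<ge> 0" unfolding z2_def z1_def using assms(2) by simp
  ultimately obtain j where j: "z2 = 2 * j + 1" by (elim oddE)
  then have "j \<ge> 0" using z20 by linarith
  then obtain w where w: "z2 = 2 * int w + 1" using j nonneg_int_cases by metis
  have "[z2 = z] (mod int l)" unfolding z2_def z1_def by (auto simp: cong_def)
  then have "[z2^2 + 3 = z^2 + 3] (mod int l)" by (intro cong_add cong_pow cong_refl)
  then have "int l dvd z2^2 + 3" using assms(3) cong_dvd_iff by blast
  moreover have "z2^2 + 3 = 4 * int (w^2 + w + 1)" unfolding w by (simp add: power2_eq_square algebra_simps)
  moreover have "coprime (int l) 4" using oddl by (metis coprime_power_right_iff even_of_nat_iff coprime_right_2_iff_odd numeral_Bit0 power2_eq_square zero_less_numeral mult_2 numeral_Bit0_eq_double)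
  ultimately have "int l dvd int (w^2 + w + 1)" by (simp only: coprime_dvd_mult_right_iff)
  then have d: "l dvd w^2 + w + 1" by (simp only: of_nat_dvd_iff)
  have "w * (w^2 + w + 1) + 1 = w ^ 3 + (w^2 + w + 1)" by (simp add: power2_eq_square power3_eq_cube algebra_simps)
  moreover have "[w * (w^2 + w + 1) + 1 = 0 + 1] (mod l)" using d by (intro cong_add cong_refl) (simp only: cong_0_iff dvd_mult)
  moreover have "[w ^ 3 + (w^2 + w + 1) = w ^ 3 + 0] (mod l)" using d by (intro cong_add cong_refl) (simp only: cong_0_iff)
  ultimately have w3: "[w ^ 3 = 1] (mod l)" by (metis add.right_neutral add_0 cong_sym cong_trans)
  have "\<not> l dvd w"
  proof
    assume "l dvd w"
    then have "l dvd w ^ 3" by (simp add: power3_eq_cube)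
    then have "l dvd 1" using w3 cong_dvd_iff by blast
    then show False using assms(2) by simp
  qed
  then have "[w ^ (l - 1) = 1] (mod l)" by (rule fermat_theorem[OF assms(1)])
  moreover have "w ^ (l - 1) = (w ^ 3) ^ m * w" unfolding m by (simp flip: power_mult)
  moreover have "[(w ^ 3) ^ m * w = 1 ^ m * w] (mod l)" by (intro cong_mult cong_pow w3 cong_refl)
  ultimately have w1: "[w = 1] (mod l)" by (metis cong_sym cong_trans mult_1 power_one)
  then have "[w^2 + w + 1 = 1^2 + 1 + 1] (mod l)" by (intro cong_add cong_pow cong_refl)
  then have "l dvd 1^2 + 1 + 1" using d cong_dvd_iff by blast
  moreover have "1^2 + 1 + 1 = (3::nat)" by simp
  ultimately have "l dvd 3" by (simp only:)
  then show False using assms(2) by (auto dest: dvd_imp_le)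
qed

lemma mod_3_of_prime_factors:
  fixes n :: nat
  assumes "n > 0" "\<And>l. prime l \<Longrightarrow> l dvd n \<Longrightarrow> l mod 3 = 1"
  shows "n mod 3 = 1"
  using assms
proof (induction n rule: less_induct)
  case (less n)
  show ?case
  proof (cases "n = 1")
    case False
    then obtain l where l: "prime l" "l dvd n" using prime_factor_nat by blast
    then obtain c where c: "n = l * c" by (elim dvdE)
    have "c < n" "c > 0" using c l(1) less.prems(1) by (auto simp: prime_gt_Suc_0_nat)
    then have "c mod 3 = 1" using less.IH[of c] less.prems(2) c by auto
    moreover have "l mod 3 = 1" using less.prems(2) l by blast
    ultimately show ?thesis unfolding c by (subst mod_mult_eq[symmetric]) simp
  qed simp
qed

text \<open>Even \<open>k\<close> is settled two-adically, the value 1 for odd \<open>k\<close>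
  modulo 3. For -1, p is a quadratic residue modulo 5 and 7, so p = 7 modulo 8 contradicts
  \<open>not_minus_70_power\<close>. Hence k = 1 and g = 1 modulo 4, and g divides 35^k + 1. Then -3
  is a square modulo each prime factor of g, so g = 1 modulo 3, whereas g = 3 e - 4.\<close>

lemma lehmer_35_prime:
  fixes s y :: int
  assumes p: "prime p" "p = 2 * k + 1" "k > 0" and s: "odd s" and y: "3 * s^2 + 35 = 2 * y"
  shows "lehmer 35 y k \<noteq> 1" "lehmer 35 y k \<noteq> - 1"
proof -
  obtain e where e: "s^2 = 8 * e + 1" and e0: "e \<ge> 0" using odd_square_mod_8[OF s] .
  define g where "g = 3 * e - 4"
  have yg: "y = 35 + 4 * g" using y unfolding e g_def by simp
  have s8: "3 * s^2 = 8 * g + 35" unfolding e g_def by simp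
  have ev: "even k \<Longrightarrow> lehmer 35 y k \<noteq> 1 \<and> lehmer 35 y k \<noteq> - 1"
    using lehmer_35_even[of g k] p(3) e0 unfolding yg g_def by auto
  have y3: "y mod 3 = 1" unfolding yg g_def by presburger
  have m3: "odd k \<Longrightarrow> [lehmer 35 y k = -1] (mod 3)"
    using lehmer_35_mod_3[OF y3, of k] by simp
  have n1: "lehmer 35 y k \<noteq> 1"
    using ev m3 by (cases "even k") (auto simp: cong_def)
  have nm1: "lehmer 35 y k \<noteq> - 1"
  proof
    assume L: "lehmer 35 y k = - 1"
    then have kodd: "odd k" using ev by blast
    then obtain i where ki: "k = 2 * i + 1" by (elim oddE)
    have pk: "int p = 2 * int k + 1" using p(2) by simp
    have p5: "p mod 5 = 1 \<or> p mod 5 = 4"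
    proof -
      have "[lehmer 35 y k = (2 * int k + 1) * y ^ k] (mod 5)" by (rule lehmer_cong_double_root) (simp add: cong_def)
      then have A: "(int p * y ^ k) mod 5 = 4" unfolding L pk[symmetric] by (simp add: cong_def)
      have "[3 * s^2 + 35 = 3 * ((s mod 5) * (s mod 5) mod 5) + 35] (mod 5)"
        by (intro cong_add cong_mult cong_refl) (simp add: cong_def power2_eq_square mod_mult_eq)
      then have "(2 * y) mod 5 = (3 * ((s mod 5) * (s mod 5) mod 5) + 35) mod 5"
        unfolding y cong_def .
      moreover have "s mod 5 = 0 \<or> s mod 5 = 1 \<or> s mod 5 = 2 \<or> s mod 5 = 3 \<or> s mod 5 = 4" by presburger
      moreover have "(2 * y) mod 5 = (2 * (y mod 5)) mod 5" by (simp only: mod_mult_right_eq)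
      ultimately have "y mod 5 = 0 \<or> y mod 5 = 1 \<or> y mod 5 = 4"
        using mod_5_cases[of y] by (elim disjE) simp_all
      moreover have "y mod 5 \<noteq> 0"
      proof
        assume "y mod 5 = 0"
        then have "5 dvd y" by presburger
        moreover have "y dvd y ^ k" using p(3) by (intro dvd_power) simp
        ultimately have "5 dvd int p * y ^ k" using dvd_trans dvd_mult by blast
        then show False using A by presburger
      qed
      ultimately have "y ^ k mod 5 \<in> {1, 4}" unfolding ki by (intro odd_power_mod_in) auto
      moreover have "(int p mod 5) * (y ^ k mod 5) mod 5 = 4" using A by (simp add: mod_mult_eq)
      ultimately have "int p mod 5 = 1 \<or> int p mod 5 = 4" using mod_5_cases[of "int p"] by auto
      then have "int (p mod 5) = int 1 \<or> int (p mod 5) = int 4" by (simp add: zmod_int)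
      then show ?thesis by (simp only: of_nat_eq_iff)
    qed
    have p7: "p mod 7 = 1 \<or> p mod 7 = 2 \<or> p mod 7 = 4"
    proof -
      have "[lehmer 35 y k = (2 * int k + 1) * y ^ k] (mod 7)" by (rule lehmer_cong_double_root) (simp add: cong_def)
      then have A: "(int p * y ^ k) mod 7 = 6" unfolding L pk[symmetric] by (simp add: cong_def)
      have "[3 * s^2 + 35 = 3 * ((s mod 7) * (s mod 7) mod 7) + 35] (mod 7)"
        by (intro cong_add cong_mult cong_refl) (simp add: cong_def power2_eq_square mod_mult_eq)
      then have "(2 * y) mod 7 = (3 * ((s mod 7) * (s mod 7) mod 7) + 35) mod 7"
        unfolding y cong_def .
      moreover have "s mod 7 = 0 \<or> s mod 7 = 1 \<or> s mod 7 = 2 \<or> s mod 7 = 3 \<or> s mod 7 = 4 \<or> s mod 7 = 5 \<or> s mod 7 = 6" by (rule mod_7_cases)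
      moreover have "(2 * y) mod 7 = (2 * (y mod 7)) mod 7" by (simp only: mod_mult_right_eq)
      ultimately have "y mod 7 = 0 \<or> y mod 7 = 3 \<or> y mod 7 = 5 \<or> y mod 7 = 6"
        using mod_7_cases[of y] by (elim disjE) simp_all
      moreover have "y mod 7 \<noteq> 0"
      proof
        assume "y mod 7 = 0"
        then have "7 dvd y" by presburger
        moreover have "y dvd y ^ k" using p(3) by (intro dvd_power) simp
        ultimately have "7 dvd int p * y ^ k" using dvd_trans dvd_mult by blast
        then show False using A by presburger
      qed
      ultimately have "y ^ k mod 7 \<in> {3, 5, 6}" unfolding ki by (intro odd_power_mod_in) auto
      moreover have "(int p mod 7) * (y ^ k mod 7) mod 7 = 6" using A by (simp add: mod_mult_eq)
      moreover have "int p mod 7 = 0 \<or> int p mod 7 = 1 \<or> int p mod 7 = 2 \<or> int p mod 7 = 3 \<or> int p mod 7 = 4 \<or> int p mod 7 = 5 \<or> int p mod 7 = 6" by (rule mod_7_cases)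
      ultimately have "int p mod 7 = 1 \<or> int p mod 7 = 2 \<or> int p mod 7 = 4" by auto
      then have "int (p mod 7) = int 1 \<or> int (p mod 7) = int 2 \<or> int (p mod 7) = int 4" by (simp add: zmod_int)
      then show ?thesis by (simp only: of_nat_eq_iff)
    qed
    have "p mod 8 \<noteq> 7"
    proof
      assume p8: "p mod 8 = 7"
      have "int p dvd 2 ^ k * (- 1) - (-35) ^ k"
        using lehmer_35_prime_cong[OF p(1,2) y] unfolding L .
      then have "[2 ^ k * (- 1) = (-35) ^ k] (mod int p)" by (simp add: cong_iff_dvd_diff)
      \<comment> \<open>Multiplying by 2^k turns the left side into -(2^(p - 1)) = -1 and -35 into
        -70.\<close>
      then have "[2 ^ k * (2 ^ k * (- 1)) = 2 ^ k * (-35) ^ k] (mod int p)" by (intro cong_mult cong_refl)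
      moreover have "2 ^ k * (-35) ^ k = (-70 :: int) ^ k" by (simp flip: power_mult_distrib)
      moreover have "[2 ^ k * (2 ^ k * (- 1)) = - 1] (mod int p)"
      proof -
        have "p \<ge> 7" using p8 mod_less_eq_dividend[of p 8] by simp
        then have "\<not> p dvd 2" by (auto dest: dvd_imp_le)
        then have "[2 ^ (p - 1) = 1] (mod p)" by (rule fermat_theorem[OF p(1)])
        then have "[int (2 ^ (p - 1)) = int 1] (mod int p)" by (simp only: cong_int_iff)
        moreover have "int (2 ^ (p - 1)) = 2 ^ k * 2 ^ k" using p(2) by (simp add: mult_2 power_add)
        ultimately have "[2 ^ k * 2 ^ k = 1] (mod int p)" by simp
        then have "[- (2 ^ k * 2 ^ k) = - 1] (mod int p)" by (simp only: cong_minus_minus_iff)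
        then show ?thesis by simp
      qed
      ultimately have "[(-70) ^ k = -1] (mod int p)" by (metis cong_sym cong_trans)
      then show False using not_minus_70_power[OF p(1,2) p8 p5 p7] by blast
    qed
    then have "k mod 4 = 1" using kodd p(2) by presburger
    then have i: "k = 4 * (k div 4) + 1" by presburger
    define i' where "i' = k div 4"
    have ki': "k = 4 * i' + 1" using i unfolding i'_def .
    have "[lehmer 35 y k = 35 + 12 * g] (mod 16)" unfolding yg ki' by (rule lehmer_35_mod_16)
    then have "[- 1 = 35 + 12 * g] (mod 16)" by (simp only: L)
    then obtain q where "- 1 - (35 + 12 * g) = 16 * q" unfolding cong_iff_dvd_diff by (elim dvdE)
    then have "g - 1 = 4 * (g + q + 2)" by simp
    then have "4 dvd g - 1" by (metis dvd_triv_left)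
    then have g4: "g mod 4 = 1" by presburger
    have g0: "g > 0"
    proof -
      have "e = 0 \<or> e = 1 \<or> e \<ge> 2" using e0 by linarith
      then show ?thesis using g4 unfolding g_def by auto
    qed
    have dvd1: "g dvd 35 ^ k + 1"
    proof -
      have "[lehmer 35 y k = 35 ^ k] (mod g)" unfolding yg ki' by (rule lehmer_35_mod_gap)
      then have "[- 1 = 35 ^ k] (mod g)" by (simp only: L)
      then have "[35 ^ k = - 1] (mod g)" by (rule cong_sym)
      then show ?thesis by (simp only: cong_iff_dvd_diff diff_minus_eq_add)
    qed
    have "nat g mod 3 = 1"
    proof (rule mod_3_of_prime_factors)
      show "nat g > 0" using g0 by simp
      fix l :: nat assume l: "prime l" "l dvd nat g"
      then have lg: "int l dvd g" using g0 by (metis int_dvd_int_iff int_nat_eq less_imp_le)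
      have oddg: "odd g" using g4 by presburger
      have l2: "l \<noteq> 2" using lg oddg by auto
      have l3: "l \<noteq> 3"
      proof
        assume "l = 3"
        then have "3 dvd g" using lg by simp
        then show False unfolding g_def by presburger
      qed
      have l4: "l > 3" using prime_gt_1_nat[OF l(1)] l2 l3 by linarith
      have l35: "int l dvd 35 ^ k + 1" using lg dvd1 dvd_trans by blast
      have cop: "coprime 35 (int l)"
      proof (rule coprimeI)
        fix d :: int assume d: "d dvd 35" "d dvd int l"
        then have "d dvd 35 ^ k" using p(3) by (meson dvd_power dvd_trans)
        moreover have "d dvd 35 ^ k + 1" using d(2) l35 dvd_trans by blast
        ultimately show "is_unit d" by (simp add: dvd_add_right_iff)
      qed
      then obtain h where h: "[35 * h = 1] (mod int l)" using cong_solve_coprime_int by blast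
      \<comment> \<open>A square root of -3 modulo l: the square of 35^(2 i' + 1) is 35^k * 35 =
        -35, and 9 s^2 = 24 g + 105 = 105, so z^2 = -3 (35 h)^2, where \<open>h\<close> inverts
        35.\<close>
      define z where "z = 3 * s * 35 ^ (2 * i' + 1) * h"
      have "z^2 = (9 * s^2) * (35 ^ k * 35) * h^2"
      proof -
        have "(35 ^ (2 * i' + 1))^2 = (35 ^ k * 35 :: int)"
          unfolding ki' power_mult[symmetric] by (subst power_Suc2[symmetric]) (rule arg_cong[where f = "\<lambda>n. 35 ^ n"], simp)
        then show ?thesis unfolding z_def by (simp add: power_mult_distrib)
      qed
      also have "9 * s^2 = 24 * g + 105" using s8 by simp
      also have "[(24 * g + 105) * (35 ^ k * 35) * h^2 = (24 * 0 + 105) * ((-1) * 35) * h^2] (mod int l)"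
      proof (intro cong_mult cong_add cong_refl)
        show "[g = 0] (mod int l)" using lg by (simp add: cong_0_iff)
        show "[35 ^ k = - 1] (mod int l)" using l35 by (simp add: cong_iff_dvd_diff)
      qed
      also have "(24 * 0 + 105) * ((-1) * 35) * h^2 = -3 * (35 * h)^2" by (simp add: power2_eq_square)
      also have "[-3 * (35 * h)^2 = -3 * 1^2] (mod int l)" by (intro cong_mult cong_pow cong_refl h)
      finally have "int l dvd z^2 + 3" by (simp add: cong_iff_dvd_diff)
      then show "l mod 3 = 1" using prime_mod_3_of_root_minus_3[OF l(1) l4] by blast
    qed
    moreover have "int (nat g mod 3) = g mod 3" using g0 by (simp add: zmod_int)
    ultimately have "g mod 3 = 1" by simp
    then show False unfolding g_def by presburger
  qed
  show "lehmer 35 y k \<noteq> 1" "lehmer 35 y k \<noteq> - 1" using n1 nm1 by auto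
qed

subsection \<open>Descent for odd exponents\<close>

text \<open>Iterated multiplication of \<open>S \<surd>A + T \<surd>(-B)\<close> by \<open>e + f \<surd>(-A B)\<close>.\<close>

primrec descent_power :: "int \<Rightarrow> int \<Rightarrow> int \<Rightarrow> int \<Rightarrow> int \<times> int \<Rightarrow> nat \<Rightarrow> int \<times> int" where
  "descent_power A B e f z 0 = z"
| "descent_power A B e f z (Suc k) = (e * fst (descent_power A B e f z k) - B * f * snd (descent_power A B e f z k),
      e * snd (descent_power A B e f z k) + A * f * fst (descent_power A B e f z k))"

lemma descent_power_norm:
  "A * (fst (descent_power A B e f z k))^2 + B * (snd (descent_power A B e f z k))^2
    = (e^2 + A * B * f^2) ^ k * (A * (fst z)^2 + B * (snd z)^2)"
proof (induction k)
  case (Suc k)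
  have "A * (e * S - B * f * T)^2 + B * (e * T + A * f * S)^2 = (e^2 + A * B * f^2) * (A * S^2 + B * T^2)" for S T
    by (simp add: power2_eq_square algebra_simps)
  then show ?case using Suc by simp
qed simp

text \<open>If \<open>\<alpha> = (s \<surd>A + t \<surd>(-B)) / \<surd>C\<close>, then \<open>\<alpha>\<^sup>2 = e + f \<surd>(-A B)\<close> and
  \<open>\<alpha>\<^sup>n = (S k \<surd>A + T k \<surd>(-B)) / \<surd>C\<close>. The congruence \<open>s = u t\<close> modulo \<open>y\<close> replaces the factorisation
  into ideals: it forces \<open>\<alpha>\<^sup>n\<close> to agree with \<open>(u \<surd>A + \<surd>(-B)) / \<surd>C\<close> up to a unit.\<close>

locale quadratic_descent =
  fixes A B C \<kappa> u y s t :: int and n k :: nat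
  assumes pos: "A > 0" "B > 0" "y > 0" "C * \<kappa> = 2" and cop: "coprime y C"
    and n: "n = 2 * k + 1" "k > 0"
    and eq: "A * u^2 + B = C * y ^ n"
    and st: "A * s^2 + B * t^2 = C * y" and dvd: "y dvd s - u * t"
begin

text \<open>The rational part of \<alpha>^2 is (A s^2 - B t^2) / C; eliminating A s^2 by the
  representation of C y removes the division.\<close>

definition "e = y - \<kappa> * B * t^2"
definition "f = \<kappa> * s * t"
definition "S j = fst (descent_power A B e f (s, t) j)"
definition "T j = snd (descent_power A B e f (s, t) j)"

lemma S_T_rec: "S 0 = s" "T 0 = t" "S (Suc j) = e * S j - B * f * T j" "T (Suc j) = e * T j + A * f * S j"
  by (simp_all add: S_def T_def)

lemma norm_e_f: "e^2 + A * B * f^2 = y^2"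
proof -
  have "e^2 + A * B * f^2 = y^2 - 2 * y * \<kappa> * B * t^2 + \<kappa>^2 * B * t^2 * (A * s^2 + B * t^2)"
    unfolding e_def f_def by (simp add: power2_eq_square algebra_simps)
  also have "\<dots> = y^2 - 2 * y * \<kappa> * B * t^2 + (C * \<kappa>) * y * \<kappa> * B * t^2"
    unfolding st by (simp add: power2_eq_square algebra_simps)
  finally show ?thesis unfolding pos(4) by simp
qed

lemma norm_S_T: "A * (S k)^2 + B * (T k)^2 = C * y ^ n"
proof -
  have "A * (S k)^2 + B * (T k)^2 = (y^2) ^ k * (C * y)"
    using descent_power_norm[of A B e f "(s, t)" k] unfolding S_def T_def norm_e_f by (simp add: st)
  moreover have "y ^ n = (y^2) ^ k * y" unfolding n(1) by (simp only: power_add power_mult power_one_right)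
  ultimately show ?thesis by simp
qed

text \<open>C times this difference is A (s - u t)^2 - t^2 (A u^2 + B), so squaring the congruence s
  = u t modulo y gives one modulo y^2, from which C is cancelled.\<close>

lemma y2_dvd: "y^2 dvd e - A * u * f"
proof -
  have "C * (e - A * u * f) = C * y - (C * \<kappa>) * B * t^2 - (C * \<kappa>) * A * u * s * t"
    unfolding e_def f_def by (simp add: algebra_simps)
  also have "\<dots> = A * (s - u * t)^2 - t^2 * (A * u^2 + B)"
    unfolding pos(4) st[symmetric] by (simp add: power2_eq_square algebra_simps)
  finally have "C * (e - A * u * f) = A * (s - u * t)^2 - t^2 * (C * y ^ n)" unfolding eq .
  moreover have "y^2 dvd (s - u * t)^2" using dvd by (rule dvd_power_same)
  moreover have "y^2 dvd y ^ n" using n by (intro le_imp_power_dvd) auto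
  ultimately have "y^2 dvd C * (e - A * u * f)" by simp
  moreover have "coprime (y^2) C" using cop by simp
  ultimately show ?thesis by (simp add: coprime_dvd_mult_right_iff)
qed

text \<open>Each multiplication by e + f sqrt (-A B) gains a factor y^2, because e = A u f modulo
  y^2.\<close>

lemma y_pow_dvd: "j \<le> k \<Longrightarrow> y ^ (2 * j + 1) dvd S j - u * T j"
proof (induction j)
  case 0
  then show ?case using dvd by (simp add: S_T_rec)
next
  case (Suc j)
  have "S (Suc j) - u * T (Suc j) = (e - A * u * f) * (S j - u * T j) - f * T j * (A * u^2 + B)"
    unfolding S_T_rec by (simp add: power2_eq_square algebra_simps)
  moreover have "y^2 * y ^ (2 * j + 1) dvd (e - A * u * f) * (S j - u * T j)"
    using y2_dvd Suc by (intro mult_dvd_mono) auto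
  moreover have "y^2 * y ^ (2 * j + 1) = y ^ (2 * Suc j + 1)" by (simp add: power2_eq_square)
  moreover have "y ^ (2 * Suc j + 1) dvd A * u^2 + B"
    unfolding eq using Suc.prems n by (intro dvd_mult le_imp_power_dvd) auto
  ultimately show ?case by (metis dvd_diff dvd_mult)
qed

text \<open>Multiplicativity of the norm. Up to sign, w / C is the coefficient of sqrt (-A B) in the
  quotient of \<alpha>^n by (u sqrt A + sqrt (-B)) / sqrt C, and it can be nonzero only if A B <=
  C^2.\<close>

lemma quotient_bound:
  obtains w where "S k - u * T k = y ^ n * w" "A * B * w^2 \<le> C^2"
    "(u * A * S k + B * T k)^2 + A * B * w^2 * (y ^ n)^2 = C^2 * (y ^ n)^2"
proof -
  have "y ^ n dvd S k - u * T k" using y_pow_dvd[of k] n by simp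
  then obtain w where w: "S k - u * T k = y ^ n * w" by (elim dvdE)
  have "(u * A * S k + B * T k)^2 + A * B * (S k - u * T k)^2 = (A * u^2 + B) * (A * (S k)^2 + B * (T k)^2)"
    by (simp add: power2_eq_square algebra_simps)
  also have "\<dots> = C^2 * (y ^ n)^2" unfolding norm_S_T eq by (simp add: power2_eq_square)
  finally have id: "(u * A * S k + B * T k)^2 + A * B * w^2 * (y ^ n)^2 = C^2 * (y ^ n)^2"
    unfolding w power_mult_distrib by (simp only: mult_ac)
  then have "A * B * w^2 * (y ^ n)^2 \<le> C^2 * (y ^ n)^2"
    using zero_le_power2[of "u * A * S k + B * T k"] by linarith
  moreover have "(y ^ n)^2 > 0" using pos by simp
  ultimately have "A * B * w^2 \<le> C^2" by (rule mult_right_le_imp_le)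
  then show thesis using that[OF w _ id] by blast
qed

text \<open>The sequence obeys the recurrence with trace 2 e and norm e^2 + A B f^2 = y^2, which is
  the Lehmer recurrence for h = \<kappa> B t^2.\<close>

lemma T_lehmer: "T j = t * lehmer (\<kappa> * B * t^2) y j"
proof -
  have "T j = t * lehmer (\<kappa> * B * t^2) y j \<and> T (Suc j) = t * lehmer (\<kappa> * B * t^2) y (Suc j)"
  proof (induction j)
    case 0
    have "T (Suc 0) = t * (y - \<kappa> * B * t^2 + \<kappa> * (A * s^2))"
      unfolding S_T_rec e_def f_def by (simp add: power2_eq_square algebra_simps)
    also have "A * s^2 = C * y - B * t^2" using st by simp
    also have "\<kappa> * (C * y - B * t^2) = (C * \<kappa>) * y - \<kappa> * B * t^2" by (simp add: algebra_simps)
    finally show ?case unfolding pos(4) by (simp add: S_T_rec)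
  next
    case (Suc j)
    have "T (Suc (Suc j)) = 2 * e * T (Suc j) - (e^2 + A * B * f^2) * T j"
      unfolding S_T_rec by (simp add: power2_eq_square algebra_simps)
    then show ?case using Suc unfolding norm_e_f by (simp add: e_def algebra_simps)
  qed
  then show ?thesis by blast
qed

lemma lehmer_pm1_of_T:
  assumes "(T k)^2 = 1"
  shows "t^2 = 1" "lehmer (\<kappa> * B) y k = 1 \<or> lehmer (\<kappa> * B) y k = - 1"
proof -
  have "t dvd T k" unfolding T_lehmer by simp
  then have "t dvd 1" using assms by (metis dvd_mult2 power2_eq_square)
  then have "\<bar>t\<bar> = 1" by simp
  then show t: "t^2 = 1" by (metis power2_abs one_power2)
  have "(lehmer (\<kappa> * B) y k)^2 = 1" using assms unfolding T_lehmer power_mult_distrib t by simp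
  then show "lehmer (\<kappa> * B) y k = 1 \<or> lehmer (\<kappa> * B) y k = - 1" by (simp add: power2_eq_1_iff)
qed

lemma T_unit:
  assumes "S k = u * T k"
  shows "(T k)^2 = 1"
proof -
  have "(T k)^2 * (A * u^2 + B) = 1 * (A * u^2 + B)"
    using norm_S_T unfolding assms eq[symmetric] by (simp add: power_mult_distrib algebra_simps)
  moreover have "A * u^2 + B > 0" using pos by (simp add: add_nonneg_pos)
  ultimately show ?thesis by (metis mult_right_cancel less_irrefl)
qed

lemma lehmer_pm1:
  assumes "C^2 < A * B"
  shows "t^2 = 1" "lehmer (\<kappa> * B) y k = 1 \<or> lehmer (\<kappa> * B) y k = - 1"
proof -
  obtain w where w: "S k - u * T k = y ^ n * w" "A * B * w^2 \<le> C^2" by (rule quotient_bound)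
  have "w = 0"
  proof (rule ccontr)
    assume "w \<noteq> 0"
    then have "w^2 \<ge> 1" by (simp add: int_one_le_iff_zero_less)
    then have "A * B * 1 \<le> A * B * w^2" using pos by (intro mult_left_mono) auto
    then show False using w(2) assms by simp
  qed
  then have "S k = u * T k" using w(1) by simp
  then have "(T k)^2 = 1" by (rule T_unit)
  then show "t^2 = 1" "lehmer (\<kappa> * B) y k = 1 \<or> lehmer (\<kappa> * B) y k = - 1" by (rule lehmer_pm1_of_T)+
qed

end

section \<open>The three equations with odd exponent\<close>

lemma descent_power_swap:
  "fst (descent_power 1 1 e f (s, t) k) = (-1) ^ k * snd (descent_power 1 1 (- e) f (t, s) k)
    \<and> snd (descent_power 1 1 e f (s, t) k) = (-1) ^ k * fst (descent_power 1 1 (- e) f (t, s) k)"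
  by (induction k) (auto simp: algebra_simps)

text \<open>Here A = B = 1 and C = 2, so the additional units of the Gaussian integers appear: w is
  0, 2 or -2. If w is not 0, then \<open>S k\<close> is a sign instead of \<open>T k\<close>, and
  exchanging s and t, with -u for u, leads back to the first case; \<open>descent_power_swap\<close>
  compares the two sequences.\<close>

lemma odd_power_sum_squares:
  fixes u y :: int
  assumes eq: "u^2 + 1 = 2 * y ^ n" and n: "n = 2 * k + 1" "k > 0"
  shows "y = 1"
proof -
  have y0: "y > 0"
    by (rule pos_of_odd_power[of y n]) (use eq zero_le_power2[of u] in linarith, use n(1) in simp)
  have oddu: "odd u" using odd_of_square_plus_1[OF eq] .
  have odd_yn: "odd (y ^ n)"
  proof -
    obtain e where "u^2 = 8 * e + 1" using odd_square_mod_8[OF oddu] .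
    then have "y ^ n = 2 * (2 * e) + 1" using eq by simp
    then show ?thesis by simp
  qed
  then have oddy: "odd y" by (metis even_power n(1) add_gr_0 zero_less_one)
  have "y dvd u^2 + 1" unfolding eq n(1) by simp
  then obtain a b where ab: "a^2 + b^2 = y" "y dvd a - u * b"
    using sum_two_squares_of_root[of y u] y0 oddy by blast
  \<comment> \<open>s + t \<i> = (1 + \<i>) (a + b \<i>), which supplies the factor 2 in 2
    y.\<close>
  define s t where "s = a - b" and "t = a + b"
  have st: "1 * s^2 + 1 * t^2 = 2 * y" unfolding s_def t_def ab(1)[symmetric] by (simp add: power2_eq_square algebra_simps)
  have dvd: "y dvd s - u * t"
  proof -
    have "s - u * t = (1 - u) * (a - u * b) - b * (u^2 + 1)"
      unfolding s_def t_def by (simp add: power2_eq_square algebra_simps)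
    then show ?thesis using ab(2) \<open>y dvd u^2 + 1\<close> by simp
  qed
  interpret D: quadratic_descent 1 1 2 1 u y s t n k
    by unfold_locales (use y0 oddy eq n st dvd in simp_all)
  have "odd (a^2 + b^2)" using ab(1) oddy by simp
  then have odds: "odd s" "odd t" unfolding s_def t_def by auto
  have final: "y = 1" if "r^2 = 1" "odd q" "q^2 + r^2 = 2 * y" "lehmer 1 y k = 1 \<or> lehmer 1 y k = - 1" for q r
  proof -
    obtain e where e: "q^2 = 8 * e + 1" "e \<ge> 0" using odd_square_mod_8[OF \<open>odd q\<close>] .
    then have y: "y = 1 + 4 * e" using that by simp
    show ?thesis
    proof (rule ccontr)
      assume "y \<noteq> 1"
      then have "e > 0" using y e(2) by simp
      then show False using lehmer_1_ne_pm1[of e k] n(2) that(4) unfolding y by blast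
    qed
  qed
  obtain w where w: "D.S k - u * D.T k = y ^ n * w" "1 * 1 * w^2 \<le> 2^2"
    "(u * 1 * D.S k + 1 * D.T k)^2 + 1 * 1 * w^2 * (y ^ n)^2 = 2^2 * (y ^ n)^2"
    by (rule D.quotient_bound)
  have "even ((D.S k)^2 + (D.T k)^2)" using D.norm_S_T by simp
  then have "even (D.S k - u * D.T k)" using oddu by simp
  then have "even w" using odd_yn unfolding w(1) even_mult_iff by blast
  then obtain v where v: "w = 2 * v" by (elim evenE)
  then have "v^2 \<le> 1" using w(2) by (simp add: power_mult_distrib)
  then have "v = 0 \<or> v^2 = 1"
    by (metis int_one_le_iff_zero_less order_antisym zero_less_power2)
  then show ?thesis
  proof
    assume "v = 0"
    then have "(D.T k)^2 = 1" using w(1) v by (intro D.T_unit) simp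
    from D.lehmer_pm1_of_T[OF this] show ?thesis using final[of t s] odds st by simp
  next
    assume "v^2 = 1"
    then have "(u * D.S k + D.T k)^2 = 0" using w(3) unfolding v by (simp add: power_mult_distrib)
    then have TS: "D.T k = - (u * D.S k)" by (simp add: add_eq_0_iff)
    have "(D.S k)^2 * (u^2 + 1) = 1 * (u^2 + 1)"
      using D.norm_S_T unfolding TS eq[symmetric] by (simp add: power_mult_distrib algebra_simps)
    moreover have "u^2 + 1 > 0" by (simp add: add_nonneg_pos)
    ultimately have S1: "(D.S k)^2 = 1" by (metis mult_right_cancel less_irrefl)
    have dvd': "y dvd t - (- u) * s"
    proof -
      have "t - (- u) * s = u * (s - u * t) + t * (u^2 + 1)" by (simp add: power2_eq_square algebra_simps)
      then show ?thesis using dvd \<open>y dvd u^2 + 1\<close> by simp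
    qed
    interpret D': quadratic_descent 1 1 2 1 "- u" y t s n k
      by unfold_locales (use y0 oddy eq n st dvd' in \<open>simp_all add: add.commute\<close>)
    have "D'.e = - D.e" "D'.f = D.f"
      unfolding D.e_def D'.e_def D.f_def D'.f_def using st by simp_all
    then have "D.S k = (-1) ^ k * D'.T k"
      unfolding D.S_def D'.T_def using descent_power_swap[of D.e D.f s t k] by simp
    then have "(D'.T k)^2 = 1" using S1 by (cases "even k") simp_all
    from D'.lehmer_pm1_of_T[OF this] show ?thesis using final[of s t] odds st by (simp add: add.commute)
  qed
qed

lemma odd_exponent_mod:
  fixes y m :: int
  assumes "[y^2 = 1] (mod m)" "n = 2 * k + 1"
  shows "[y ^ n = y] (mod m)"
proof -
  have "[(y^2) ^ k * y = 1 ^ k * y] (mod m)" by (intro cong_mult cong_pow assms cong_refl)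
  moreover have "y ^ n = (y^2) ^ k * y" unfolding assms(2) by (simp add: power_mult)
  ultimately show ?thesis by simp
qed

text \<open>The equation forces y = 5 modulo 8 and y = 2 modulo 3. The pigeonhole principle gives 3
  s^2 + 2 t^2 = m y with m <= 5; m = 2 and m = 5 fail modulo 3, m = 3 fails modulo 4, and for m = 4
  both s and t can be halved.\<close>

lemma no_power_three_squares_plus_2:
  fixes u y :: int
  assumes eq: "3 * u^2 + 2 = y ^ n" and n: "n = 2 * k + 1" "k > 0"
  shows False
proof -
  have y0: "y > 0"
    by (rule pos_of_odd_power[of y n]) (use eq zero_le_power2[of u] in linarith, use n(1) in simp)
  have oddy: "odd y"
  proof
    assume "even y"
    then have "2^2 dvd y^2" by (rule dvd_power_same)
    moreover have "y^2 dvd y ^ n" using n by (intro le_imp_power_dvd) auto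
    ultimately have "4 dvd 3 * u^2 + 2" unfolding eq using dvd_trans by fastforce
    then show False using square_mod_4[of u] by presburger
  qed
  obtain ey where ey: "y^2 = 8 * ey + 1" using odd_square_mod_8[OF oddy] .
  have "odd (3 * u^2 + 2)" unfolding eq using oddy by simp
  then have "odd u" by simp
  then obtain eu where eu: "u^2 = 8 * eu + 1" using odd_square_mod_8 by blast
  have "[y ^ n = y] (mod 8)" by (rule odd_exponent_mod[OF _ n(1)]) (simp add: ey cong_def)
  then have "[y = 3 * u^2 + 2] (mod 8)" unfolding eq by (rule cong_sym)
  also have "3 * u^2 + 2 = 5 + 8 * (3 * eu)" unfolding eu by simp
  also have "[5 + 8 * (3 * eu) = 5] (mod 8)" by (simp only: cong_def mod_mult_self2)
  finally have y8: "y mod 8 = 5" by (simp add: cong_def)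
  have y3: "y mod 3 = 2"
  proof -
    have "[3 * u^2 + 2 = 2] (mod 3)" by (simp add: cong_def)
    then have yn: "[y ^ n = 2] (mod 3)" unfolding eq .
    have "y mod 3 = 0 \<or> y mod 3 = 1 \<or> y mod 3 = 2" by presburger
    then show ?thesis
    proof (elim disjE)
      assume "y mod 3 = 0"
      then have "[y ^ n = 0 ^ n] (mod 3)" by (intro cong_pow) (simp add: cong_def)
      then show ?thesis using yn n(1) by (simp add: cong_def)
    next
      assume "y mod 3 = 1"
      then have "[y ^ n = 1 ^ n] (mod 3)" by (intro cong_pow) (simp add: cong_def)
      then show ?thesis using yn by (simp add: cong_def)
    qed
  qed
  have yu: "y dvd 3 * u^2 + 2" unfolding eq n(1) by simp
  have "\<exists>s t. 3 * s^2 + 2 * t^2 = 1 * y \<and> y dvd s - u * t"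
  proof -
    obtain R where R: "(int R)^2 \<le> y" "y < (int R + 1)^2" using int_sqrt_ex[of y] y0 by auto
    then obtain s t where st: "s \<noteq> 0 \<or> t \<noteq> 0" "\<bar>s\<bar> \<le> int R" "\<bar>t\<bar> \<le> int R" "y dvd s - u * t"
      using thue_lemma[of y R R u] y0 by (auto simp: power2_eq_square)
    have "3 * s^2 + 2 * t^2 = 3 * (s + u * t) * (s - u * t) + (3 * u^2 + 2) * t^2"
      by (simp add: power2_eq_square algebra_simps)
    then have "y dvd 3 * s^2 + 2 * t^2" using st(4) yu by simp
    then obtain m where m: "3 * s^2 + 2 * t^2 = y * m" by (elim dvdE)
    have "s^2 \<le> (int R)^2" "t^2 \<le> (int R)^2"
      using st(2,3) abs_le_square_iff[of s "int R"] abs_le_square_iff[of t "int R"] by simp_all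
    then have "y * m \<le> y * 5" using R m by linarith
    then have m5: "m \<le> 5" using y0 by simp
    have "3 * s^2 + 2 * t^2 > 0"
      using st(1) zero_less_power2[of s] zero_less_power2[of t] zero_le_power2[of s] zero_le_power2[of t] by linarith
    then have m0: "m > 0" using m y0 by (simp add: zero_less_mult_iff)
    have "(3 * s^2 + 2 * t^2) mod 3 = (2 * (t^2 mod 3)) mod 3" by (simp add: mod_mult_right_eq)
    then have E: "(2 * (t^2 mod 3)) mod 3 = (2 * (m mod 3)) mod 3"
      unfolding m using y3 mod_mult_eq[of y 3 m] by simp
    have "m = 1 \<or> m = 2 \<or> m = 3 \<or> m = 4 \<or> m = 5" using m0 m5 by linarith
    then have "m = 1 \<or> m = 3 \<or> m = 4" using E square_mod_3[of t] by auto
    then show ?thesis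
    proof (elim disjE)
      assume "m = 1"
      then show ?thesis using m st(4) by auto
    next
      assume m3: "m = 3"
      have "odd (3 * s^2 + 2 * t^2)" unfolding m m3 using oddy by simp
      then have "odd s" by simp
      then obtain a where a: "s^2 = 8 * a + 1" using odd_square_mod_8 by blast
      obtain q where q: "y = 8 * q + 5" using y8 by (metis mult_div_mod_eq)
      have "t^2 = 4 * (3 * (q - a) + 1) + 2" using m unfolding m3 a q by simp
      then have "t^2 mod 4 = 2" by presburger
      then show ?thesis using square_mod_4[of t] by simp
    next
      assume m4: "m = 4"
      have "3 * s^2 = 2 * (2 * y - t^2)" using m unfolding m4 by simp
      then have "even (3 * s^2)" by (metis dvd_triv_left)
      then have "even s" by simp
      then obtain a where a: "s = 2 * a" by (elim evenE)
      have "t^2 = 2 * (y - 3 * a^2)" using m unfolding m4 a by (simp add: power_mult_distrib)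
      then have "even (t^2)" by (metis dvd_triv_left)
      then have "even t" by simp
      then obtain b where b: "t = 2 * b" by (elim evenE)
      have "3 * a^2 + 2 * b^2 = 1 * y" using m unfolding m4 a b by (simp add: power_mult_distrib)
      moreover have "y dvd 2 * (a - u * b)" using st(4) unfolding a b by (simp add: algebra_simps)
      then have "y dvd a - u * b" using oddy coprime_dvd_mult_right_iff[of y 2 "a - u * b"] by simp
      ultimately show ?thesis by blast
    qed
  qed
  then obtain s t where st: "3 * s^2 + 2 * t^2 = 1 * y" "y dvd s - u * t" by blast
  interpret D: quadratic_descent 3 2 1 2 u y s t n k
    by unfold_locales (use y0 eq n st in simp_all)
  have t1: "t^2 = 1" and L: "lehmer 4 y k = 1 \<or> lehmer 4 y k = - 1" using D.lehmer_pm1 by simp_all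
  have "odd (3 * s^2 + 2 * t^2)" using st(1) oddy by simp
  then have "odd s" by simp
  then obtain e where e: "s^2 = 8 * e + 1" "e \<ge> 0" using odd_square_mod_8 by blast
  then have "y = 5 + 24 * e" using st(1) t1 by simp
  then have "lehmer 4 y k \<noteq> 1" using lehmer_4_neq_1[of e k] e(2) n(2) by simp
  moreover have "lehmer 4 y k \<noteq> - 1" using lehmer_4_mod_3[OF y3, of k] by auto
  ultimately show False using L by blast
qed

text \<open>Otherwise q^2 divides 3 u^2 + 35, so q divides u and q^2 divides 35.\<close>

lemma prime_not_dvd_of_power:
  fixes y q :: int
  assumes "3 * u^2 + 35 = 2 * y ^ n" "n \<ge> 2" "prime q" "\<not> q dvd 3" "q dvd 35" "\<not> q^2 dvd 35"
  shows "\<not> q dvd y"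
proof
  assume "q dvd y"
  then have "q^2 dvd y^2" by (rule dvd_power_same)
  moreover have "y^2 dvd y ^ n" using assms(2) by (rule le_imp_power_dvd)
  ultimately have d: "q^2 dvd 3 * u^2 + 35" unfolding assms(1) using dvd_trans dvd_mult by blast
  have "q dvd 3 * u^2 + 35" using d by (metis dvd_mult_left power2_eq_square)
  then have "q dvd 3 * u^2" using assms(5) by (simp add: dvd_add_left_iff)
  then have "q dvd u" using assms(3,4) by (metis prime_dvd_mult_iff prime_dvd_power_int)
  then have "q^2 dvd u^2" by (rule dvd_power_same)
  then have "q^2 dvd 35" using d by (metis dvd_add_right_iff dvd_mult)
  then show False using assms(6) by blast
qed

text \<open>Residues of y modulo 3, 5 and 7 restrict the m in 3 s^2 + 35 t^2 = 2 y m: of m <= 20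
  only the squares 1, 4, 9, 16 and the number 15 survive. A square is divided out, and 15 is
  impossible modulo 5.\<close>

lemma no_power_three_squares_plus_35:
  fixes u y :: int
  assumes eq: "3 * u^2 + 35 = 2 * y ^ p" and p: "prime p" "p = 2 * k + 1"
  shows False
proof -
  have k0: "k > 0" using p prime_gt_1_nat[OF p(1)] by simp
  have y0: "y > 0"
    by (rule pos_of_odd_power[of y p]) (use eq zero_le_power2[of u] in linarith, use p(2) in simp)
  have oddu: "odd u"
  proof -
    have "even (3 * u^2 + 35)" unfolding eq by simp
    then show ?thesis by simp
  qed
  obtain e where e: "u^2 = 8 * e + 1" using odd_square_mod_8[OF oddu] .
  have yp: "y ^ p = 12 * e + 19" using eq unfolding e by simp
  then have "odd (y ^ p)" by simp
  then have oddy: "odd y" using p(2) by (metis even_power add_gr_0 zero_less_one)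
  have y3: "y mod 3 = 1"
  proof -
    have ypm: "y ^ p mod 3 = 1" unfolding yp by presburger
    have "y mod 3 = 0 \<or> y mod 3 = 1 \<or> y mod 3 = 2" by presburger
    then show ?thesis
    proof (elim disjE)
      assume "y mod 3 = 0"
      then have "y ^ p mod 3 \<in> {0}" unfolding p(2) by (intro odd_power_mod_in) auto
      then show ?thesis using ypm by simp
    next
      assume "y mod 3 = 2"
      then have "y ^ p mod 3 \<in> {2}" unfolding p(2) by (intro odd_power_mod_in) auto
      then show ?thesis using ypm by simp
    qed
  qed
  have p2: "p \<ge> 2" using p(1) by (rule prime_ge_2_nat)
  have y5: "y mod 5 = 1 \<or> y mod 5 = 4"
  proof -
    have "\<not> 5 dvd y" by (rule prime_not_dvd_of_power[OF eq p2]) simp_all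
    then have "y mod 5 \<noteq> 0" by (simp add: dvd_eq_mod_eq_0)
    moreover have "y mod 5 \<notin> {2, 3}"
    proof
      assume "y mod 5 \<in> {2, 3}"
      then have a: "y ^ p mod 5 \<in> {2, 3}" unfolding p(2) by (intro odd_power_mod_in) auto
      have "(3 * (u^2 mod 5)) mod 5 = (3 * u^2 + 5 * 7) mod 5" by (simp only: mod_mult_right_eq mod_mult_self2)
      also have "\<dots> = (2 * (y ^ p mod 5)) mod 5" using eq by (simp add: mod_mult_right_eq)
      finally show False using a square_mod_5[of u] by auto
    qed
    ultimately show ?thesis using mod_5_cases[of y] by auto
  qed
  have y7: "y mod 7 = 3 \<or> y mod 7 = 5 \<or> y mod 7 = 6"
  proof -
    have "\<not> 7 dvd y" by (rule prime_not_dvd_of_power[OF eq p2]) simp_all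
    then have "y mod 7 \<noteq> 0" by (simp add: dvd_eq_mod_eq_0)
    moreover have "y mod 7 \<notin> {1, 2, 4}"
    proof
      assume "y mod 7 \<in> {1, 2, 4}"
      then have a: "y ^ p mod 7 \<in> {1, 2, 4}" unfolding p(2) by (intro odd_power_mod_in) auto
      have "(3 * (u^2 mod 7)) mod 7 = (3 * u^2 + 7 * 5) mod 7" by (simp only: mod_mult_right_eq mod_mult_self2)
      also have "\<dots> = (2 * (y ^ p mod 7)) mod 7" using eq by (simp add: mod_mult_right_eq)
      finally show False using a square_mod_7[of u] by auto
    qed
    ultimately show ?thesis using mod_7_cases[of y] by auto
  qed
  have yu: "2 * y dvd 3 * u^2 + 35" unfolding eq p(2) by simp
  have "\<exists>s t. 3 * s^2 + 35 * t^2 = 2 * y \<and> y dvd s - u * t"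
  proof -
    \<comment> \<open>The box has sides about sqrt (7 y) and sqrt (4 y / 7), whose product is the
      modulus 2 y. This nearly balances 3 s^2 <= 21 y and 35 t^2 <= 20 y and keeps m <= 20.\<close>
    obtain R where R: "(int R)^2 \<le> 7 * y" "7 * y < (int R + 1)^2" using int_sqrt_ex[of "7 * y"] y0 by auto
    have "0 \<le> 4 * y div 7" using y0 by (simp add: pos_imp_zdiv_nonneg_iff)
    then obtain Q where Q: "(int Q)^2 \<le> 4 * y div 7" "4 * y div 7 < (int Q + 1)^2" by (rule int_sqrt_ex)
    have Q': "7 * (int Q)^2 \<le> 4 * y" "4 * y < 7 * (int Q + 1)^2" using Q by linarith+
    have "(7 * y) * (4 * y) < (int R + 1)^2 * (7 * (int Q + 1)^2)"
      by (rule mult_strict_mono[OF R(2) Q'(2)]) (use y0 in simp_all)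
    then have "(2 * y)^2 < ((int R + 1) * (int Q + 1))^2" by (simp add: power2_eq_square algebra_simps)
    then have "2 * y < (int R + 1) * (int Q + 1)" by (rule power_less_imp_less_base) simp
    then obtain s t where st: "s \<noteq> 0 \<or> t \<noteq> 0" "\<bar>s\<bar> \<le> int R" "\<bar>t\<bar> \<le> int Q" "2 * y dvd s - u * t"
      using thue_lemma[of "2 * y" R Q u] y0 by auto
    have ys: "y dvd s - u * t" using st(4) by (rule dvd_mult_right)
    have "3 * s^2 + 35 * t^2 = 3 * (s + u * t) * (s - u * t) + (3 * u^2 + 35) * t^2"
      by (simp add: power2_eq_square algebra_simps)
    then have "2 * y dvd 3 * s^2 + 35 * t^2" using st(4) yu by simp
    then obtain m where m: "3 * s^2 + 35 * t^2 = 2 * y * m" by (elim dvdE)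
    have "s^2 \<le> (int R)^2" "t^2 \<le> (int Q)^2"
      using st(2,3) abs_le_square_iff[of s "int R"] abs_le_square_iff[of t "int Q"] by simp_all
    then have "2 * y * m \<le> 41 * y" using R(1) Q'(1) m by linarith
    then have "y * (2 * m) \<le> y * 41" by (simp only: mult_ac)
    then have "2 * m \<le> 41" using y0 by (simp only: mult_le_cancel_left_pos)
    then have m20: "m \<le> 20" by simp
    have "3 * s^2 + 35 * t^2 > 0"
      using st(1) zero_less_power2[of s] zero_less_power2[of t] zero_le_power2[of s] zero_le_power2[of t] by linarith
    then have m0: "m > 0" using m y0 by (simp add: zero_less_mult_iff)
    have red: "[2 * y * m = 2 * (y mod q) * (m mod q)] (mod q)" for q :: int
      by (intro cong_mult cong_refl) (simp_all add: cong_def)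
    have m3: "m mod 3 = 0 \<or> m mod 3 = 1"
    proof -
      have "(2 * (t^2 mod 3)) mod 3 = (2 * t^2 + 3 * (s^2 + 11 * t^2)) mod 3" by (simp only: mod_mult_right_eq mod_mult_self2)
      also have "2 * t^2 + 3 * (s^2 + 11 * t^2) = 2 * y * m" using m by simp
      also have "\<dots> mod 3 = 2 * (y mod 3) * (m mod 3) mod 3" using red[of 3] unfolding cong_def .
      finally have E: "(2 * (t^2 mod 3)) mod 3 = 2 * (m mod 3) mod 3" unfolding y3 by simp
      have "m mod 3 = 0 \<or> m mod 3 = 1 \<or> m mod 3 = 2" by presburger
      then show ?thesis using E square_mod_3[of t] by auto
    qed
    have m5: "m mod 5 = 0 \<or> m mod 5 = 1 \<or> m mod 5 = 4"
    proof -
      have "(3 * (s^2 mod 5)) mod 5 = (3 * s^2 + 5 * (7 * t^2)) mod 5" by (simp only: mod_mult_right_eq mod_mult_self2)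
      also have "3 * s^2 + 5 * (7 * t^2) = 2 * y * m" using m by simp
      also have "\<dots> mod 5 = 2 * (y mod 5) * (m mod 5) mod 5" using red[of 5] unfolding cong_def .
      finally have E: "(3 * (s^2 mod 5)) mod 5 = 2 * (y mod 5) * (m mod 5) mod 5" .
      from y5 square_mod_5[of s] mod_5_cases[of m] show ?thesis using E by (elim disjE) simp_all
    qed
    have m7: "m mod 7 = 0 \<or> m mod 7 = 1 \<or> m mod 7 = 2 \<or> m mod 7 = 4"
    proof -
      have "(3 * (s^2 mod 7)) mod 7 = (3 * s^2 + 7 * (5 * t^2)) mod 7" by (simp only: mod_mult_right_eq mod_mult_self2)
      also have "3 * s^2 + 7 * (5 * t^2) = 2 * y * m" using m by simp
      also have "\<dots> mod 7 = 2 * (y mod 7) * (m mod 7) mod 7" using red[of 7] unfolding cong_def .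
      finally have E: "(3 * (s^2 mod 7)) mod 7 = 2 * (y mod 7) * (m mod 7) mod 7" .
      from y7 square_mod_7[of s] mod_7_cases[of m] show ?thesis using E by (elim disjE) simp_all
    qed
    have half: "even s \<and> even t" if "3 * s^2 + 35 * t^2 = 8 * c" for s t c :: int
    proof -
      have "even (3 * s^2 + 35 * t^2)" unfolding that by simp
      then have par: "even s \<longleftrightarrow> even t" by simp
      have "\<not> (odd s \<and> odd t)"
      proof
        assume "odd s \<and> odd t"
        then obtain a b where "s^2 = 8 * a + 1" "t^2 = 8 * b + 1" using odd_square_mod_8 by metis
        then have "8 * (c - 3 * a - 35 * b) = 38" using that by simp
        then have "8 dvd (38 :: int)" by (metis dvd_triv_left)
        then show False by simp
      qed
      then show ?thesis using par by blast
    qed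
    have div2: "\<exists>s' t'. 3 * s'^2 + 35 * t'^2 = 2 * c \<and> y dvd s' - u * t'"
      if h: "3 * s^2 + 35 * t^2 = 8 * c" "y dvd s - u * t" for s t c :: int
    proof -
      obtain a b where ab: "s = 2 * a" "t = 2 * b" using half[OF h(1)] by (auto elim!: evenE)
      have "3 * a^2 + 35 * b^2 = 2 * c" using h(1) unfolding ab by (simp add: power_mult_distrib)
      moreover have "y dvd 2 * (a - u * b)" using h(2) unfolding ab by (simp add: algebra_simps)
      then have "y dvd a - u * b" using oddy coprime_dvd_mult_right_iff[of y 2 "a - u * b"] by simp
      ultimately show ?thesis by blast
    qed
    consider "m \<le> 7" | "8 \<le> m" "m \<le> 14" | "15 \<le> m" by linarith
    then have "m = 1 \<or> m = 4 \<or> m = 9 \<or> m = 15 \<or> m = 16"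
    proof cases
      case 1
      then have "m = 1 \<or> m = 2 \<or> m = 3 \<or> m = 4 \<or> m = 5 \<or> m = 6 \<or> m = 7" using m0 by linarith
      then show ?thesis using m3 m5 m7 by (elim disjE) simp_all
    next
      case 2
      then have "m = 8 \<or> m = 9 \<or> m = 10 \<or> m = 11 \<or> m = 12 \<or> m = 13 \<or> m = 14" by linarith
      then show ?thesis using m3 m5 m7 by (elim disjE) simp_all
    next
      case 3
      then have "m = 15 \<or> m = 16 \<or> m = 17 \<or> m = 18 \<or> m = 19 \<or> m = 20" using m20 by linarith
      then show ?thesis using m3 m5 m7 by (elim disjE) simp_all
    qed
    then show ?thesis
    proof (elim disjE)
      assume "m = 1"
      then show ?thesis using m ys by auto
    next
      assume "m = 4"
      then show ?thesis using div2[of s t y] m ys by simp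
    next
      assume "m = 16"
      then have "3 * s^2 + 35 * t^2 = 8 * (4 * y)" using m by simp
      then obtain s' t' where "3 * s'^2 + 35 * t'^2 = 2 * (4 * y)" "y dvd s' - u * t'" using div2 ys by blast
      then show ?thesis using div2[of s' t' y] by simp
    next
      assume m9: "m = 9"
      have "35 * t^2 = 3 * (6 * y - s^2)" using m unfolding m9 by simp
      then have "3 dvd 35 * t^2" by (metis dvd_triv_left)
      moreover have "3 dvd X" if "3 dvd 35 * X" for X :: int using that by presburger
      ultimately have "3 dvd t^2" by blast
      then have "3 dvd t" using prime_dvd_power[of 3 t 2] by simp
      then obtain b where b: "t = 3 * b" by (elim dvdE)
      have "s^2 = 3 * (2 * y - 35 * b^2)" using m unfolding m9 b by (simp add: power_mult_distrib)
      then have "3 dvd s^2" by (metis dvd_triv_left)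
      then have "3 dvd s" using prime_dvd_power[of 3 s 2] by simp
      then obtain a where a: "s = 3 * a" by (elim dvdE)
      have "3 * a^2 + 35 * b^2 = 2 * y" using m unfolding m9 a b by (simp add: power_mult_distrib)
      moreover have "y dvd 3 * (a - u * b)" using ys unfolding a b by (simp add: algebra_simps)
      moreover have "coprime y 3"
        using y3 by (metis coprime_mod_left_iff coprime_1_left zero_neq_numeral)
      ultimately show ?thesis using coprime_dvd_mult_right_iff[of y 3 "a - u * b"] by blast
    next
      assume m15: "m = 15"
      have "3 * s^2 = 5 * (6 * y - 7 * t^2)" using m unfolding m15 by simp
      then have "5 dvd 3 * s^2" by (metis dvd_triv_left)
      moreover have "5 dvd X" if "5 dvd 3 * X" for X :: int using that by presburger
      ultimately have "5 dvd s^2" by blast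
      then have "5 dvd s" using prime_dvd_power[of 5 s 2] by simp
      then obtain a where a: "s = 5 * a" by (elim dvdE)
      have E: "2 * t^2 + 5 * (3 * a^2 + t^2) = y + 5 * y" using m unfolding m15 a by (simp add: power_mult_distrib)
      have "(2 * (t^2 mod 5)) mod 5 = (2 * t^2 + 5 * (3 * a^2 + t^2)) mod 5" by (simp only: mod_mult_right_eq mod_mult_self2)
      also have "\<dots> = y mod 5" unfolding E by (simp only: mod_mult_self2)
      finally have "(2 * (t^2 mod 5)) mod 5 = y mod 5" .
      then show ?thesis using y5 square_mod_5[of t] by auto
    qed
  qed
  then obtain s t where st: "3 * s^2 + 35 * t^2 = 2 * y" "y dvd s - u * t" by blast
  interpret D: quadratic_descent 3 35 2 1 u y s t p k
    by unfold_locales (use y0 oddy eq p k0 st in simp_all)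
  have t1: "t^2 = 1" and L: "lehmer 35 y k = 1 \<or> lehmer 35 y k = - 1" using D.lehmer_pm1 by simp_all
  have s35: "3 * s^2 + 35 = 2 * y" using st(1) t1 by simp
  then have "even (3 * s^2 + 35)" by simp
  then have "odd s" by simp
  then show False using lehmer_35_prime[OF p k0 _ s35] L by blast
qed

subsection \<open>Sums of consecutive squares\<close>

lemma sums_of_squares:
  fixes x :: int
  shows "(\<Sum>i = 1..2. (x + int i)^2) = (x + 1)^2 + (x + 2)^2"
    "(\<Sum>i = 1..3. (x + int i)^2) = 3 * (x + 2)^2 + 2"
    "(\<Sum>i = 1..4. (x + int i)^2) = 4 * (x * x + 5 * x + 7) + 2"
    "(\<Sum>i = 1..5. (x + int i)^2) = 5 * ((x + 3)^2 + 2)"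
    "2 * (\<Sum>i = 1..6. (x + int i)^2) = 3 * (2 * x + 7)^2 + 35"
    "(\<Sum>i = 1..7. (x + int i)^2) = 7 * ((x + 4)^2 + 4)"
    "(\<Sum>i = 1..8. (x + int i)^2) = 2 * ((2 * x + 9)^2 + 21)"
    "(\<Sum>i = 1..9. (x + int i)^2) = 3 * (3 * (x + 5)^2 + 20)"
    "2 * (\<Sum>i = 1..10. (x + int i)^2) = 5 * ((2 * x + 11)^2 + 33)"
  by (simp_all add: eval_nat_numeral power2_eq_square algebra_simps)

lemma square_dvd_power:
  fixes q y :: int
  assumes "prime q" "q dvd y ^ n" "n \<ge> 2"
  shows "q^2 dvd y ^ n"
proof -
  have "q dvd y" using assms(1,2) by (rule prime_dvd_power)
  then have "q^2 dvd y^2" by (rule dvd_power_same)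
  moreover have "y^2 dvd y ^ n" using assms(3) by (rule le_imp_power_dvd)
  ultimately show ?thesis by (rule dvd_trans)
qed

text \<open>No prime divides an n-th power with n >= 2 exactly once. This is the obstruction for d =
  4, 5, 7 and 9.\<close>

lemma prime_dvd_cofactor_of_power:
  fixes q y :: int
  assumes "prime q" "y ^ n = q * c" "n \<ge> 2"
  shows "q dvd c"
proof -
  have "q^2 dvd q * c" using square_dvd_power[OF assms(1) _ assms(3), of y] unfolding assms(2) by simp
  moreover have "q \<noteq> 0" using assms(1) by auto
  ultimately show ?thesis by (simp add: power2_eq_square)
qed

lemma sum_3_not_power:
  fixes x y :: int
  assumes "n \<ge> 2"
  shows "(\<Sum>i = 1..3. (x + int i)^2) \<noteq> y ^ n"
proof
  assume "(\<Sum>i = 1..3. (x + int i)^2) = y ^ n"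
  then have eq: "3 * (x + 2)^2 + 2 = y ^ n" unfolding sums_of_squares by simp
  show False
  proof (cases "even n")
    case True
    then obtain j where "n = 2 * j" by (elim evenE)
    then have "y ^ n = (y ^ j)^2" by (simp add: power_mult mult.commute)
    then have "(y ^ j)^2 = 2 + 3 * (x + 2)^2" using eq by simp
    then have "(y ^ j)^2 mod 3 = 2" by (simp only: mod_mult_self2) simp
    then show False using square_mod_3[of "y ^ j"] by simp
  next
    case False
    then obtain k where "n = 2 * k + 1" by (elim oddE)
    then show False using no_power_three_squares_plus_2[OF eq, of k] assms by simp
  qed
qed

lemma sum_4_not_power:
  fixes x y :: int
  assumes "n \<ge> 2"
  shows "(\<Sum>i = 1..4. (x + int i)^2) \<noteq> y ^ n"
proof
  assume "(\<Sum>i = 1..4. (x + int i)^2) = y ^ n"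
  then have "y ^ n = 2 * (2 * (x * x + 5 * x + 7) + 1)" unfolding sums_of_squares by simp
  from prime_dvd_cofactor_of_power[OF _ this assms] show False by simp
qed

lemma sum_5_not_power:
  fixes x y :: int
  assumes "n \<ge> 2"
  shows "(\<Sum>i = 1..5. (x + int i)^2) \<noteq> y ^ n"
proof
  assume "(\<Sum>i = 1..5. (x + int i)^2) = y ^ n"
  then have "y ^ n = 5 * ((x + 3)^2 + 2)" unfolding sums_of_squares by simp
  from prime_dvd_cofactor_of_power[OF _ this assms] have "5 dvd (x + 3)^2 + 2" by simp
  then show False using square_mod_5[of "x + 3"] by presburger
qed

lemma sum_6_not_power:
  fixes x y :: int
  assumes "n \<ge> 2"
  shows "(\<Sum>i = 1..6. (x + int i)^2) \<noteq> y ^ n"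
proof
  assume "(\<Sum>i = 1..6. (x + int i)^2) = y ^ n"
  then have eq: "3 * (2 * x + 7)^2 + 35 = 2 * y ^ n" using sums_of_squares(5)[of x] by simp
  show False
  proof (cases "even n")
    case True
    then obtain j where "n = 2 * j" by (elim evenE)
    then have yj: "y ^ n = (y ^ j)^2" by (simp add: power_mult mult.commute)
    have "\<not> 7 dvd y" by (rule prime_not_dvd_of_power[OF eq assms]) simp_all
    moreover have "prime (7 :: int)" by simp
    ultimately have "\<not> 7 dvd y ^ j" using prime_dvd_power by blast
    then have "\<not> 7 dvd (y ^ j)^2" using prime_dvd_power[of "7 :: int" "y ^ j" 2] by auto
    then have n0: "(y ^ j)^2 mod 7 \<noteq> 0" by (simp add: dvd_eq_mod_eq_0)
    \<comment> \<open>Modulo 7, 3 a^2 = 2 b^2 forces b = 0, as 3 / 2 = 5 is a non-residue.\<close>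
    have "(3 * ((2 * x + 7)^2 mod 7)) mod 7 = (3 * (2 * x + 7)^2 + 7 * 5) mod 7" by (simp only: mod_mult_right_eq mod_mult_self2)
    also have "\<dots> = (2 * ((y ^ j)^2 mod 7)) mod 7" using eq unfolding yj by (simp add: mod_mult_right_eq)
    finally show False using n0 square_mod_7[of "2 * x + 7"] square_mod_7[of "y ^ j"] by (elim disjE) simp_all
  next
    case False
    then have "n \<noteq> 1" using assms by simp
    then obtain p where p: "prime p" "p dvd n" using prime_factor_nat by blast
    then obtain c where c: "n = p * c" by (elim dvdE)
    then have "odd p" using False by simp
    then obtain k where k: "p = 2 * k + 1" by (elim oddE)
    have "3 * (2 * x + 7)^2 + 35 = 2 * (y ^ c) ^ p" using eq unfolding c by (simp add: power_mult mult.commute flip: power_mult)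
    then show False using no_power_three_squares_plus_35 p(1) k by blast
  qed
qed

lemma sum_7_not_power:
  fixes x y :: int
  assumes "n \<ge> 2"
  shows "(\<Sum>i = 1..7. (x + int i)^2) \<noteq> y ^ n"
proof
  assume "(\<Sum>i = 1..7. (x + int i)^2) = y ^ n"
  then have "y ^ n = 7 * ((x + 4)^2 + 4)" unfolding sums_of_squares by simp
  from prime_dvd_cofactor_of_power[OF _ this assms] have "((x + 4)^2 + 4) mod 7 = 0" by simp
  then have "((x + 4)^2 mod 7 + 4) mod 7 = 0" by (simp only: mod_add_left_eq)
  then show False using square_mod_7[of "x + 4"] by (elim disjE) simp_all
qed

text \<open>The sum is 4 times an odd number, which leaves only n = 2. Then 2 w^2 = (2 x + 9)^2 + 21
  forces both squares to be divisible by 9, but 9 does not divide 21.\<close>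

lemma sum_8_not_power:
  fixes x y :: int
  assumes "n \<ge> 2"
  shows "(\<Sum>i = 1..8. (x + int i)^2) \<noteq> y ^ n"
proof
  assume "(\<Sum>i = 1..8. (x + int i)^2) = y ^ n"
  then have eq: "y ^ n = 2 * ((2 * x + 9)^2 + 21)" unfolding sums_of_squares by simp
  have "odd (2 * x + 9)" by simp
  then obtain e where e: "(2 * x + 9)^2 = 8 * e + 1" using odd_square_mod_8 by blast
  have eq': "y ^ n = 4 * (4 * e + 11)" using eq unfolding e by simp
  have "2 dvd y ^ n" unfolding eq' by simp
  then have ev: "even y" using assms by simp
  have "n = 2"
  proof (rule ccontr)
    assume "n \<noteq> 2"
    then have "y ^ 3 dvd y ^ n" using assms by (intro le_imp_power_dvd) simp
    moreover have "2 ^ 3 dvd y ^ 3" using ev by (rule dvd_power_same)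
    ultimately have "2 ^ 3 dvd y ^ n" by (rule dvd_trans[rotated])
    then have "4 * 2 dvd 4 * (4 * e + 11)" unfolding eq' by simp
    then have "2 dvd 4 * e + 11" by (simp only: dvd_mult_cancel_left) simp
    then show False by simp
  qed
  moreover obtain w where w: "y = 2 * w" using ev by (elim evenE)
  ultimately have E: "2 * w^2 = (2 * x + 9)^2 + 3 * 7" using eq by (simp add: power_mult_distrib)
  have "(2 * (w^2 mod 3)) mod 3 = ((2 * x + 9)^2 + 3 * 7) mod 3" unfolding E[symmetric] by (simp only: mod_mult_right_eq)
  also have "\<dots> = (2 * x + 9)^2 mod 3" by (simp only: mod_mult_self2)
  finally have "(2 * x + 9)^2 mod 3 = 0" "w^2 mod 3 = 0"
    using square_mod_3[of "2 * x + 9"] square_mod_3[of w] by auto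
  then have "3 dvd (2 * x + 9)^2" "3 dvd w^2" by auto
  moreover have "prime (3 :: int)" by simp
  ultimately have "3^2 dvd (2 * x + 9)^2" "3^2 dvd w^2" using square_dvd_power[of 3 _ 2] by auto
  then have "3^2 dvd 2 * w^2 - (2 * x + 9)^2" by (intro dvd_diff dvd_mult)
  then show False unfolding E by simp
qed

lemma sum_9_not_power:
  fixes x y :: int
  assumes "n \<ge> 2"
  shows "(\<Sum>i = 1..9. (x + int i)^2) \<noteq> y ^ n"
proof
  assume "(\<Sum>i = 1..9. (x + int i)^2) = y ^ n"
  then have "y ^ n = 3 * (3 * (x + 5)^2 + 20)" unfolding sums_of_squares by simp
  from prime_dvd_cofactor_of_power[OF _ this assms] have "3 dvd 3 * (x + 5)^2 + 20" by simp
  then show False by presburger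
qed

lemma sum_10_not_power:
  fixes x y :: int
  assumes "n \<ge> 2"
  shows "(\<Sum>i = 1..10. (x + int i)^2) \<noteq> y ^ n"
proof
  assume "(\<Sum>i = 1..10. (x + int i)^2) = y ^ n"
  then have eq: "2 * y ^ n = 5 * ((2 * x + 11)^2 + 33)" using sums_of_squares(9)[of x] by simp
  then have "5 dvd 2 * y ^ n" by simp
  then have "5 dvd y ^ n" by presburger
  then have "5^2 dvd y ^ n" using assms by (intro square_dvd_power) simp_all
  then have "5^2 dvd 2 * y ^ n" by (rule dvd_mult)
  then have "5 * 5 dvd 5 * ((2 * x + 11)^2 + 33)" unfolding eq by (simp add: power2_eq_square)
  then have "5 dvd (2 * x + 11)^2 + 33" by (simp only: dvd_mult_cancel_left) simp
  then show False using square_mod_5[of "2 * x + 11"] by presburger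
qed

lemma consecutive_squares_power_imp_2:
  fixes x y :: int
  assumes "2 \<le> d" "d \<le> 10" "n \<ge> 2" "(\<Sum>i = 1..d. (x + int i)^2) = y ^ n"
  shows "d = 2"
proof -
  have "d \<noteq> 3" using assms(3,4) sum_3_not_power by metis
  moreover
  have "d \<noteq> 4" using assms(3,4) sum_4_not_power by metis
  moreover
  have "d \<noteq> 5" using assms(3,4) sum_5_not_power by metis
  moreover
  have "d \<noteq> 6" using assms(3,4) sum_6_not_power by metis
  moreover
  have "d \<noteq> 7" using assms(3,4) sum_7_not_power by metis
  moreover
  have "d \<noteq> 8" using assms(3,4) sum_8_not_power by metis
  moreover
  have "d \<noteq> 9" using assms(3,4) sum_9_not_power by metis
  moreover
  have "d \<noteq> 10" using assms(3,4) sum_10_not_power by metis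
  ultimately show ?thesis using assms(1,2) by linarith
qed

lemma sum_2_iff: "(\<Sum>i = 1..2. (x + int i)^2) = z \<longleftrightarrow> (2 * x + 3)^2 + 1 = 2 * z"
proof -
  have "(2 * x + 3)^2 + 1 = 2 * ((x + 1)^2 + (x + 2)^2)" by (simp add: power2_eq_square algebra_simps)
  then show ?thesis unfolding sums_of_squares(1) by auto
qed

text \<open>An odd factor of n above 1 leads to \<open>odd_power_sum_squares\<close>. Otherwise n =
  2^v with v >= 2, and Ljunggren's equation applies to |y|^(n / 4). As 13 is not a square, it occurs
  only for n = 4.\<close>

lemma square_plus_1_twice_power:
  fixes u y :: int
  assumes eq: "u^2 + 1 = 2 * y ^ n" and n: "n \<ge> 3"
  shows "u^2 = 1 \<and> (y = 1 \<or> y = - 1 \<and> even n) \<or> u^2 = 239^2 \<and> n = 4 \<and> (y = 13 \<or> y = - 13)"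
proof -
  have yn: "y ^ n > 0" using eq zero_le_power2[of u] by linarith
  have unit: ?thesis if "\<bar>y\<bar> = 1"
  proof -
    have "y ^ n = 1"
    proof -
      have "\<bar>y ^ n\<bar> = 1" using that by (simp add: power_abs)
      then show ?thesis using yn by simp
    qed
    then have "u^2 = 1" using eq by simp
    moreover have "y = 1 \<or> y = - 1 \<and> even n"
      using that \<open>y ^ n = 1\<close> by (cases "even n") (auto simp: abs_if split: if_splits)
    ultimately show ?thesis by blast
  qed
  obtain v k where vk: "odd k" "n = 2 ^ v * k" by (rule pos_eq_power_2_times_odd[of n]) (use n in auto)
  show ?thesis
  proof (cases "k = 1")
    case False
    then obtain j where j: "k = 2 * j + 1" "j > 0" using vk(1) by (metis oddE gr0I mult_0_right add_0)
    have "y ^ n = (y ^ 2 ^ v) ^ k" unfolding vk(2) by (simp add: power_mult)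
    then have "y ^ 2 ^ v = 1" using odd_power_sum_squares[of u "y ^ 2 ^ v" k j] eq j by simp
    then have "\<bar>y\<bar> ^ 2 ^ v = 1" by (simp flip: power_abs)
    then have "\<bar>y\<bar> = 1" using power_eq_imp_eq_base[of "\<bar>y\<bar>" "2 ^ v" 1] by simp
    then show ?thesis by (rule unit)
  next
    case True
    have "v \<ge> 2"
    proof (rule ccontr)
      assume "\<not> v \<ge> 2"
      then have "v = 0 \<or> v = 1" by linarith
      then show False using vk(2) True n by auto
    qed
    then obtain w where w: "v = w + 2" using le_Suc_ex by (metis add.commute)
    have n4: "n = 2 ^ w * 4" unfolding vk(2) True w by (simp add: power_add)
    define z where "z = \<bar>y\<bar> ^ 2 ^ w"
    have zy: "z ^ 4 = y ^ n"
      unfolding z_def n4 power_mult[symmetric] by (simp add: power_mult flip: power_abs)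
    have "y \<noteq> 0" using yn n by (auto simp: power_0_left split: if_splits)
    then have "z > 0" unfolding z_def by simp
    then have "z = 1 \<or> z = 13" using ljunggren[of z u] eq zy by simp
    then show ?thesis
    proof
      assume "z = 1"
      then have "\<bar>y\<bar> = 1" unfolding z_def using power_eq_imp_eq_base[of "\<bar>y\<bar>" "2 ^ w" 1] by simp
      then show ?thesis by (rule unit)
    next
      assume z: "z = 13"
      have "w = 0"
      proof (rule ccontr)
        assume "w \<noteq> 0"
        then obtain w' where "w = Suc w'" by (cases w) auto
        then have "z = (\<bar>y\<bar> ^ 2 ^ w')^2" unfolding z_def by (simp add: power_mult mult.commute flip: power_mult)
        then show False using not_square_between[of 3 13 "\<bar>y\<bar> ^ 2 ^ w'"] z by simp
      qed
      then have y13: "\<bar>y\<bar> = 13" and "n = 4" using z n4 unfolding z_def by simp_all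
      moreover have "u^2 = 239^2" using eq zy z by simp
      moreover have "y = 13 \<or> y = - 13" using y13 by linarith
      ultimately show ?thesis by blast
    qed
  qed
qed

section \<open>Solutions with exponent two\<close>

lemma square_eq_twice_square:
  fixes a b :: int
  assumes "a^2 = 2 * b^2"
  shows "b = 0"
  using assms
proof (induction "nat \<bar>b\<bar>" arbitrary: a b rule: less_induct)
  case less
  show ?case
  proof (rule ccontr)
    assume b: "b \<noteq> 0"
    have "even (a^2)" using less.prems by simp
    then obtain c where c: "a = 2 * c" by (auto elim: evenE)
    then have b2: "b^2 = 2 * c^2" using less.prems by (simp add: power_mult_distrib)
    then have "even (b^2)" by simp
    then obtain e where e: "b = 2 * e" by (auto elim: evenE)
    then have "c^2 = 2 * e^2" using b2 by (simp add: power_mult_distrib)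
    moreover have "nat \<bar>e\<bar> < nat \<bar>b\<bar>" using e b by simp
    ultimately have "e = 0" using less.hyps by blast
    then show False using e b by simp
  qed
qed

lemma sqrt_2_independent:
  assumes "real_of_int a + real_of_int b * sqrt 2 = real_of_int c + real_of_int d * sqrt 2"
  shows "a = c \<and> b = d"
proof -
  have "real_of_int (a - c) = real_of_int (d - b) * sqrt 2" using assms by (simp add: algebra_simps)
  then have "(real_of_int (a - c))^2 = (real_of_int (d - b) * sqrt 2)^2" by simp
  also have "\<dots> = 2 * (real_of_int (d - b))^2" by (simp add: power_mult_distrib)
  finally have "real_of_int ((a - c)^2) = real_of_int (2 * (d - b)^2)" by simp
  then have "(a - c)^2 = 2 * (d - b)^2" by (simp only: of_int_eq_iff)
  then have "d - b = 0" by (rule square_eq_twice_square)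
  then show ?thesis using assms by simp
qed

text \<open>The norm a^2 - 2 b^2 = -1 makes -a + b sqrt 2 the inverse of a + b sqrt 2.\<close>

lemma pell_unit_power_neg:
  "real_of_int (- fst (pell n)) + real_of_int (snd (pell n)) * sqrt 2 = (1 + sqrt 2) powi (- int (2 * n + 1))"
proof -
  define a b where "a = real_of_int (fst (pell n))" and "b = real_of_int (snd (pell n))"
  have "a^2 + 1 = 2 * b^2"
    using arg_cong[OF pell_solution[of n], of real_of_int] unfolding a_def b_def by simp
  then have "(b * sqrt 2 - a) * (a + b * sqrt 2) = 1"
    by (simp add: algebra_simps power2_eq_square)
  moreover have "a + b * sqrt 2 > 0"
    unfolding a_def b_def using pell_pos[of n] by (intro add_pos_pos mult_pos_pos) auto
  ultimately have "b * sqrt 2 - a = inverse (a + b * sqrt 2)"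
    by (simp add: field_simps)
  moreover have "(1 + sqrt 2) powi (- int (2 * n + 1)) = inverse ((1 + sqrt 2) ^ (2 * n + 1))"
    by (simp only: power_int_minus power_int_of_nat)
  ultimately show ?thesis using pell_unit_power[of n] unfolding a_def b_def by simp
qed

lemma odd_powi_cases:
  obtains n where "(1 + sqrt 2) powi (2 * r + 1) = real_of_int (fst (pell n)) + real_of_int (snd (pell n)) * sqrt 2"
  | n where "(1 + sqrt 2) powi (2 * r + 1) = real_of_int (- fst (pell n)) + real_of_int (snd (pell n)) * sqrt 2"
proof (cases "r \<ge> 0")
  case True
  then have "2 * r + 1 = int (2 * nat r + 1)" by simp
  then have "(1 + sqrt 2) powi (2 * r + 1) = (1 + sqrt 2) ^ (2 * nat r + 1)" by (simp only: power_int_of_nat)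
  then show ?thesis using that(1) pell_unit_power by metis
next
  case False
  then have "2 * r + 1 = - int (2 * nat (- r - 1) + 1)" by simp
  then show ?thesis using that(2) pell_unit_power_neg by metis
qed

lemma negative_pell_iff:
  fixes u y :: int
  shows "u^2 + 1 = 2 * y^2 \<longleftrightarrow> (\<exists>r :: int.
    real_of_int u + real_of_int y * sqrt 2 = (1 + sqrt 2) powi (2 * r + 1) \<or>
    real_of_int u + real_of_int y * sqrt 2 = - ((1 + sqrt 2) powi (2 * r + 1)))"
proof
  let ?v = "real_of_int u + real_of_int y * sqrt 2"
  assume eq: "u^2 + 1 = 2 * y^2"
  have "u \<noteq> 0"
  proof
    assume "u = 0"
    then have "2 * y^2 = 1" using eq by simp
    then show False by presburger
  qed
  moreover have "y \<noteq> 0"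
  proof
    assume "y = 0"
    then show False using eq zero_le_power2[of u] by simp
  qed
  ultimately obtain n where n: "pell n = (\<bar>u\<bar>, \<bar>y\<bar>)" using pell_complete[of "\<bar>u\<bar>" "\<bar>y\<bar>"] eq by auto
  have p: "real_of_int \<bar>u\<bar> + real_of_int \<bar>y\<bar> * sqrt 2 = (1 + sqrt 2) powi (2 * int n + 1)"
  proof -
    have "2 * int n + 1 = int (2 * n + 1)" by simp
    then show ?thesis using pell_unit_power[of n] n by (simp only: power_int_of_nat fst_conv snd_conv)
  qed
  have m: "real_of_int (- \<bar>u\<bar>) + real_of_int \<bar>y\<bar> * sqrt 2 = (1 + sqrt 2) powi (2 * (- int n - 1) + 1)"
  proof -
    have "2 * (- int n - 1) + 1 = - int (2 * n + 1)" by simp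
    then show ?thesis using pell_unit_power_neg[of n] n by (simp only: fst_conv snd_conv)
  qed
  have neg: "U + Y * q = - (U' + Y' * q)" if "U = - U'" "Y = - Y'" for U Y U' Y' q :: real
    using that by (simp add: algebra_simps)
  \<comment> \<open>The outer sign makes the second entry positive; the sign of the first then
    decides between the exponents 2 n + 1 and -(2 n + 1).\<close>
  consider "u = \<bar>u\<bar>" "y = \<bar>y\<bar>" | "u = - \<bar>u\<bar>" "y = - \<bar>y\<bar>" | "u = \<bar>u\<bar>" "y = - \<bar>y\<bar>" | "u = - \<bar>u\<bar>" "y = \<bar>y\<bar>"
    by linarith
  then show "\<exists>r :: int. ?v = (1 + sqrt 2) powi (2 * r + 1) \<or>
    ?v = - ((1 + sqrt 2) powi (2 * r + 1))"
  proof cases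
    case 1
    then show ?thesis using p by metis
  next
    case 2
    have "?v = - (real_of_int \<bar>u\<bar> + real_of_int \<bar>y\<bar> * sqrt 2)"
      by (rule neg) (use 2 in linarith)+
    then show ?thesis unfolding p by blast
  next
    case 3
    have "?v = - (real_of_int (- \<bar>u\<bar>) + real_of_int \<bar>y\<bar> * sqrt 2)"
      by (rule neg) (use 3 in linarith)+
    then show ?thesis unfolding m by blast
  next
    case 4
    then show ?thesis using m by metis
  qed
next
  let ?v = "real_of_int u + real_of_int y * sqrt 2"
  assume "\<exists>r :: int. ?v = (1 + sqrt 2) powi (2 * r + 1) \<or>
    ?v = - ((1 + sqrt 2) powi (2 * r + 1))"
  then obtain r :: int and \<epsilon> :: int where r: "?v = of_int \<epsilon> * (1 + sqrt 2) powi (2 * r + 1)"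
    and e: "\<epsilon> = 1 \<or> \<epsilon> = - 1"
    by (metis mult_1 mult_minus1 of_int_1 of_int_minus)
  have key: "u^2 + 1 = 2 * y^2" if "(1 + sqrt 2) powi (2 * r + 1) = real_of_int a + real_of_int b * sqrt 2" "a^2 + 1 = 2 * b^2" for a b
  proof -
    have "?v = real_of_int (\<epsilon> * a) + real_of_int (\<epsilon> * b) * sqrt 2"
      unfolding r that(1) by (simp add: algebra_simps)
    then have "u = \<epsilon> * a \<and> y = \<epsilon> * b" by (rule sqrt_2_independent)
    then show ?thesis using e that(2) by (auto simp: power_mult_distrib)
  qed
  show "u^2 + 1 = 2 * y^2"
  proof (rule odd_powi_cases[of r])
    fix n assume "(1 + sqrt 2) powi (2 * r + 1) = real_of_int (fst (pell n)) + real_of_int (snd (pell n)) * sqrt 2"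
    then show ?thesis by (rule key) (rule pell_solution)
  next
    fix n assume "(1 + sqrt 2) powi (2 * r + 1) = real_of_int (- fst (pell n)) + real_of_int (snd (pell n)) * sqrt 2"
    then show ?thesis by (rule key) (simp add: pell_solution)
  qed
qed

lemma infinite_square_sums:
  "infinite {(d :: nat, x :: int, y :: int, n :: nat). 2 \<le> d \<and> d \<le> 10 \<and> n = 2 \<and>
            (\<Sum>i = 1..d. (x + int i)^2) = y ^ n}"
proof -
  \<comment> \<open>2 x + 3 has to be \<open>fst (pell j)\<close>, which is odd, so the division is
    exact.\<close>
  define F where "F = (\<lambda>j. (2 :: nat, (fst (pell j) - 3) div 2, snd (pell j), 2 :: nat))"
  have "strict_mono (\<lambda>j. snd (pell j))"
    unfolding strict_mono_Suc_iff
  proof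
    fix j
    show "snd (pell j) < snd (pell (Suc j))" using pell_pos[of j] by simp
  qed
  then have "inj (\<lambda>j. snd (pell j))" by (rule strict_mono_imp_inj_on)
  then have "inj F" unfolding F_def inj_def by auto
  then have "infinite (range F)" using finite_imageD by blast
  moreover have "range F \<subseteq> {(d, x, y, n). 2 \<le> d \<and> d \<le> 10 \<and> n = 2 \<and> (\<Sum>i = 1..d. (x + int i)^2) = y ^ n}"
  proof
    fix z assume "z \<in> range F"
    then obtain j where z: "z = F j" by blast
    have "odd (fst (pell j))" using odd_of_square_plus_1[OF pell_solution[of j]] .
    then have "2 * ((fst (pell j) - 3) div 2) + 3 = fst (pell j)" by presburger
    then have "(\<Sum>i = 1..2. ((fst (pell j) - 3) div 2 + int i)^2) = (snd (pell j))^2"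
      unfolding sum_2_iff using pell_solution[of j] by simp
    then show "z \<in> {(d, x, y, n). 2 \<le> d \<and> d \<le> 10 \<and> n = 2 \<and> (\<Sum>i = 1..d. (x + int i)^2) = y ^ n}"
      unfolding z F_def by (simp del: One_nat_def)
  qed
  ultimately show ?thesis using finite_subset by blast
qed

theorem theorem1:
  shows "{(d :: nat, x :: int, y :: int, n :: nat). 2 \<le> d \<and> d \<le> 10 \<and> 3 \<le> n \<and>
            (\<Sum>i = 1..d. (x + int i)\<^sup>2) = y ^ n}
         = {(2, - 1, y, 2 * r) | y r. y \<in> {1, - 1} \<and> 3 \<le> 2 * r}
           \<union> {(2, - 2, y, 2 * r) | y r. y \<in> {1, - 1} \<and> 3 \<le> 2 * r}
           \<union> {(2, - 1, 1, 2 * r + 1) | r. 3 \<le> 2 * r + 1}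
           \<union> {(2, - 2, 1, 2 * r + 1) | r. 3 \<le> 2 * r + 1}
           \<union> {(2, 118, 13, 4), (2, 118, - 13, 4), (2, - 121, 13, 4), (2, - 121, - 13, 4)}
         \<and>
         {(d :: nat, x :: int, y :: int, n :: nat). 2 \<le> d \<and> d \<le> 10 \<and> n = 2 \<and>
            (\<Sum>i = 1..d. (x + int i)\<^sup>2) = y ^ n}
         = {(2, x, y, 2) | x y. \<exists>r :: int.
              real_of_int (2 * x + 3) + real_of_int y * sqrt 2 = (1 + sqrt 2) powi (2 * r + 1) \<or>
              real_of_int (2 * x + 3) + real_of_int y * sqrt 2 = - ((1 + sqrt 2) powi (2 * r + 1))}
         \<and>
         infinite {(d :: nat, x :: int, y :: int, n :: nat). 2 \<le> d \<and> d \<le> 10 \<and> n = 2 \<and>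
            (\<Sum>i = 1..d. (x + int i)\<^sup>2) = y ^ n}"
    (is "?A = ?B \<and> ?C = ?D \<and> _")
proof (intro conjI)
  show "?A = ?B"
  proof (intro equalityI subsetI)
    fix z assume "z \<in> ?A"
    then obtain d x y n where z: "z = (d, x, y, n)" and h: "2 \<le> d" "d \<le> 10" "3 \<le> n" "(\<Sum>i = 1..d. (x + int i)^2) = y ^ n"
      by auto
    have d: "d = 2" using consecutive_squares_power_imp_2[OF h(1,2) _ h(4)] h(3) by simp
    have eq: "(2 * x + 3)^2 + 1 = 2 * y ^ n" using h(4) unfolding d sum_2_iff .
    from square_plus_1_twice_power[OF eq h(3)] show "z \<in> ?B"
    proof (elim disjE[where P = "_ \<and> _"] conjE)
      assume "(2 * x + 3)^2 = 1" and y: "y = 1 \<or> y = - 1 \<and> even n"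
      then have "2 * x + 3 = 1 \<or> 2 * x + 3 = - 1" by (simp add: power2_eq_1_iff)
      then have x: "x = - 1 \<or> x = - 2" by linarith
      show ?thesis
      proof (cases "even n")
        case True
        then obtain r where "n = 2 * r" by (elim evenE)
        then show ?thesis using x y h(3) unfolding z d by auto
      next
        case False
        then obtain r where "n = 2 * r + 1" by (elim oddE)
        then show ?thesis using x y h(3) unfolding z d by auto
      qed
    next
      assume "(2 * x + 3)^2 = 239^2" and n: "n = 4" and y: "y = 13 \<or> y = - 13"
      then have "2 * x + 3 = 239 \<or> 2 * x + 3 = - 239" by (simp only: power2_eq_iff)
      then have "x = 118 \<or> x = - 121" by linarith
      then show ?thesis using n y unfolding z d by auto
    qed
  next
    have mem: "(2, x, y, n) \<in> ?A \<longleftrightarrow> 3 \<le> n \<and> (2 * x + 3)^2 + 1 = 2 * y ^ n" for x y n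
      by (simp add: sum_2_iff del: One_nat_def)
    fix z assume "z \<in> ?B"
    then show "z \<in> ?A"
    proof (elim UnE)
      assume "z \<in> {(2, - 1, y, 2 * r) | y r. y \<in> {1, - 1} \<and> 3 \<le> 2 * r}"
      then obtain y r where z: "z = (2, - 1, y, 2 * r)" "y \<in> {1, - 1}" "3 \<le> 2 * r" by blast
      show ?thesis unfolding z(1) mem using z(2,3) by (auto simp: power_mult)
    next
      assume "z \<in> {(2, - 2, y, 2 * r) | y r. y \<in> {1, - 1} \<and> 3 \<le> 2 * r}"
      then obtain y r where z: "z = (2, - 2, y, 2 * r)" "y \<in> {1, - 1}" "3 \<le> 2 * r" by blast
      show ?thesis unfolding z(1) mem using z(2,3) by (auto simp: power_mult)
    next
      assume "z \<in> {(2, - 1, 1, 2 * r + 1) | r. 3 \<le> 2 * r + 1}"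
      then obtain r where z: "z = (2, - 1, 1, 2 * r + 1)" "3 \<le> 2 * r + 1" by blast
      show ?thesis unfolding z(1) mem using z(2) by simp
    next
      assume "z \<in> {(2, - 2, 1, 2 * r + 1) | r. 3 \<le> 2 * r + 1}"
      then obtain r where z: "z = (2, - 2, 1, 2 * r + 1)" "3 \<le> 2 * r + 1" by blast
      show ?thesis unfolding z(1) mem using z(2) by simp
    next
      assume "z \<in> {(2, 118, 13, 4), (2, 118, - 13, 4), (2, - 121, 13, 4), (2, - 121, - 13, 4)}"
      then consider "z = (2, 118, 13, 4)" | "z = (2, 118, - 13, 4)" | "z = (2, - 121, 13, 4)" | "z = (2, - 121, - 13, 4)"
        by blast
      then show ?thesis by cases (simp_all only: mem, simp_all)
    qed
  qed
next
  show "?C = ?D"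
  proof (intro equalityI subsetI)
    fix z assume "z \<in> ?C"
    then obtain d x y where z: "z = (d, x, y, 2)" and h: "2 \<le> d" "d \<le> 10" "(\<Sum>i = 1..d. (x + int i)^2) = y ^ 2"
      by auto
    have d: "d = 2" using consecutive_squares_power_imp_2[OF h(1,2) _ h(3)] by simp
    have "(2 * x + 3)^2 + 1 = 2 * y^2" using h(3) unfolding d sum_2_iff .
    then show "z \<in> ?D" unfolding negative_pell_iff z d by blast
  next
    fix z assume "z \<in> ?D"
    then obtain x y where z: "z = (2, x, y, 2)" and "(2 * x + 3)^2 + 1 = 2 * y^2"
      unfolding negative_pell_iff by blast
    then show "z \<in> ?C" by (simp add: sum_2_iff del: One_nat_def)
  qed
next
  show "infinite ?C" by (rule infinite_square_sums)
qed

end
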